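(* Let $[A,B]$ be a finite interval, let $q:[A,B]\to\mathbb{C}$ be continuous, and let $p,r:[A,B]\to\mathbb{R}$ be such that $p,p',r,r'$ are absolutely continuous on $[A,B]$ and $p(y)>0$, $r(y)>0$ for all $y\in[A,B]$. Put $\rho(y)=(p(y)r(y))^{1/4}$, $l(y)=\int_A^y\{r(s)/p(s)\}^{1/2}ds$ and $b=l(B)$. Let $g$ be a (in general complex-valued) solution of $(p(y)g')'-q(y)g=0$ on $[A,B]$ such that $g(A)=1/\rho(A)$ and $g(y)\neq 0$ for all $y\in[A,B]$. Let $\Phi_k$ be the formal powers constructed from $p,r,g$ as in the context, and for $n=0,1,2,\ldots$ set $$\alpha_n(y)=\frac{2n+1}{2}\left(\sum_{k=0}^n\frac{l_{k,n}\Phi_k(y)}{l^k(y)}-\frac{1}{\rho(y)}\right),$$ where $l_{k,n}$ is the coefficient of $x^k$ in the Legendre polynomial of order $n$. Then for every $\omega\in\mathbb{C}$, $\omega\neq0$, two linearly independent solutions $v_1$ and $v_2$ of the equation $$(p(y)v')'-q(y)v=-\omega^2 r(y)v,\qquad y\in[A,B],$$ can be written in the form $$v_1(\omega,y)=\frac{\cos(\omega l(y))}{\rho(y)}+2\sum_{n=0}^\infty(-1)^n\alpha_{2n}(y)j_{2n}(\omega l(y)),$$ $$v_2(\omega,y)=\frac{\sin(\omega l(y))}{\rho(y)}+2\sum_{n=0}^\infty(-1)^n\alpha_{2n+1}(y)j_{2n+1}(\omega l(y)).$$ These solutions satisfy the initial conditions $$v_1(\omega,A)=\frac{1}{\rho(A)},\quad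 v_2(\omega,A)=0,\quad v_1'(\omega,A)=g'(A),\quad v_2'(\omega,A)=\frac{\omega}{\rho(A)}\sqrt{\frac{r(A)}{p(A)}}.$$ Both series converge uniformly with respect to $y$ on $[A,B]$ and converge uniformly with respect to $\omega$ on any compact subset of the complex plane of the variable $\omega$. Moreover, let $$v_1^N(\omega,y)=\frac{\cos(\omega l(y))}{\rho(y)}+2\sum_{n=0}^{[N/2]}(-1)^n\alpha_{2n}(y)j_{2n}(\omega l(y)),$$ $$v_2^N(\omega,y)=\frac{\sin(\omega l(y))}{\rho(y)}+2\sum_{n=0}^{[(N-1)/2]}(-1)^n\alpha_{2n+1}(y)j_{2n+1}(\omega l(y)).$$ Then there exist nonnegative functions $\varepsilon_N$ on $[0,b]$, not depending on $\omega$ or on the constant $C$ below, with $\varepsilon_N(x)\to0$ as $N\to\infty$, such that for $i=1,2$ and all $y\in[A,B]$ $$|v_i(\omega,y)-v_i^N(\omega,y)|\le\sqrt{2l(y)}\,\varepsilon_N(l(y))\max_{y\in[A,B]}\frac{1}{|\rho(y)|}$$ for any $\omega\in\mathbb{R}$, $\omega\ne0$, and $$|v_i(\omega,y)-v_i^N(\omega,y)|\le\varepsilon_N(l(y))\sqrt{\frac{\sinh(2Cl(y))}{C}}\max_{y\in[A,B]}\frac{1}{|\rho(y)|}$$ for any $\omega\in\mathbb{C}$, $\omega\neq0$, belonging to the strip $|\operatorname{Im}\omega|\le C$, $C\ge0$.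
   Context: Primes denote derivatives with respect to $y$. $j_k$ denotes the spherical Bessel function of order $k$, and $[\cdot]$ is the integer part (floor); empty sums are zero. Formal powers. Set $Y^{(0)}\equiv\widetilde Y^{(0)}\equiv1$ and, for $n\ge1$, $$Y^{(n)}(y)=\begin{cases} n\int_A^y Y^{(n-1)}(s)\frac{1}{g^2(s)p(s)}ds,& n\text{ odd},\\ n\int_A^y Y^{(n-1)}(s)g^2(s)r(s)ds,& n\text{ even},\end{cases}$$ $$\widetilde Y^{(n)}(y)=\begin{cases} n\int_A^y\widetilde Y^{(n-1)}(s)g^2(s)r(s)ds,& n\text{ odd},\\ n\int_A^y\widetilde Y^{(n-1)}(s)\frac{1}{g^2(s)p(s)}ds,& n\text{ even}.\end{cases}$$ Then $\Phi_k(y)=g(y)Y^{(k)}(y)$ for $k$ odd and $\Phi_k(y)=g(y)\widetilde Y^{(k)}(y)$ for $k$ even, $k=0,1,2,\ldots$. Conventions: at $y=A$, where $l(A)=0$, the value $\alpha_n(A)$ is understood as the limit of $\alpha_n(y)$ as $y\to A$; for $C=0$ the quantity $\sinh(2Cx)/C$ is understood as its limit $2x$. *)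

theory Defs
  imports
    "HOL-Analysis.Analysis"
    "HOL-Computational_Algebra.Polynomial"
begin

text \<open>Absolute continuity on \<open>[A,B]\<close>. The members of a division are non-overlapping nonempty
  compact intervals, so \<open>d\<close> ranges over the finite families of non-overlapping subintervals.\<close>

definition abs_continuous_on_interval :: "real \<Rightarrow> real \<Rightarrow> (real \<Rightarrow> real) \<Rightarrow> bool" where
  "abs_continuous_on_interval A B f \<longleftrightarrow>
     (\<forall>\<epsilon>>0. \<exists>\<delta>>0. \<forall>d t. d division_of t \<and> t \<subseteq> {A..B} \<and> (\<Sum>K\<in>d. Sup K - Inf K) < \<delta>
        \<longrightarrow> (\<Sum>K\<in>d. \<bar>f (Sup K) - f (Inf K)\<bar>) < \<epsilon>)"

text \<open>Classical solution on \<open>[A,B]\<close>, with one-sided derivatives at the end points, of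
  \<open>(p v')' - q v = f\<close>.\<close>

definition sl_solves ::
  "real \<Rightarrow> real \<Rightarrow> (real \<Rightarrow> real) \<Rightarrow> (real \<Rightarrow> complex) \<Rightarrow> (real \<Rightarrow> complex) \<Rightarrow> (real \<Rightarrow> complex) \<Rightarrow> bool" where
  "sl_solves A B p q f v \<longleftrightarrow>
     (\<exists>v' w. \<forall>y\<in>{A..B}.
        (v has_vector_derivative v' y) (at y within {A..B}) \<and>
        ((\<lambda>s. complex_of_real (p s) * v' s) has_vector_derivative w y) (at y within {A..B}) \<and>
        w y - q y * v y = f y)"

text \<open>Rodrigues' formula.\<close>

definition legendre_poly :: "nat \<Rightarrow> real poly" where
  "legendre_poly n = smult (1 / (2 ^ n * fact n)) ((pderiv ^^ n) ([:-1, 0, 1:] ^ n))"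

text \<open>The spherical Bessel function \<open>j\<^sub>k(z) = (\<pi>/(2z))\<^sup>1\<^sup>/\<^sup>2 J\<^sub>\<nu>(z)\<close> with \<open>\<nu> = k + 1/2\<close>. In the series
  \<open>J\<^sub>\<nu>(z) = \<Sum>\<^sub>m (-1)\<^sup>m / (m! \<Gamma>(m + \<nu> + 1)) (z/2)\<^sup>2\<^sup>m\<^sup>+\<^sup>\<nu>\<close> the factor \<open>(z/2)\<^sup>1\<^sup>/\<^sup>2\<close> cancels against
  \<open>(\<pi>/(2z))\<^sup>1\<^sup>/\<^sup>2\<close> leaving \<open>\<surd>\<pi>/2\<close>; this gives the entire function, without branch cuts and including
  the value at \<open>0\<close>.\<close>

definition spherical_bessel_j :: "nat \<Rightarrow> complex \<Rightarrow> complex" where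
  "spherical_bessel_j k z =
     complex_of_real (sqrt pi / 2) *
     (\<Sum>m. complex_of_real ((-1) ^ m / (fact m * Gamma (real m + real k + 3 / 2))) * (z / 2) ^ (2 * m + k))"

definition sl_rho :: "(real \<Rightarrow> real) \<Rightarrow> (real \<Rightarrow> real) \<Rightarrow> real \<Rightarrow> real" where
  "sl_rho p r y = (p y * r y) powr (1 / 4)"

definition sl_l :: "real \<Rightarrow> (real \<Rightarrow> real) \<Rightarrow> (real \<Rightarrow> real) \<Rightarrow> real \<Rightarrow> real" where
  "sl_l A p r y = integral {A..y} (\<lambda>s. sqrt (r s / p s))"

text \<open>\<open>formal_Y\<close> and \<open>formal_Yt\<close> are the two families of iterated integrals (without and with
  tilde).\<close>

primrec formal_Y ::
  "real \<Rightarrow> (real \<Rightarrow> real) \<Rightarrow> (real \<Rightarrow> real) \<Rightarrow> (real \<Rightarrow> complex) \<Rightarrow> nat \<Rightarrow> real \<Rightarrow> complex" where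
  "formal_Y A p r g 0 = (\<lambda>y. 1)"
| "formal_Y A p r g (Suc n) = (\<lambda>y. of_nat (Suc n) *
     integral {A..y} (\<lambda>s. formal_Y A p r g n s *
       (if odd (Suc n) then 1 / ((g s)\<^sup>2 * complex_of_real (p s))
        else (g s)\<^sup>2 * complex_of_real (r s))))"

primrec formal_Yt ::
  "real \<Rightarrow> (real \<Rightarrow> real) \<Rightarrow> (real \<Rightarrow> real) \<Rightarrow> (real \<Rightarrow> complex) \<Rightarrow> nat \<Rightarrow> real \<Rightarrow> complex" where
  "formal_Yt A p r g 0 = (\<lambda>y. 1)"
| "formal_Yt A p r g (Suc n) = (\<lambda>y. of_nat (Suc n) *
     integral {A..y} (\<lambda>s. formal_Yt A p r g n s *
       (if odd (Suc n) then (g s)\<^sup>2 * complex_of_real (r s)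
        else 1 / ((g s)\<^sup>2 * complex_of_real (p s)))))"

definition formal_Phi ::
  "real \<Rightarrow> (real \<Rightarrow> real) \<Rightarrow> (real \<Rightarrow> real) \<Rightarrow> (real \<Rightarrow> complex) \<Rightarrow> nat \<Rightarrow> real \<Rightarrow> complex" where
  "formal_Phi A p r g k y =
     g y * (if odd k then formal_Y A p r g k y else formal_Yt A p r g k y)"

text \<open>\<open>alpha_formula\<close> is meaningful for \<open>y > A\<close> only, since \<open>l(A) = 0\<close>; \<open>alpha\<close> takes the limit there.\<close>

definition alpha_formula ::
  "real \<Rightarrow> (real \<Rightarrow> real) \<Rightarrow> (real \<Rightarrow> real) \<Rightarrow> (real \<Rightarrow> complex) \<Rightarrow> nat \<Rightarrow> real \<Rightarrow> complex" where
  "alpha_formula A p r g n y =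
     complex_of_real ((2 * real n + 1) / 2) *
     ((\<Sum>k\<le>n. complex_of_real (coeff (legendre_poly n) k) * formal_Phi A p r g k y
                 / complex_of_real (sl_l A p r y) ^ k)
      - 1 / complex_of_real (sl_rho p r y))"

definition alpha ::
  "real \<Rightarrow> (real \<Rightarrow> real) \<Rightarrow> (real \<Rightarrow> real) \<Rightarrow> (real \<Rightarrow> complex) \<Rightarrow> nat \<Rightarrow> real \<Rightarrow> complex" where
  "alpha A p r g n y =
     (if y = A then Lim (at_right A) (alpha_formula A p r g n) else alpha_formula A p r g n y)"

definition term1 ::
  "real \<Rightarrow> (real \<Rightarrow> real) \<Rightarrow> (real \<Rightarrow> real) \<Rightarrow> (real \<Rightarrow> complex) \<Rightarrow> complex \<Rightarrow> real \<Rightarrow> nat \<Rightarrow> complex" where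
  "term1 A p r g \<omega> y n =
     (-1) ^ n * alpha A p r g (2 * n) y
     * spherical_bessel_j (2 * n) (\<omega> * complex_of_real (sl_l A p r y))"

definition term2 ::
  "real \<Rightarrow> (real \<Rightarrow> real) \<Rightarrow> (real \<Rightarrow> real) \<Rightarrow> (real \<Rightarrow> complex) \<Rightarrow> complex \<Rightarrow> real \<Rightarrow> nat \<Rightarrow> complex" where
  "term2 A p r g \<omega> y n =
     (-1) ^ n * alpha A p r g (2 * n + 1) y
     * spherical_bessel_j (2 * n + 1) (\<omega> * complex_of_real (sl_l A p r y))"

definition v1 ::
  "real \<Rightarrow> (real \<Rightarrow> real) \<Rightarrow> (real \<Rightarrow> real) \<Rightarrow> (real \<Rightarrow> complex) \<Rightarrow> complex \<Rightarrow> real \<Rightarrow> complex" where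
  "v1 A p r g \<omega> y =
     cos (\<omega> * complex_of_real (sl_l A p r y)) / complex_of_real (sl_rho p r y)
     + 2 * (\<Sum>n. term1 A p r g \<omega> y n)"

definition v2 ::
  "real \<Rightarrow> (real \<Rightarrow> real) \<Rightarrow> (real \<Rightarrow> real) \<Rightarrow> (real \<Rightarrow> complex) \<Rightarrow> complex \<Rightarrow> real \<Rightarrow> complex" where
  "v2 A p r g \<omega> y =
     sin (\<omega> * complex_of_real (sl_l A p r y)) / complex_of_real (sl_rho p r y)
     + 2 * (\<Sum>n. term2 A p r g \<omega> y n)"

definition v1_approx ::
  "real \<Rightarrow> (real \<Rightarrow> real) \<Rightarrow> (real \<Rightarrow> real) \<Rightarrow> (real \<Rightarrow> complex) \<Rightarrow> nat \<Rightarrow> complex \<Rightarrow> real \<Rightarrow> complex" where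
  "v1_approx A p r g N \<omega> y =
     cos (\<omega> * complex_of_real (sl_l A p r y)) / complex_of_real (sl_rho p r y)
     + 2 * (\<Sum>n\<le>N div 2. term1 A p r g \<omega> y n)"

text \<open>The upper summation limit is \<open>[(N-1)/2]\<close>; it equals \<open>-1\<close> (empty sum) for \<open>N = 0\<close>, which
  truncated subtraction on \<^typ>\<open>nat\<close> would not give.\<close>

definition v2_approx ::
  "real \<Rightarrow> (real \<Rightarrow> real) \<Rightarrow> (real \<Rightarrow> real) \<Rightarrow> (real \<Rightarrow> complex) \<Rightarrow> nat \<Rightarrow> complex \<Rightarrow> real \<Rightarrow> complex" where
  "v2_approx A p r g N \<omega> y =
     sin (\<omega> * complex_of_real (sl_l A p r y)) / complex_of_real (sl_rho p r y)
     + 2 * (\<Sum>n<(N + 1) div 2. term2 A p r g \<omega> y n)"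

text \<open>\<open>sinh(2Cx)/C\<close>, read as its limit \<open>2x\<close> for \<open>C = 0\<close>.\<close>

definition sinh_quot :: "real \<Rightarrow> real \<Rightarrow> real" where
  "sinh_quot C x = (if C = 0 then 2 * x else sinh (2 * C * x) / C)"

text \<open>The maximum over \<open>[A,B]\<close> is written as a supremum (\<^const>\<open>Max\<close> is for finite sets); it is
  attained because \<open>\<rho>\<close> is continuous and positive on \<open>[A,B]\<close>.\<close>

definition max_inv_rho :: "real \<Rightarrow> real \<Rightarrow> (real \<Rightarrow> real) \<Rightarrow> (real \<Rightarrow> real) \<Rightarrow> real" where
  "max_inv_rho A B p r = (SUP y\<in>{A..B}. 1 / \<bar>sl_rho p r y\<bar>)"

end

(* Write Phi_k = g X_k and let Z_k be the dual formal powers; then X_k' = k Z_(k-1) / (g^2 p) and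
   Z_k' = k X_(k-1) g^2 r, so that g * sum_k (i omega)^k X_k / k! solves the equation, and v1, v2 are
   the even and odd parts of this series in omega.  For fixed y the map t^k |-> Phi_k(y) is thus a
   functional on polynomials which sends e^(i omega t) to a solution.  Its difference from evaluation
   at l(y) divided by rho(y) is bounded on L^1(-l(y), l(y)): extending it to translates of a
   polynomial gives a solution of a wave equation, written as a first order system whose Riemann
   invariants are estimated along characteristics; the first order form avoids the potential of the
   Liouville normal form, which is merely integrable.  Expanding e^(i omega t) in Legendre
   polynomials, whose coefficients are spherical Bessel functions, gives the series; the error
   estimate is the Cauchy-Schwarz inequality combined with Bessel's inequality for the functional
   and for the exponential. *)
theory Submission
  imports Defs
begin

subsection \<open>Legendre polynomials\<close>

text \<open>No transmutation kernel is constructed: only its action on polynomials is used. An L^1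
  bound there implies an L^2 bound on [-1,1], and testing the functional on a finite Legendre sum
  then gives Bessel's inequality without completeness or Parseval. The variable is scaled by l(y),
  so that one interval serves every y. Since P_n(1) = 1, the term 1/rho in alpha_n is an evaluation
  at the end point, and alpha_n is (2n+1)/2 times the value of the functional on P_n. The bound of
  the functional is a constant times l(y); hence alpha_n(y) tends to 0 at A. Passing from powers of
  omega to Bessel functions exchanges two limits; the exchange rests on the moments of x^k against
  P_n being nonnegative, so that a Bessel function at an imaginary argument dominates all partial
  sums. Finally sinh(2Cx)/C is the integral of |exp(i omega t)|^2 over [-x,x] for Im omega =
  C.\<close>

definition pint :: "real poly \<Rightarrow> real" where
  "pint f = integral {-1..1} (poly f)"

lemma poly_has_integral_pint: "(poly f has_integral pint f) {-1..1}"
  unfolding pint_def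
  by (intro integrable_integral integrable_continuous_real continuous_intros)

lemma pint_linear [simp]:
  "pint (f + h) = pint f + pint h"
  "pint (smult c f) = c * pint f"
  "pint (- f) = - pint f"
  "pint (f - h) = pint f - pint h"
  "pint 0 = 0"
proof -
  show "pint (f + h) = pint f + pint h"
    using has_integral_add[OF poly_has_integral_pint[of f] poly_has_integral_pint[of h]]
      poly_has_integral_pint[of "f + h"]
    by (auto intro: has_integral_unique simp flip: poly_add)
  show smult: "pint (smult c f) = c * pint f" for c f
    using has_integral_mult_right[OF poly_has_integral_pint[of f], of c]
      poly_has_integral_pint[of "smult c f"]
    by (auto intro: has_integral_unique simp flip: poly_smult)
  show neg: "pint (- f) = - pint f" for f
    using smult[of "-1" f] by simp
  show "pint (f - h) = pint f - pint h"
    using has_integral_diff[OF poly_has_integral_pint[of f] poly_has_integral_pint[of h]]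
      poly_has_integral_pint[of "f - h"]
    by (auto intro: has_integral_unique simp flip: poly_diff)
  show "pint 0 = 0"
    using smult[of 0 0] by simp
qed

lemma pint_sum: "pint (\<Sum>i\<in>I. f i) = (\<Sum>i\<in>I. pint (f i))"
  by (induction I rule: infinite_finite_induct) auto

lemma pint_pderiv: "pint (pderiv F) = poly F 1 - poly F (-1)"
proof -
  have "(poly (pderiv F) has_integral poly F 1 - poly F (-1)) {-1..1}"
    by (rule fundamental_theorem_of_calculus)
      (auto intro: DERIV_subset poly_DERIV simp flip: has_real_derivative_iff_has_vector_derivative)
  then show ?thesis
    using poly_has_integral_pint has_integral_unique by blast
qed

lemma pint_by_parts:
  assumes "poly h 1 = 0" "poly h (-1) = 0"
  shows "pint (f * pderiv h) = - pint (pderiv f * h)"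
  using pint_pderiv[of "f * h"] assms by (simp add: pderiv_mult mult.commute)

lemma pint_reflect: "pint (pcompose f [:0, -1:]) = pint f"
proof -
  have "((\<lambda>t. poly f (- t)) has_integral pint f) {-1..1}"
    using poly_has_integral_pint[of f] by (subst has_integral_reflect_real[symmetric]) simp
  then have "(poly (pcompose f [:0, -1:]) has_integral pint f) {-1..1}"
    by (simp add: poly_pcompose[abs_def] fun_eq_iff cong: has_integral_cong)
  then show ?thesis
    using poly_has_integral_pint has_integral_unique by blast
qed

text \<open>By the product rule each differentiation removes at most one factor \<open>w\<close>.
  This makes the boundary terms at 1 and -1 vanish when Rodrigues' formula is integrated by
  parts.\<close>

lemma power_dvd_higher_pderiv:
  assumes "w ^ n dvd (f :: real poly)" "k \<le> n"
  shows "w ^ (n - k) dvd (pderiv ^^ k) f"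
  using assms(2)
proof (induction k)
  case 0
  then show ?case using assms by simp
next
  case (Suc k)
  then obtain h where h: "(pderiv ^^ k) f = w ^ (n - k) * h" by (auto simp: dvd_def)
  obtain m where m: "n - k = Suc m" "n - Suc k = m"
    using Suc.prems by (metis Suc_diff_Suc Suc_le_lessD)
  have "(pderiv ^^ Suc k) f
      = w ^ m * (smult (real (Suc m)) (pderiv w) * h) + w ^ m * (w * pderiv h)"
    by (simp add: h m pderiv_mult pderiv_power_Suc algebra_simps del: power_Suc)
      (simp add: algebra_simps)
  then show ?case
    unfolding m(2) by (metis dvd_add dvd_triv_left)
qed

text \<open>At the root c only the term with all n derivatives on the power survives. The cofactor
  \<open>h\<close> is arbitrary in the induction because one derivative replaces it by a polynomial
  with value \<open>(n + 1) * h(c)\<close> at c.\<close>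

lemma higher_pderiv_power_linear:
  "poly ((pderiv ^^ n) ([:- c, 1:] ^ n * h)) c = fact n * poly (h :: real poly) c"
proof (induction n arbitrary: h)
  case 0
  then show ?case by simp
next
  case (Suc n)
  have "pderiv ([:- c, 1:] ^ Suc n * h)
      = [:- c, 1:] ^ n * (smult (real (Suc n)) h + [:- c, 1:] * pderiv h)"
    by (simp only: pderiv_mult pderiv_power_Suc) (simp add: pderiv_pCons algebra_simps)
  then have "poly ((pderiv ^^ Suc n) ([:- c, 1:] ^ Suc n * h)) c
      = poly ((pderiv ^^ n) ([:- c, 1:] ^ n * (smult (real (Suc n)) h + [:- c, 1:] * pderiv h))) c"
    by (simp del: funpow.simps power_Suc add: funpow_Suc_right)
  also have "\<dots> = fact (Suc n) * poly h c"
    by (subst Suc.IH) (simp add: algebra_simps)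
  finally show ?case .
qed

lemma legendre_factor: "([:-1, 0, 1:] :: real poly) = [:-1, 1:] * [:1, 1:]"
  by simp

lemma legendre_at_1: "poly (legendre_poly n) 1 = 1"
  using higher_pderiv_power_linear[of n 1 "[:1, 1:] ^ n"]
  by (simp add: legendre_poly_def legendre_factor power_mult_distrib del: mult_pCons_left mult_pCons_right)

lemma legendre_at_m1: "poly (legendre_poly n) (-1) = (-1) ^ n"
proof -
  \<comment> \<open>The double minus brings the factor into the shape \<open>[:- c, 1:]\<close> with
    c = -1.\<close>
  have "[:-1, 0, 1:] ^ n = ([:- (-1), 1:] ^ n * [:-1, 1:] ^ n :: real poly)"
    by (simp only: power_mult_distrib[symmetric]) simp
  then have "poly ((pderiv ^^ n) ([:-1, 0, 1:] ^ n)) (-1) = fact n * poly ([:-1, 1:] ^ n) (-1::real)"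
    by (simp only: higher_pderiv_power_linear)
  then show ?thesis
    by (simp add: legendre_poly_def poly_power power_mult_distrib[symmetric] field_simps)
qed

text \<open>Integrating by parts n times moves the derivatives of Rodrigues' formula to
  \<open>f\<close>. The sign (-1)^n is absorbed by passing from x^2 - 1 to 1 - x^2.\<close>

lemma pint_legendre:
  "pint (f * legendre_poly n) = pint ((pderiv ^^ n) f * [:1, 0, -1:] ^ n) / (2 ^ n * fact n)"
proof -
  define w where "w = ([:-1, 0, 1:] :: real poly) ^ n"
  have root: "poly ((pderiv ^^ k) w) c = 0" if "k < n" "c\<^sup>2 = 1" for k and c :: real
  proof -
    have "[:-1, 0, 1:] dvd (pderiv ^^ k) w"
      using power_dvd_higher_pderiv[of "[:-1, 0, 1:]" n w k] that
      by (metis dvd_power dvd_refl dvd_trans less_imp_le w_def zero_less_diff)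
    then show ?thesis using that by (auto simp: dvd_def power2_eq_square)
  qed
  have "pint (f * (pderiv ^^ n) w) = (-1) ^ k * pint ((pderiv ^^ k) f * (pderiv ^^ (n - k)) w)"
    if "k \<le> n" for k
    using that
  proof (induction k)
    case (Suc k)
    then have "n - k = Suc (n - Suc k)" by simp
    then have "pint ((pderiv ^^ k) f * (pderiv ^^ (n - k)) w)
        = - pint ((pderiv ^^ Suc k) f * (pderiv ^^ (n - Suc k)) w)"
      using Suc.prems by (simp add: pint_by_parts root)
    then show ?case using Suc by simp
  qed simp
  from this[of n] have "pint (f * (pderiv ^^ n) w) = (-1) ^ n * pint ((pderiv ^^ n) f * w)"
    by simp
  also have "\<dots> = pint ((pderiv ^^ n) f * smult ((-1) ^ n) w)" by simp
  also have "smult ((-1) ^ n) w = [:1, 0, -1:] ^ n"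
    unfolding w_def smult_power[symmetric] by simp
  finally show ?thesis
    by (simp add: legendre_poly_def w_def)
qed

lemma degree_legendre: "degree (legendre_poly n) = n"
proof -
  have "degree ([:-1, 0, 1:] ^ n :: real poly) = 2 * n"
    by (simp add: degree_power_eq)
  then show ?thesis
    by (simp add: legendre_poly_def degree_higher_pderiv)
qed

lemma legendre_orthogonal_lower:
  assumes "degree f < n"
  shows "pint (f * legendre_poly n) = 0"
proof -
  have "(pderiv ^^ n) f = 0"
    by (rule poly_eqI) (use assms in \<open>simp add: coeff_higher_pderiv coeff_eq_0\<close>)
  then show ?thesis by (simp add: pint_legendre)
qed

text \<open>Integrate (x P_n^2)' = P_n^2 + 2 x P_n' P_n: the boundary values give 2, and x P_n' may
  be replaced by n P_n up to a polynomial orthogonal to P_n.\<close>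

lemma legendre_norm: "pint (legendre_poly n * legendre_poly n) = 2 / (2 * real n + 1)"
proof -
  let ?P = "legendre_poly n" and ?X = "[:0, 1:] :: real poly"
  \<comment> \<open>\<open>x P\<^sub>n' - n P\<^sub>n\<close> has degree below \<open>n\<close>, so it is orthogonal to \<open>P\<^sub>n\<close>.\<close>
  define R where "R = ?X * pderiv ?P - smult (real n) ?P"
  have "coeff R k = 0" if "k \<ge> n" for k
    using that degree_legendre[of n] coeff_eq_0[of ?P k]
    by (cases k) (auto simp: R_def coeff_pderiv coeff_pCons coeff_eq_0 le_less)
  \<comment> \<open>For n = 0 the remainder is the zero polynomial, whose degree is 0 by convention
    and hence not below n.\<close>
  then have "n = 0 \<and> R = 0 \<or> degree R < n"
    by (metis coeff_0 degree_lessI leading_coeff_0_iff not_less le_degree poly_eqI zero_le gr0I)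
  then have "pint (R * ?P) = 0"
    using legendre_orthogonal_lower by auto
  then have 1: "pint (?X * pderiv ?P * ?P) = real n * pint (?P * ?P)"
    by (simp add: R_def left_diff_distrib)
  have "pint (pderiv (?X * (?P * ?P))) = 2"
    unfolding pint_pderiv
    by (simp add: legendre_at_1 legendre_at_m1 power_mult_distrib[symmetric])
  moreover have "pderiv (?X * (?P * ?P)) = ?P * ?P + smult 2 (?X * pderiv ?P * ?P)"
  proof -
    have "pderiv (?X * (?P * ?P)) = ?P * ?P + (?X * pderiv ?P * ?P + ?X * pderiv ?P * ?P)"
      unfolding pderiv_mult by (simp add: pderiv_pCons algebra_simps)
    moreover have "?X * pderiv ?P * ?P + ?X * pderiv ?P * ?P = smult 2 (?X * pderiv ?P * ?P)"
      by (metis one_add_one smult_1_left smult_add_left)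
    ultimately show ?thesis by simp
  qed
  ultimately have "pint (?P * ?P) + 2 * pint (?X * pderiv ?P * ?P) = 2"
    by (simp only: pint_linear)
  with 1 have "(2 * real n + 1) * pint (?P * ?P) = 2"
    by (simp add: algebra_simps)
  then show ?thesis by (simp add: field_simps)
qed

lemma legendre_orthogonal:
  "pint (legendre_poly m * legendre_poly n) = (if m = n then 2 / (2 * real n + 1) else 0)"
  using legendre_norm legendre_orthogonal_lower[of "legendre_poly m" n]
    legendre_orthogonal_lower[of "legendre_poly n" m]
  by (cases m n rule: linorder_cases) (auto simp: degree_legendre mult.commute)

text \<open>P_n has exact degree n, so a multiple of the top one cancels the leading coefficient and
  lowers the degree.\<close>

lemma legendre_span:
  assumes "degree f \<le> N"
  shows "\<exists>d. f = (\<Sum>n\<le>N. smult (d n) (legendre_poly n))"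
  using assms
proof (induction N arbitrary: f)
  case 0
  have "legendre_poly 0 = 1" by (simp add: legendre_poly_def)
  moreover obtain c where "f = [:c:]" using 0 degree_eq_zeroE by blast
  ultimately show ?case by (intro exI[of _ "\<lambda>_. c"]) simp
next
  case (Suc N)
  define c where "c = coeff f (Suc N) / coeff (legendre_poly (Suc N)) (Suc N)"
  have nz: "coeff (legendre_poly (Suc N)) (Suc N) \<noteq> 0"
    using degree_legendre[of "Suc N"] by (metis Zero_neq_Suc degree_0 leading_coeff_0_iff)
  have "degree (f - smult c (legendre_poly (Suc N))) \<le> N"
  proof (rule degree_le, intro allI impI)
    fix i assume "N < i"
    then show "coeff (f - smult c (legendre_poly (Suc N))) i = 0"
      using Suc.prems nz
      by (cases "i = Suc N") (auto simp: c_def coeff_eq_0 degree_legendre)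
  qed
  from Suc.IH[OF this] obtain d where d:
    "f - smult c (legendre_poly (Suc N)) = (\<Sum>n\<le>N. smult (d n) (legendre_poly n))" by blast
  have "(\<Sum>n\<le>N. smult ((d(Suc N := c)) n) (legendre_poly n)) = (\<Sum>n\<le>N. smult (d n) (legendre_poly n))"
    by (intro sum.cong) auto
  with d show ?case
    by (intro exI[of _ "d(Suc N := c)"]) (simp add: algebra_simps)
qed

lemma legendre_expansion:
  assumes "degree f \<le> N"
  shows "f = (\<Sum>n\<le>N. smult ((2 * real n + 1) / 2 * pint (f * legendre_poly n)) (legendre_poly n))"
proof -
  obtain d where d: "f = (\<Sum>n\<le>N. smult (d n) (legendre_poly n))"
    using legendre_span[OF assms] by blast
  have "pint (f * legendre_poly m) = d m * (2 / (2 * real m + 1))" if "m \<le> N" for m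
  proof -
    have "pint (f * legendre_poly m) = (\<Sum>n\<le>N. d n * pint (legendre_poly n * legendre_poly m))"
      by (subst d) (simp add: sum_distrib_right pint_sum)
    also have "\<dots> = (\<Sum>n\<le>N. if n = m then d m * (2 / (2 * real m + 1)) else 0)"
      by (intro sum.cong) (auto simp: legendre_orthogonal)
    finally show ?thesis using that by simp
  qed
  then have dm: "d m = (2 * real m + 1) / 2 * pint (f * legendre_poly m)" if "m \<le> N" for m
    using that by (simp add: field_simps)
  have "(\<Sum>n\<le>N. smult (d n) (legendre_poly n))
      = (\<Sum>n\<le>N. smult ((2 * real n + 1) / 2 * pint (f * legendre_poly n)) (legendre_poly n))"
    by (rule sum.cong) (simp_all only: dm atMost_iff)
  with d show ?thesis by simp
qed

section \<open>Moments of Legendre polynomials as Beta integrals\<close>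

lemma Gamma_half_Suc: "Gamma (real m + 1 / 2 + 1) = (real m + 1 / 2) * Gamma (real m + 1 / 2)"
proof (rule Gamma_plus1)
  show "real m + 1 / 2 \<notin> \<int>\<^sub>\<le>\<^sub>0"
    using nonpos_Ints_nonpos[of "real m + 1 / 2"] by auto
qed

text \<open>This is the Beta integral B(m + 1/2, n + 1). Integration by parts trades one factor 1 -
  x^2 for x^2, so the induction on n has to let m vary.\<close>

lemma pint_even_beta:
  "pint (monom 1 (2 * m) * [:1, 0, -1:] ^ n) = Gamma (real m + 1 / 2) * fact n / Gamma (real m + real n + 3 / 2)"
proof (induction n arbitrary: m)
  case 0
  have "pderiv (monom (1 / (2 * real m + 1)) (2 * m + 1)) = monom 1 (2 * m)"
    by (simp add: pderiv_monom field_simps)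
  then have "pint (monom 1 (2 * m)) = 2 / (2 * real m + 1)"
    using pint_pderiv[of "monom (1 / (2 * real m + 1)) (2 * m + 1)"] by (simp add: poly_monom field_simps)
  moreover have "Gamma (real m + 3 / 2) = (real m + 1 / 2) * Gamma (real m + 1 / 2)"
    using Gamma_half_Suc[of m] by (simp add: add.assoc)
  moreover have "Gamma (real m + 1 / 2) \<noteq> 0" using Gamma_real_pos[of "real m + 1 / 2"] by linarith
  then have "Gamma (real m + 1 / 2) / ((real m + 1 / 2) * Gamma (real m + 1 / 2)) = 1 / (real m + 1 / 2)"
    by simp
  moreover have "1 / (real m + 1 / 2) = 2 / (2 * real m + 1)" by (simp add: field_simps)
  ultimately show ?case by simp
next
  case (Suc n)
  let ?w = "[:1, 0, -1:] :: real poly"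
  have "pderiv (?w ^ Suc n) = ?w ^ n * smult (- (2 * real (Suc n))) (monom 1 1)"
    by (rule poly_ext)
      (simp add: pderiv_power_Suc pderiv_pCons poly_monom algebra_simps del: power_Suc)
  then have *: "monom (1 / (2 * real m + 1)) (2 * m + 1) * pderiv (?w ^ Suc n)
      = smult (- (2 * real (Suc n)) / (2 * real m + 1)) (monom 1 (2 * (m + 1)) * ?w ^ n)"
    by (simp only:) (rule poly_ext, simp add: poly_monom power_add power2_eq_square field_simps)
  have pm: "pderiv (monom (1 / (2 * real m + 1)) (2 * m + 1)) = monom 1 (2 * m)"
    by (simp add: pderiv_monom field_simps)
  have "pint (monom 1 (2 * m) * ?w ^ Suc n)
      = - pint (monom (1 / (2 * real m + 1)) (2 * m + 1) * pderiv (?w ^ Suc n))"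
    using pint_by_parts[of "?w ^ Suc n" "monom (1 / (2 * real m + 1)) (2 * m + 1)"]
    unfolding pm by simp
  also have "\<dots> = 2 * real (Suc n) / (2 * real m + 1) * pint (monom 1 (2 * (m + 1)) * ?w ^ n)"
    unfolding * by (simp only: pint_linear minus_divide_left[symmetric] mult_minus_left minus_minus)
  also have "\<dots> = 2 * real (Suc n) / (2 * real m + 1) *
       (Gamma (real m + 1 / 2 + 1) * fact n / Gamma (real m + real (Suc n) + 3 / 2))"
    unfolding Suc by (simp add: algebra_simps)
  also have "Gamma (real m + 1 / 2 + 1) = (real m + 1 / 2) * Gamma (real m + 1 / 2)"
    by (rule Gamma_half_Suc)
  also have "2 * real (Suc n) / (2 * real m + 1) * ((real m + 1 / 2) * c * fact n / d) = c * fact (Suc n) / d"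
    for c d :: real
    by (simp add: divide_simps) (simp add: algebra_simps)
  finally show ?case .
qed

text \<open>The duplication formula at half-integers. The factor \<open>fact (2 * m)\<close> later
  completes the Pochhammer symbol of the differentiated monomial to
  \<open>fact (n + 2 * m)\<close>.\<close>

lemma Gamma_half_nat: "Gamma (real m + 1 / 2) = fact (2 * m) * sqrt pi / (4 ^ m * fact m)"
proof (induction m)
  case 0
  then show ?case by (simp add: Gamma_one_half_real)
next
  case (Suc m)
  have "Gamma (real (Suc m) + 1 / 2) = (real m + 1 / 2) * Gamma (real m + 1 / 2)"
    using Gamma_half_Suc[of m] by (simp add: algebra_simps)
  also have "\<dots> = (real m + 1 / 2) * (fact (2 * m) * sqrt pi / (4 ^ m * fact m))"
    by (simp only: Suc.IH)
  also have "\<dots> = fact (2 * Suc m) * sqrt pi / (4 ^ Suc m * fact (Suc m))"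
    by (simp add: divide_simps) (simp add: algebra_simps)
  finally show ?case .
qed

lemma pint_odd_beta:
  assumes "odd j"
  shows "pint (monom 1 j * [:1, 0, -1:] ^ n) = 0"
proof -
  have "pcompose (monom 1 j * [:1, 0, -1:] ^ n) [:0, -1:] = - (monom 1 j * [:1, 0, -1:] ^ n :: real poly)"
    by (rule poly_ext) (use \<open>odd j\<close> in \<open>simp add: poly_pcompose poly_monom poly_power\<close>)
  with pint_reflect[of "monom 1 j * [:1, 0, -1:] ^ n"] show ?thesis by simp
qed

lemma legendre_moment_0:
  assumes "k < n \<or> odd (k - n)"
  shows "pint (monom 1 k * legendre_poly n) = 0"
proof (cases "k < n")
  case True
  then show ?thesis
    by (intro legendre_orthogonal_lower) (simp add: degree_monom_eq)
next
  case False
  then obtain j where j: "k = n + j" "odd j"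
    using assms by (auto simp: not_less le_iff_add)
  have "(pderiv ^^ n) (monom 1 (n + j)) = smult (pochhammer (real (Suc j)) n) (monom 1 j)"
    by (rule poly_eqI) (auto simp: coeff_higher_pderiv)
  with j show ?thesis by (simp add: pint_legendre pint_odd_beta)
qed

text \<open>Divided by \<open>fact (n + 2 * m)\<close>, the right-hand side is twice the modulus of
  the coefficient of z^(n + 2m) in j_n. This is how Bessel functions enter.\<close>

lemma legendre_moment:
  "pint (monom 1 (n + 2 * m) * legendre_poly n)
   = fact (n + 2 * m) * sqrt pi / (2 ^ n * 4 ^ m * fact m * Gamma (real m + real n + 3 / 2))"
proof -
  have "(pderiv ^^ n) (monom 1 (n + 2 * m)) = smult (pochhammer (real (Suc (2 * m))) n) (monom 1 (2 * m))"
    by (rule poly_eqI) (auto simp: coeff_higher_pderiv)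
  moreover have "fact (n + 2 * m) = fact (2 * m) * pochhammer (real (Suc (2 * m))) n"
    by (induction n) (auto simp: pochhammer_Suc algebra_simps)
  moreover have "Gamma (real m + real n + 3 / 2) > 0" by (rule Gamma_real_pos) simp
  ultimately show ?thesis
    by (simp only: pint_legendre mult_smult_left pint_linear pint_even_beta Gamma_half_nat)
      (simp add: divide_simps)
qed

text \<open>Allows the partial sums of the moment series of exp(i z t) to be dominated by the full
  series at the modulus of z.\<close>

lemma legendre_moment_nonneg: "pint (monom 1 k * legendre_poly n) \<ge> 0"
proof (cases "k < n \<or> odd (k - n)")
  case True
  then show ?thesis by (simp add: legendre_moment_0)
next
  case False
  then obtain m where "k = n + 2 * m" by (metis dvdE le_add_diff_inverse not_less)
  moreover have "Gamma (real m + real n + 3 / 2) > 0" by (rule Gamma_real_pos) simp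
  ultimately show ?thesis by (simp add: legendre_moment)
qed

subsection \<open>Spherical Bessel functions\<close>

text \<open>Absorbs the weight 2n + 1 into a geometric factor, so that majorants keep the form x^n /
  n! of an exponential series.\<close>

lemma odd_le_power_3: "2 * real n + 1 \<le> 3 ^ n"
  by (induction n) auto

text \<open>Start from Gamma(3/2) = sqrt(pi)/2 and bound each factor of the functional equation
  below by the next integer factor. The factorial of k makes j_k(z) decay like (|z|/2)^k / k!,
  locally uniformly in z.\<close>

lemma Gamma_half_ge: "Gamma (real m + real k + 3 / 2) \<ge> sqrt pi / 2 * fact m * fact k"
proof (induction m)
  case 0
  show ?case
  proof (induction k)
    case 0
    show ?case using Gamma_half_Suc[of 0] by (simp add: Gamma_one_half_real)
  next
    case (Suc k)
    have "sqrt pi / 2 * fact (Suc k) = (sqrt pi / 2 * fact k) * real (Suc k)" by simp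
    also have "\<dots> \<le> Gamma (real k + 3 / 2) * (real k + 3 / 2)"
      using Suc by (intro mult_mono) auto
    also have "\<dots> = Gamma (real (Suc k) + 3 / 2)"
      using Gamma_half_Suc[of "Suc k"] by (simp add: algebra_simps)
    finally show ?case by simp
  qed
next
  case (Suc m)
  have "sqrt pi / 2 * fact (Suc m) * fact k = (sqrt pi / 2 * fact m * fact k) * real (Suc m)" by simp
  also have "\<dots> \<le> Gamma (real m + real k + 3 / 2) * (real m + real k + 3 / 2)"
    using Suc by (intro mult_mono) auto
  also have "\<dots> = Gamma (real (Suc m) + real k + 3 / 2)"
    using Gamma_half_Suc[of "Suc (m + k)"] by (simp add: algebra_simps)
  finally show ?case .
qed

definition bessel_term :: "nat \<Rightarrow> complex \<Rightarrow> nat \<Rightarrow> complex" where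
  "bessel_term k z m =
     complex_of_real ((-1) ^ m / (fact m * Gamma (real m + real k + 3 / 2))) * (z / 2) ^ (2 * m + k)"

lemma norm_bessel_term_le:
  "sqrt pi / 2 * cmod (bessel_term k z m) \<le> (cmod z / 2) ^ k / fact k * (((cmod z)\<^sup>2 / 4) ^ m / fact m)"
proof -
  define G where "G = Gamma (real m + real k + 3 / 2)"
  have G: "G \<ge> sqrt pi / 2 * fact m * fact k" unfolding G_def by (rule Gamma_half_ge)
  have "sqrt pi / 2 * 1 * 1 \<le> sqrt pi / 2 * fact m * (fact k :: real)"
    by (intro mult_mono) auto
  with G have "G > 0" using pi_gt_zero by (smt (verit) half_gt_zero real_sqrt_gt_zero)
  have "(cmod z / 2) ^ (2 * m + k) = (cmod z / 2) ^ k * ((cmod z)\<^sup>2 / 4) ^ m"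
    by (simp only: power_add power_mult power_divide) (simp add: mult.commute)
  then have "sqrt pi / 2 * cmod (bessel_term k z m)
      = (cmod z / 2) ^ k * ((cmod z)\<^sup>2 / 4) ^ m * (sqrt pi / 2 / (fact m * G))"
    using \<open>G > 0\<close>
    by (simp add: bessel_term_def norm_mult norm_power norm_divide G_def[symmetric])
  also have "\<dots> \<le> (cmod z / 2) ^ k * ((cmod z)\<^sup>2 / 4) ^ m * (1 / (fact m * fact k))"
  proof (intro mult_left_mono)
    have "sqrt pi / 2 * fact k \<le> sqrt pi / 2 * fact k * fact m" by simp
    also have "\<dots> \<le> G" using G by (simp add: mult_ac)
    finally show "sqrt pi / 2 / (fact m * G) \<le> 1 / (fact m * fact k)"
      using \<open>G > 0\<close> by (simp add: field_simps)
  qed auto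
  finally show ?thesis by (simp add: field_simps)
qed

lemma exp_sums: "(\<lambda>m. x ^ m / fact m) sums exp (x :: 'a :: {real_normed_field, banach})"
  using exp_converges[of x] by (simp add: scaleR_conv_of_real field_simps)

lemma summable_bessel_term: "summable (\<lambda>m. sqrt pi / 2 * cmod (bessel_term k z m))"
proof (rule summable_comparison_test')
  show "summable (\<lambda>m. (cmod z / 2) ^ k / fact k * (((cmod z)\<^sup>2 / 4) ^ m / fact m))"
    by (intro summable_mult sums_summable[OF exp_sums])
  show "norm (sqrt pi / 2 * cmod (bessel_term k z m))
      \<le> (cmod z / 2) ^ k / fact k * (((cmod z)\<^sup>2 / 4) ^ m / fact m)" for m
    using norm_bessel_term_le[of k z m] by simp
qed

lemma spherical_bessel_sums:
  "(\<lambda>m. complex_of_real (sqrt pi / 2) * bessel_term k z m) sums spherical_bessel_j k z"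
proof -
  have "summable (\<lambda>m. cmod (complex_of_real (sqrt pi / 2) * bessel_term k z m))"
    using summable_bessel_term[of k z] by (simp add: norm_mult)
  then have "summable (\<lambda>m. complex_of_real (sqrt pi / 2) * bessel_term k z m)"
    by (rule summable_norm_cancel)
  moreover have "complex_of_real (sqrt pi / 2) \<noteq> 0" by simp
  ultimately have "summable (bessel_term k z)"
    by (subst (asm) summable_cmult_iff) auto
  then show ?thesis
    unfolding spherical_bessel_j_def bessel_term_def[symmetric]
    by (intro sums_mult summable_sums)
qed

lemma norm_spherical_bessel_le:
  "cmod (spherical_bessel_j k z) \<le> (cmod z / 2) ^ k / fact k * exp ((cmod z)\<^sup>2 / 4)"
proof -
  have "(\<lambda>m. (cmod z / 2) ^ k / fact k * (((cmod z)\<^sup>2 / 4) ^ m / fact m))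
      sums ((cmod z / 2) ^ k / fact k * exp ((cmod z)\<^sup>2 / 4))"
    by (intro sums_mult exp_sums)
  moreover have "cmod (complex_of_real (sqrt pi / 2) * bessel_term k z m)
      \<le> (cmod z / 2) ^ k / fact k * (((cmod z)\<^sup>2 / 4) ^ m / fact m)" for m
    using norm_bessel_term_le[of k z m] by (simp add: norm_mult)
  ultimately show ?thesis
    using spherical_bessel_sums[of k z]
    by (metis (no_types, lifting) norm_suminf_le sums_iff)
qed

lemma spherical_bessel_minus:
  "spherical_bessel_j k (- z) = (-1) ^ k * spherical_bessel_j k z"
proof -
  have "bessel_term k (- z) m = (-1) ^ k * bessel_term k z m" for m
    by (simp add: bessel_term_def power_minus[of "z / 2"] power_add power_mult)
  then have "(\<lambda>m. (-1) ^ k * (complex_of_real (sqrt pi / 2) * bessel_term k z m))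
      sums spherical_bessel_j k (- z)"
    using spherical_bessel_sums[of k "- z"] by (simp add: mult_ac)
  with sums_mult[OF spherical_bessel_sums[of k z], of "(-1) ^ k"] show ?thesis
    using sums_unique2 by blast
qed

text \<open>The exponential series integrated termwise against P_n; only the indices k = n + 2m
  survive. The termwise form is what a functional known only on polynomials can use.\<close>

lemma legendre_moment_series:
  "(\<lambda>k. (\<i> * z) ^ k / fact k * complex_of_real (pint (monom 1 k * legendre_poly n)))
   sums (2 * \<i> ^ n * spherical_bessel_j n z)"
proof -
  define f where "f k = (\<i> * z) ^ k / fact k * complex_of_real (pint (monom 1 k * legendre_poly n))" for k
  have zero: "f k = 0" if "k \<notin> range (\<lambda>m. n + 2 * m)" for k
  proof -
    have "k < n \<or> odd (k - n)"
      using that by (metis dvdE le_add_diff_inverse not_less rangeI)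
    then show ?thesis by (simp add: f_def legendre_moment_0)
  qed
  have f: "f (n + 2 * m) = 2 * \<i> ^ n * (complex_of_real (sqrt pi / 2) * bessel_term n z m)" for m
  proof -
    have "(\<i> ^ m)\<^sup>2 = (-1) ^ m" "((2::complex) ^ m)\<^sup>2 = 4 ^ m"
      by (simp_all add: power2_eq_square flip: power_mult_distrib)
    then show ?thesis
      unfolding f_def legendre_moment bessel_term_def
      by (simp add: power_add power_mult power_mult_distrib power_divide field_simps)
  qed
  have "(\<lambda>m. f (n + 2 * m)) sums (2 * \<i> ^ n * spherical_bessel_j n z)"
    unfolding f by (intro sums_mult spherical_bessel_sums)
  then have "f sums (2 * \<i> ^ n * spherical_bessel_j n z)"
    by (subst (asm) sums_mono_reindex) (auto intro: zero strict_monoI)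
  then show ?thesis by (simp add: f_def[abs_def])
qed

text \<open>On [-1,1] the exponential series converges uniformly, so integral and sum may be
  exchanged. This is the Legendre coefficient of the plane wave.\<close>

lemma exp_legendre_integral:
  "((\<lambda>t. exp (\<i> * z * complex_of_real t) * complex_of_real (poly (legendre_poly n) t))
     has_integral (2 * \<i> ^ n * spherical_bessel_j n z)) {-1..1}"
proof -
  let ?P = "\<lambda>t. complex_of_real (poly (legendre_poly n) t)"
  define f where "f N t = (\<Sum>k<N. (\<i> * z * complex_of_real t) ^ k / fact k) * ?P t" for N t
  have "bounded (?P ` {-1..1})"
    by (intro compact_imp_bounded compact_continuous_image continuous_intros) auto
  moreover have "uniform_limit {-1..1} (\<lambda>N t. \<Sum>k<N. (\<i> * z * complex_of_real t) ^ k / fact k)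
      (\<lambda>t. exp (\<i> * z * complex_of_real t)) sequentially"
    unfolding sums_unique[OF exp_sums]
  proof (rule Weierstrass_m_test)
    show "norm ((\<i> * z * complex_of_real t) ^ k / fact k) \<le> cmod z ^ k / fact k"
      if "t \<in> {-1..1}" for k t
    proof -
      have "\<bar>t\<bar> \<le> 1" using that by auto
      then have "cmod z * \<bar>t\<bar> \<le> cmod z" by (simp add: mult_left_le)
      then show ?thesis
        by (simp add: norm_divide norm_power norm_mult divide_right_mono power_mono)
    qed
  qed (rule sums_summable[OF exp_sums])
  ultimately have "uniform_limit {-1..1} f (\<lambda>t. exp (\<i> * z * complex_of_real t) * ?P t) sequentially"
    unfolding f_def
    by (intro uniform_lim_mult uniform_limit_const)
      (auto intro!: compact_imp_bounded compact_continuous_image continuous_intros)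
  then obtain I J where I: "\<And>N. (f N has_integral I N) {-1..1}"
    and J: "((\<lambda>t. exp (\<i> * z * complex_of_real t) * ?P t)
        has_integral J) {-1..1}" and "I \<longlonglongrightarrow> J"
    by (rule uniform_limit_integral) (auto simp: f_def intro!: continuous_intros)
  have "I N = (\<Sum>k<N. (\<i> * z) ^ k / fact k * complex_of_real (pint (monom 1 k * legendre_poly n)))" for N
  proof (rule has_integral_unique[OF I])
    have "f N = (\<lambda>t. \<Sum>k<N. (\<i> * z) ^ k / fact k * complex_of_real (poly (monom 1 k *
        legendre_poly n) t))"
      by (simp add: f_def fun_eq_iff sum_distrib_right poly_monom power_mult_distrib mult.assoc)
    then show "(f N has_integral (\<Sum>k<N. (\<i> * z) ^ k / fact k * complex_of_real (pint (monom 1 k *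
        legendre_poly n)))) {-1..1}"
      by (simp only:) (intro has_integral_sum has_integral_mult_right finite_lessThan
          has_integral_linear[OF poly_has_integral_pint bounded_linear_of_real, unfolded o_def])
  qed
  then have "I = (\<lambda>N. \<Sum>k<N. (\<i> * z) ^ k / fact k * complex_of_real (pint (monom 1 k *
      legendre_poly n)))"
    by (simp only: fun_eq_iff) simp
  then have "I \<longlonglongrightarrow> 2 * \<i> ^ n * spherical_bessel_j n z"
    using legendre_moment_series[of z n] by (simp only: sums_def)
  with J \<open>I \<longlonglongrightarrow> J\<close> show ?thesis
    using LIMSEQ_unique by blast
qed

section \<open>Bessel's inequality for the exponential\<close>

definition sinhc :: "real \<Rightarrow> real" where
  "sinhc c = (if c = 0 then 1 else sinh (2 * c) / (2 * c))"

text \<open>The integrand is |exp(i z t)|^2 for Im z = b, so \<open>2 * sinhc b\<close> is the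
  squared L^2 norm of the plane wave on [-1,1]; hence the argument doubled in \<open>sinhc\<close>
  and its value 1 at 0.\<close>

lemma exp_has_integral_sinhc: "((\<lambda>t. exp (- 2 * b * t)) has_integral 2 * sinhc b) {-1..1}"
proof (cases "b = 0")
  case True
  then show ?thesis
    using has_integral_const_real[of "1::real" "-1" 1] by (simp add: sinhc_def)
next
  case False
  have "((\<lambda>t. exp (- 2 * b * t)) has_integral
      - exp (- 2 * b * 1) / (2 * b) - - exp (- 2 * b * (-1)) / (2 * b)) {-1..1}"
    by (rule fundamental_theorem_of_calculus)
      (use False in \<open>auto simp flip: has_real_derivative_iff_has_vector_derivative
        intro!: derivative_eq_intros simp: field_simps\<close>)
  moreover have "- exp (- 2 * b * 1) / (2 * b) - - exp (- 2 * b * (-1)) / (2 * b) = 2 * sinhc b"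
    using False by (simp add: sinhc_def sinh_def field_simps)
  ultimately show ?thesis by simp
qed

lemma sinhc_minus [simp]: "sinhc (- b) = sinhc b"
  by (simp add: sinhc_def)

text \<open>Averaging the integrals for b and -b represents \<open>2 * sinhc b\<close> as the
  integral of cosh(2bt), whose integrand is monotone in |b|. This treats b = 0 without a separate
  case.\<close>

lemma sinhc_mono:
  assumes "\<bar>b\<bar> \<le> c"
  shows "sinhc b \<le> sinhc c"
proof -
  have cosh: "((\<lambda>t. cosh (2 * a * t)) has_integral 2 * sinhc a) {-1..1}" for a
    using has_integral_divide[OF has_integral_add[OF exp_has_integral_sinhc[of a] exp_has_integral_sinhc[of "-
        a"]], of 2]
    by (simp add: cosh_def add.commute)
  have "2 * sinhc b \<le> 2 * sinhc c"
  proof (rule has_integral_le[OF cosh cosh])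
    fix t :: real
    have "\<bar>2 * b * t\<bar> \<le> \<bar>2 * c * t\<bar>" using assms by (simp add: abs_mult mult_right_mono)
    then have "cosh \<bar>2 * b * t\<bar> \<le> cosh \<bar>2 * c * t\<bar>"
      by (subst cosh_real_nonneg_le_iff) auto
    then show "cosh (2 * b * t) \<le> cosh (2 * c * t)" by simp
  qed
  then show ?thesis by simp
qed

lemma sinh_quot_sinhc: "x > 0 \<Longrightarrow> sinh_quot C x = 2 * x * sinhc (C * x)"
  by (simp add: sinh_quot_def sinhc_def field_simps)

text \<open>Bessel's inequality for exp(i z t): the squared L^2 distance from its Legendre partial
  sum is nonnegative.\<close>

lemma spherical_bessel_sum_le:
  "(\<Sum>n\<le>N. (2 * real n + 1) * (cmod (spherical_bessel_j n z))\<^sup>2) \<le> sinhc (Im z)"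
proof -
  define e where "e t = exp (\<i> * z * complex_of_real t)" for t
  define P where "P n t = poly (legendre_poly n) t" for n t
  \<comment> \<open>The Legendre coefficient of the exponential: the integral 2 i^n j_n(z) times
    (2n+1)/2.\<close>
  define c where "c n = (2 * real n + 1) * \<i> ^ n * spherical_bessel_j n z" for n
  define S where "S t = (\<Sum>n\<le>N. c n * complex_of_real (P n t))" for t
  define Z where "Z = (\<Sum>n\<le>N. (2 * real n + 1) * (cmod (spherical_bessel_j n z))\<^sup>2)"
  have ee: "((\<lambda>t. (cmod (e t))\<^sup>2) has_integral 2 * sinhc (Im z)) {-1..1}"
    using exp_has_integral_sinhc[of "Im z"]
    by (simp add: e_def norm_exp_eq_Re mult.assoc flip: exp_of_nat_mult)
  have "((\<lambda>t. Re (\<Sum>n\<le>N. cnj (c n) * (e t * complex_of_real (P n t)))) has_integral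
      Re (\<Sum>n\<le>N. cnj (c n) * (2 * \<i> ^ n * spherical_bessel_j n z))) {-1..1}"
    unfolding e_def P_def
    by (intro has_integral_Re has_integral_sum has_integral_mult_right exp_legendre_integral) auto
  also have "(\<lambda>t. Re (\<Sum>n\<le>N. cnj (c n) * (e t * complex_of_real (P n t))))
      = (\<lambda>t. Re (e t * cnj (S t)))"
    by (simp add: S_def fun_eq_iff sum_distrib_left mult_ac)
  also have "Re (\<Sum>n\<le>N. cnj (c n) * (2 * \<i> ^ n * spherical_bessel_j n z)) = 2 * Z"
  proof -
    have "cnj (c n) * (2 * \<i> ^ n * spherical_bessel_j n z)
        = complex_of_real (2 * ((2 * real n + 1) * (cmod (spherical_bessel_j n z))\<^sup>2))" for n
    proof -
      have "cnj \<i> ^ n * \<i> ^ n = 1" by (simp flip: power_mult_distrib)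
      moreover have "cnj (spherical_bessel_j n z) * spherical_bessel_j n z
          = complex_of_real ((cmod (spherical_bessel_j n z))\<^sup>2)"
        by (metis complex_norm_square mult.commute)
      ultimately show ?thesis
        by (simp add: c_def) (metis (no_types, opaque_lifting) mult.assoc mult.commute mult_1)
    qed
    then show ?thesis unfolding Z_def sum_distrib_left by (simp only: Re_sum Re_complex_of_real)
  qed
  finally have eS: "((\<lambda>t. Re (e t * cnj (S t))) has_integral 2 * Z) {-1..1}" .
  have "((\<lambda>t. \<Sum>m\<le>N. \<Sum>n\<le>N. Re (c m * cnj (c n)) * poly (legendre_poly m *
      legendre_poly n) t) has_integral
      (\<Sum>m\<le>N. \<Sum>n\<le>N. Re (c m * cnj (c n)) * pint (legendre_poly m * legendre_poly n))) {-1..1}"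
    by (intro has_integral_sum has_integral_mult_right poly_has_integral_pint) auto
  also have "(\<lambda>t. \<Sum>m\<le>N. \<Sum>n\<le>N. Re (c m * cnj (c n)) * poly (legendre_poly m *
      legendre_poly n) t)
      = (\<lambda>t. (cmod (S t))\<^sup>2)"
  proof
    fix t
    have "complex_of_real ((cmod (S t))\<^sup>2) = S t * cnj (S t)"
      by (rule complex_norm_square)
    also have "\<dots> = (\<Sum>m\<le>N. \<Sum>n\<le>N. c m * cnj (c n) * complex_of_real (poly (legendre_poly
        m * legendre_poly n) t))"
      by (simp add: S_def sum_product P_def mult_ac)
    finally have "(cmod (S t))\<^sup>2 = Re \<dots>" by (metis Re_complex_of_real)
    then show "(\<Sum>m\<le>N. \<Sum>n\<le>N. Re (c m * cnj (c n)) * poly (legendre_poly m * legendre_poly n)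
        t) = (cmod (S t))\<^sup>2"
      by simp
  qed
  also have "(\<Sum>m\<le>N. \<Sum>n\<le>N. Re (c m * cnj (c n)) * pint (legendre_poly m * legendre_poly n))
      = (\<Sum>m\<le>N. (cmod (c m))\<^sup>2 * (2 / (2 * real m + 1)))"
  proof (rule sum.cong[OF refl])
    fix m assume "m \<in> {..N}"
    have "(\<Sum>n\<le>N. Re (c m * cnj (c n)) * pint (legendre_poly m * legendre_poly n))
        = (\<Sum>n\<le>N. if n = m then Re (c m * cnj (c m)) * (2 / (2 * real m + 1)) else 0)"
      by (intro sum.cong) (auto simp: legendre_orthogonal)
    also have "\<dots> = Re (c m * cnj (c m)) * (2 / (2 * real m + 1))"
      using \<open>m \<in> {..N}\<close> by simp
    also have "Re (c m * cnj (c m)) = (cmod (c m))\<^sup>2"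
      by (metis Re_complex_of_real complex_norm_square)
    finally show "(\<Sum>n\<le>N. Re (c m * cnj (c n)) * pint (legendre_poly m * legendre_poly n))
      = (cmod (c m))\<^sup>2 * (2 / (2 * real m + 1))" .
  qed
  also have "\<dots> = 2 * Z"
  proof -
    have "(cmod (c m))\<^sup>2 * (2 / (2 * real m + 1))
        = 2 * ((2 * real m + 1) * (cmod (spherical_bessel_j m z))\<^sup>2)" for m
    proof -
      have "cmod (c m) = (2 * real m + 1) * cmod (spherical_bessel_j m z)"
        unfolding c_def norm_mult norm_power by (simp del: of_real_add)
      then show ?thesis by (simp add: power2_eq_square field_simps)
    qed
    then show ?thesis by (simp add: Z_def sum_distrib_left)
  qed
  finally have SS: "((\<lambda>t. (cmod (S t))\<^sup>2) has_integral 2 * Z) {-1..1}" .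
  \<comment> \<open>The cross term and the norm of the partial sum both integrate to
    \<open>2 * Z\<close>, which leaves \<open>sinhc (Im z) - Z\<close> up to a factor 2.\<close>
  have "((\<lambda>t. (cmod (e t))\<^sup>2 - 2 * Re (e t * cnj (S t)) + (cmod (S t))\<^sup>2) has_integral
      2 * sinhc (Im z) - 2 * (2 * Z) + 2 * Z) {-1..1}"
    by (intro has_integral_add has_integral_diff has_integral_mult_right ee eS SS)
  moreover have "(cmod (e t))\<^sup>2 - 2 * Re (e t * cnj (S t)) + (cmod (S t))\<^sup>2 = (cmod (e t
      - S t))\<^sup>2" for t
    by (simp only: cmod_power2) (simp add: power2_eq_square algebra_simps)
  ultimately have "0 \<le> 2 * sinhc (Im z) - 2 * (2 * Z) + 2 * Z"
    by (metis (no_types, lifting) has_integral_nonneg zero_le_power2)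
  then show ?thesis by (simp add: Z_def)
qed

subsection \<open>Functionals on polynomials\<close>

definition moment_functional :: "(nat \<Rightarrow> complex) \<Rightarrow> real poly \<Rightarrow> complex" where
  "moment_functional \<mu> f = (\<Sum>k\<le>degree f. complex_of_real (coeff f k) * \<mu> k)"

lemma moment_functional_eq:
  assumes "degree f \<le> N"
  shows "moment_functional \<mu> f = (\<Sum>k\<le>N. complex_of_real (coeff f k) * \<mu> k)"
  unfolding moment_functional_def
  by (rule sum.mono_neutral_left) (use assms in \<open>auto simp: coeff_eq_0\<close>)

lemma moment_functional_add:
  "moment_functional \<mu> (f + h) = moment_functional \<mu> f + moment_functional \<mu> h"
proof -
  define N where "N = max (degree f) (degree h)"
  have "degree f \<le> N" "degree h \<le> N" "degree (f + h) \<le> N"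
    by (auto simp: N_def degree_add_le_max)
  then show ?thesis
    by (simp add: moment_functional_eq[of _ N] sum.distrib algebra_simps)
qed

lemma moment_functional_smult:
  "moment_functional \<mu> (smult c f) = complex_of_real c * moment_functional \<mu> f"
  by (simp add: moment_functional_eq[of _ "degree f"] sum_distrib_left mult_ac degree_smult_le)

lemma moment_functional_sum:
  "moment_functional \<mu> (\<Sum>i\<in>I. f i) = (\<Sum>i\<in>I. moment_functional \<mu> (f i))"
  by (induction I rule: infinite_finite_induct)
    (auto simp: moment_functional_add, simp_all add: moment_functional_def)

lemma moment_functional_monom: "moment_functional \<mu> (monom 1 k) = \<mu> k"
proof -
  have "moment_functional \<mu> (monom 1 k) = (\<Sum>i\<le>k. if i = k then \<mu> k else 0)"
    unfolding moment_functional_eq[OF degree_monom_le] by (intro sum.cong) auto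
  then show ?thesis by simp
qed

text \<open>Cauchy-Schwarz against the constant 1, obtained by integrating the square of |f| - I/2,
  where I/2 is the mean of |f| over [-1,1].\<close>

lemma integral_abs_poly_le: "integral {-1..1} (\<lambda>t. \<bar>poly f t\<bar>) \<le> sqrt (2 * pint (f * f))"
proof -
  define I where "I = integral {-1..1} (\<lambda>t. \<bar>poly f t\<bar>)"
  have 1: "((\<lambda>t. \<bar>poly f t\<bar>) has_integral I) {-1..1}"
    unfolding I_def by (intro integrable_integral integrable_continuous_real continuous_intros)
  have "((\<lambda>t. poly (f * f) t - I * \<bar>poly f t\<bar> + I\<^sup>2 / 4) has_integral
      pint (f * f) - I * I + (1 - (-1)) *\<^sub>R (I\<^sup>2 / 4)) {-1..1}"
    by (intro has_integral_add has_integral_diff has_integral_mult_right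
        poly_has_integral_pint 1 has_integral_const_real[THEN has_integral_eq_rhs]) auto
  moreover have "poly (f * f) t - I * \<bar>poly f t\<bar> + I\<^sup>2 / 4 = (\<bar>poly f t\<bar>
      - I / 2)\<^sup>2" for t
    by (simp add: power2_eq_square algebra_simps)
  ultimately have "0 \<le> pint (f * f) - I * I + (1 - (-1)) *\<^sub>R (I\<^sup>2 / 4)"
    by (metis (no_types, lifting) has_integral_nonneg zero_le_power2)
  then have "I\<^sup>2 \<le> 2 * pint (f * f)" by (simp add: power2_eq_square)
  then show ?thesis unfolding I_def[symmetric] by (rule real_le_rsqrt)
qed

text \<open>Integration against a kernel bounded by \<open>K\<close> satisfies \<open>bound\<close>;
  the locale keeps just this consequence, tested on polynomials.\<close>

locale bounded_moment_functional =
  fixes \<mu> :: "nat \<Rightarrow> complex" and K :: real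
  assumes bound: "cmod (moment_functional \<mu> f) \<le> K * integral {-1..1} (\<lambda>t. \<bar>poly f t\<bar>)"
begin

lemma K_nonneg: "K \<ge> 0"
proof -
  have "cmod (moment_functional \<mu> 1) \<le> K * 2" using bound[of 1] by simp
  then show ?thesis using norm_ge_zero[of "moment_functional \<mu> 1"] by linarith
qed

text \<open>Duality: the test polynomial \<open>f\<close> is chosen so that the functional takes the
  value \<open>Z\<close> on it in the chosen part, while the integral of f^2 is
  \<open>2 * Z\<close>. The bound gives \<open>Z \<le> K * sqrt (4 * Z)\<close>. Real and imaginary
  parts are separated because the test polynomials have real coefficients.\<close>

lemma legendre_bessel_inequality_part:
  assumes R: "R = Re \<or> R = Im"
  shows "(\<Sum>n\<le>N. (2 * real n + 1) * (R (moment_functional \<mu> (legendre_poly n)))\<^sup>2) \<le> 4 *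
      K\<^sup>2"
proof -
  define a where "a n = R (moment_functional \<mu> (legendre_poly n))" for n
  define Z where "Z = (\<Sum>n\<le>N. (2 * real n + 1) * (a n)\<^sup>2)"
  define f where "f = (\<Sum>n\<le>N. smult ((2 * real n + 1) * a n) (legendre_poly n))"
  have "Z \<ge> 0" unfolding Z_def by (intro sum_nonneg) auto
  have "R (moment_functional \<mu> f) = (\<Sum>n\<le>N. (2 * real n + 1) * a n * a n)"
    using R by (auto simp: f_def a_def moment_functional_sum moment_functional_smult simp del: of_real_mult
        of_real_add)
  also have "\<dots> = Z" by (simp add: Z_def power2_eq_square mult_ac)
  finally have "Z = R (moment_functional \<mu> f)" ..
  also have "\<dots> \<le> cmod (moment_functional \<mu> f)"
    using R by (auto intro: complex_Re_le_cmod order.trans[OF abs_ge_self abs_Im_le_cmod])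
  also have "\<dots> \<le> K * sqrt (2 * pint (f * f))"
    using bound[of f] integral_abs_poly_le[of f] K_nonneg by (meson mult_left_mono order.trans)
  also have "pint (f * f) = 2 * Z"
  proof -
    have "pint (f * f) = (\<Sum>m\<le>N. \<Sum>n\<le>N. ((2 * real m + 1) * a m) * ((2 * real n + 1) * a n)
        * pint (legendre_poly m * legendre_poly n))"
      by (simp add: f_def sum_product pint_sum mult_ac)
    also have "\<dots> = (\<Sum>m\<le>N. 2 * ((2 * real m + 1) * (a m)\<^sup>2))"
    proof (rule sum.cong[OF refl])
      fix m assume "m \<in> {..N}"
      have "(\<Sum>n\<le>N. ((2 * real m + 1) * a m) * ((2 * real n
          + 1) * a n) * pint (legendre_poly m * legendre_poly n))
          = (\<Sum>n\<le>N. if n = m then 2 * ((2 * real m + 1) * (a m)\<^sup>2) else 0)"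
        by (intro sum.cong) (auto simp: legendre_orthogonal power2_eq_square)
      then show "(\<Sum>n\<le>N. ((2 * real m + 1) * a m) * ((2 * real n
          + 1) * a n) * pint (legendre_poly m * legendre_poly n))
          = 2 * ((2 * real m + 1) * (a m)\<^sup>2)"
        using \<open>m \<in> {..N}\<close> by simp
    qed
    finally show ?thesis by (simp add: Z_def sum_distrib_left)
  qed
  finally have "Z \<le> K * sqrt (2 * (2 * Z))" .
  then have "Z\<^sup>2 \<le> (K * sqrt (2 * (2 * Z)))\<^sup>2" using \<open>Z \<ge> 0\<close> by (intro power_mono)
  also have "\<dots> = 4 * K\<^sup>2 * Z" using \<open>Z \<ge> 0\<close> by (simp add: power_mult_distrib)
  finally have "Z * Z \<le> 4 * K\<^sup>2 * Z" by (simp add: power2_eq_square)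
  then have "Z \<le> 4 * K\<^sup>2"
    using \<open>Z \<ge> 0\<close> by (cases "Z = 0") (auto simp: mult_le_cancel_right)
  then show ?thesis by (simp add: Z_def a_def)
qed

lemma legendre_bessel_inequality:
  "(\<Sum>n\<le>N. (2 * real n + 1) * (cmod (moment_functional \<mu> (legendre_poly n)))\<^sup>2) \<le> 8 * K\<^sup>2"
  using legendre_bessel_inequality_part[of Re N] legendre_bessel_inequality_part[of Im N]
  by (simp add: cmod_power2 distrib_left sum.distrib)

text \<open>One term is at most the whole sum, and 8 is at most 3^2.\<close>

lemma norm_legendre_le: "cmod (moment_functional \<mu> (legendre_poly n)) \<le> 3 * K"
proof -
  let ?c = "cmod (moment_functional \<mu> (legendre_poly n))"
  have "?c\<^sup>2 \<le> (2 * real n + 1) * ?c\<^sup>2" by (simp add: mult_le_cancel_right1)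
  also have "\<dots> \<le> (\<Sum>n\<le>n. (2 * real n + 1) * (cmod (moment_functional \<mu> (legendre_poly
      n)))\<^sup>2)"
    by (rule member_le_sum) auto
  also have "\<dots> \<le> 8 * K\<^sup>2" by (rule legendre_bessel_inequality)
  also have "\<dots> \<le> (3 * K)\<^sup>2" by (simp add: power_mult_distrib)
  finally show ?thesis by (rule power2_le_imp_le) (simp add: K_nonneg)
qed

text \<open>Both series are the functional applied to exp(i z t), expanded once in Legendre
  polynomials and once in powers. For the exponential series truncated to M terms both expansions
  are finite and agree; Tannery's theorem then lets M tend to infinity.\<close>

lemma neumann_series:
  "\<exists>s. (\<lambda>n. (2 * real n + 1) * \<i> ^ n * spherical_bessel_j n z * moment_functional \<mu>
      (legendre_poly n)) sums s
     \<and> (\<lambda>k. (\<i> * z) ^ k / fact k * \<mu> k) sums s"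
proof -
  define L where "L n = moment_functional \<mu> (legendre_poly n)" for n
  define m where "m k n = complex_of_real (pint (monom 1 k * legendre_poly n))" for k n
  \<comment> \<open>The contribution of P_n after the exponential series has been cut off at M
    terms.\<close>
  define a where "a n M = (2 * real n + 1) / 2 * (\<Sum>k<M. (\<i> * z) ^ k / fact k * m k n) * L n" for n M
  define b where "b n = (2 * real n + 1) * \<i> ^ n * spherical_bessel_j n z * L n" for n
  define r where "r = cmod z"
  define B where "B n = 3 * K * exp (r\<^sup>2 / 4) * ((3 * r / 2) ^ n / fact n)" for n
  have lim: "(\<lambda>M. a n M) \<longlonglongrightarrow> b n" for n
  proof -
    have "(\<lambda>M. (2 * real n + 1) / 2 * (\<Sum>k<M. (\<i> * z) ^ k / fact k * m k n) * L n)
        \<longlonglongrightarrow> (2 * real n + 1) / 2 * (2 * \<i> ^ n * spherical_bessel_j n z) * L n"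
      using legendre_moment_series[of z n] unfolding sums_def m_def
      by (intro tendsto_intros)
    moreover have "(2 * real n + 1) / 2 * (2 * \<i> ^ n * spherical_bessel_j n z) * L n = b n"
      by (simp add: b_def)
    ultimately show ?thesis by (simp only: a_def)
  qed
  have bnd: "cmod (a n M) \<le> B n" for n M
  proof -
    \<comment> \<open>The moments are nonnegative, so the Bessel function at \<open>- \<i> * r\<close> dominates all
      partial sums.\<close>
    have s: "(\<lambda>k. complex_of_real (r ^ k / fact k * pint (monom 1 k * legendre_poly n)))
        sums (2 * \<i> ^ n * spherical_bessel_j n (- \<i> * complex_of_real r))"
      using legendre_moment_series[of "- \<i> * complex_of_real r" n] by simp
    have nn: "r ^ k / fact k * pint (monom 1 k * legendre_poly n) \<ge> 0" for k
      by (simp add: legendre_moment_nonneg r_def)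
    have s': "(\<lambda>k. r ^ k / fact k * pint (monom 1 k * legendre_poly n))
        sums Re (2 * \<i> ^ n * spherical_bessel_j n (- \<i> * complex_of_real r))"
      using sums_Re[OF s] by (simp only: Re_complex_of_real)
    have "cmod (\<Sum>k<M. (\<i> * z) ^ k / fact k * m k n)
        \<le> (\<Sum>k<M. r ^ k / fact k * pint (monom 1 k * legendre_poly n))"
      using legendre_moment_nonneg[of _ n]
      by (intro sum_norm_le) (auto simp: m_def norm_mult norm_divide norm_power r_def)
    also have "\<dots> \<le> Re (2 * \<i> ^ n * spherical_bessel_j n (- \<i> * complex_of_real r))"
      using sum_le_suminf[OF sums_summable[OF s'], of "{..<M}"] sums_unique[OF s'] nn by auto
    also have "\<dots> \<le> cmod (2 * \<i> ^ n * spherical_bessel_j n (- \<i> * complex_of_real r))"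
      by (rule complex_Re_le_cmod)
    also have "\<dots> \<le> 2 * ((r / 2) ^ n / fact n * exp (r\<^sup>2 / 4))"
      using norm_spherical_bessel_le[of n "- \<i> * complex_of_real r"]
      by (simp add: norm_mult norm_power r_def)
    finally have 1: "cmod (\<Sum>k<M. (\<i> * z) ^ k / fact k * m k n) \<le> 2
        * ((r / 2) ^ n / fact n * exp (r\<^sup>2 / 4))" .
    have "cmod (complex_of_real ((2 * real n + 1) / 2)) = (2 * real n + 1) / 2"
      by (simp only: norm_of_real) simp
    then have "cmod (a n M) = (2 * real n + 1) / 2 * cmod (\<Sum>k<M. (\<i> * z) ^ k / fact k * m k n) * cmod (L n)"
      by (simp add: a_def norm_mult)
    also have "\<dots> \<le> 3 ^ n / 2 * (2 * ((r / 2) ^ n / fact n * exp (r\<^sup>2 / 4))) * (3 * K)"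
      using 1 norm_legendre_le[of n] odd_le_power_3[of n] K_nonneg
      by (intro mult_mono) (auto simp: L_def r_def)
    also have "\<dots> = B n"
      by (simp add: B_def power_mult_distrib power_divide)
    finally show ?thesis .
  qed
  have sB: "summable B" unfolding B_def by (intro summable_mult sums_summable[OF exp_sums])
  have T: "eventually (\<lambda>M. summable (\<lambda>n. norm (a n M))) sequentially \<and>
           summable (\<lambda>n. norm (b n)) \<and>
           ((\<lambda>M. suminf (\<lambda>n. a n M)) \<longlonglongrightarrow> suminf b)"
  proof (rule tannerys_theorem[OF lim _ sB])
    show "eventually (\<lambda>(n, M). norm (a n M) \<le> B n) (sequentially \<times>\<^sub>F sequentially)"
      by (intro always_eventually) (use bnd in auto)
  qed auto
  have "suminf (\<lambda>n. a n M) = (\<Sum>k<M. (\<i> * z) ^ k / fact k * \<mu> k)" for M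
  proof -
    \<comment> \<open>For n at least M the polynomial P_n is orthogonal to all powers that
      remain.\<close>
    have "suminf (\<lambda>n. a n M) = (\<Sum>n<M. a n M)"
      by (rule suminf_finite) (auto simp: a_def m_def legendre_moment_0)
    also have "\<dots> = (\<Sum>k<M. (\<i> * z) ^ k / fact k * (\<Sum>n<M. (2 * real n + 1) / 2 * m k n * L n))"
      unfolding a_def sum_distrib_left sum_distrib_right
      by (subst sum.swap) (simp add: mult_ac)
    also have "\<dots> = (\<Sum>k<M. (\<i> * z) ^ k / fact k * \<mu> k)"
    proof (rule sum.cong[OF refl])
      fix k assume k: "k \<in> {..<M}"
      define d where "d n = (2 * real n + 1) / 2 * pint (monom 1 k * legendre_poly n)" for n
      \<comment> \<open>Here k < M excludes M = 0, so \<open>M - 1\<close> is a genuine degree bound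
        for x^k.\<close>
      have "\<mu> k = moment_functional \<mu> (\<Sum>n\<le>M - 1. smult (d n) (legendre_poly n))"
        using legendre_expansion[of "monom 1 k" "M - 1"] k
        by (simp add: d_def moment_functional_monom[symmetric] degree_monom_eq)
      also have "\<dots> = (\<Sum>n\<le>M - 1. complex_of_real (d n) * L n)"
        by (simp add: moment_functional_sum moment_functional_smult L_def)
      also have "{..M - 1} = {..<M}" using k by auto
      finally have "\<mu> k = (\<Sum>n<M. (2 * real n + 1) / 2 * m k n * L n)"
        by (simp add: d_def m_def)
      then show "(\<i> * z) ^ k / fact k * (\<Sum>n<M. (2 * real n + 1) / 2 * m k n * L n)
          = (\<i> * z) ^ k / fact k * \<mu> k"
        by simp
    qed
    finally show ?thesis .
  qed
  with T have "(\<lambda>k. (\<i> * z) ^ k / fact k * \<mu> k) sums suminf b"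
    by (simp add: sums_def)
  moreover have "b sums suminf b" using T summable_norm_cancel summable_sums by blast
  ultimately show ?thesis by (auto simp: b_def[abs_def] L_def)
qed

end

subsection \<open>Formal powers and the transmutation kernel\<close>

text \<open>A mean value inequality with a comparison function: choosing \<open>\<phi>\<close> with
  the bound as its derivative replaces estimates of integrals by closed forms.\<close>

lemma norm_increment_le:
  fixes f :: "real \<Rightarrow> 'a :: real_normed_vector" and \<phi> :: "real \<Rightarrow> real"
  assumes "a \<le> b"
    and f: "\<And>x. x \<in> {a..b} \<Longrightarrow> (f has_vector_derivative f' x) (at x within {a..b})"
    and \<phi>: "\<And>x. x \<in> {a..b} \<Longrightarrow> (\<phi>
        has_real_derivative \<phi>' x) (at x within {a..b})"
    and le: "\<And>x. x \<in> {a..b} \<Longrightarrow> norm (f' x) \<le> \<phi>' x"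
  shows "norm (f b - f a) \<le> \<phi> b - \<phi> a"
proof (cases "a < b")
  case True
  show ?thesis
  proof (rule differentiable_bound_general[OF True])
    show "continuous_on {a..b} f"
      using f by (meson continuous_on_eq_continuous_within has_vector_derivative_continuous)
    show "continuous_on {a..b} \<phi>"
      using \<phi> by (meson DERIV_continuous continuous_on_eq_continuous_within)
    show "(f has_vector_derivative f' x) (at x)" if "a < x" "x < b" for x
      using f[of x] that by (simp add: at_within_Icc_at)
    show "(\<phi> has_vector_derivative \<phi>' x) (at x)" if "a < x" "x < b" for x
      using \<phi>[of x] that by (simp add: at_within_Icc_at has_real_derivative_iff_has_vector_derivative)
  qed (use le in auto)
qed (use \<open>a \<le> b\<close> in auto)

lemma has_vector_derivative_series:
  fixes f :: "nat \<Rightarrow> real \<Rightarrow> 'a :: banach"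
  assumes "convex S"
    and f: "\<And>n x. x \<in> S \<Longrightarrow> (f n has_vector_derivative f' n x) (at x within S)"
    and M: "\<And>n x. x \<in> S \<Longrightarrow> norm (f' n x) \<le> M n" "summable M"
    and x0: "x0 \<in> S" "summable (\<lambda>n. f n x0)"
    and x: "x \<in> S"
  shows "((\<lambda>x. \<Sum>n. f n x) has_vector_derivative (\<Sum>n. f' n x)) (at x within S)"
proof -
  have "\<exists>F. \<forall>x\<in>S. (\<lambda>n. f n x) sums F x \<and> (F
      has_derivative (\<lambda>h. h *\<^sub>R (\<Sum>n. f' n x))) (at x within S)"
  proof (rule has_derivative_series[where f' = "\<lambda>n x h. h *\<^sub>R f' n x" and x
      = x0, OF \<open>convex S\<close>])
    show "(f n has_derivative (\<lambda>h. h *\<^sub>R f' n x)) (at x within S)" if "x \<in> S" for n x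
      using f[OF that] by (simp add: has_vector_derivative_def)
    show "x0 \<in> S" "(\<lambda>n. f n x0) sums (\<Sum>n. f n x0)"
      using x0 by (auto intro: summable_sums)
    fix e :: real assume "e > 0"
    have "uniform_limit S (\<lambda>n x. \<Sum>i<n. f' i x) (\<lambda>x. \<Sum>i. f' i x) sequentially"
      by (rule Weierstrass_m_test[OF M])
    then have "\<forall>\<^sub>F n in sequentially. \<forall>x\<in>S. norm ((\<Sum>i<n. f' i x)
        - (\<Sum>i. f' i x)) < e"
      using \<open>e > 0\<close> by (simp add: uniform_limit_iff dist_norm)
    then show "\<forall>\<^sub>F n in sequentially. \<forall>x\<in>S. \<forall>h.
        norm ((\<Sum>i<n. h *\<^sub>R f' i x) - h *\<^sub>R (\<Sum>n. f' n x)) \<le> e * norm h"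
    proof eventually_elim
      case (elim n)
      show ?case
      proof (intro ballI allI)
        fix x h assume "x \<in> S"
        have "norm ((\<Sum>i<n. h *\<^sub>R f' i x) - h *\<^sub>R (\<Sum>n. f' n x))
            = \<bar>h\<bar> * norm ((\<Sum>i<n. f' i x) - (\<Sum>i. f' i x))"
          by (simp flip: scaleR_sum_right scaleR_diff_right)
        also have "\<dots> \<le> \<bar>h\<bar> * e"
          using elim \<open>x \<in> S\<close> by (intro mult_left_mono) (auto intro: less_imp_le)
        finally show "norm ((\<Sum>i<n. h *\<^sub>R f' i x) - h *\<^sub>R (\<Sum>n. f' n x)) \<le> e * norm h"
          by (simp add: mult.commute)
      qed
    qed
  qed
  then obtain F where F: "\<And>x. x \<in> S \<Longrightarrow> (\<lambda>n. f n x) sums F x"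
      "\<And>x. x \<in> S \<Longrightarrow> (F has_derivative (\<lambda>h. h *\<^sub>R (\<Sum>n. f' n x))) (at
          x within S)"
    by blast
  have 1: "(F has_vector_derivative (\<Sum>n. f' n x)) (at x within S)"
    using F(2)[OF x] by (simp add: has_vector_derivative_def)
  have 2: "(\<Sum>n. f n y) = F y" if "y \<in> S" for y
    using sums_unique[OF F(1)[OF that]] by simp
  show ?thesis
    by (rule has_vector_derivative_transform[OF x 2 1])
qed

lemma has_vector_derivative_inverse:
  fixes f :: "real \<Rightarrow> complex"
  assumes "(f has_vector_derivative f') (at x within S)" "f x \<noteq> 0"
  shows "((\<lambda>x. 1 / f x) has_vector_derivative - f' / (f x)\<^sup>2) (at x within S)"
proof -
  have "((\<lambda>z. 1 / z) has_field_derivative - 1 / (f x)\<^sup>2) (at (f x) within f ` S)"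
    using assms(2) by (auto intro!: derivative_eq_intros simp: power2_eq_square)
  from field_vector_diff_chain_within[OF assms(1) this] show ?thesis
    by (simp add: o_def)
qed

text \<open>The formal powers depend on the potential \<open>q\<close> only through
  \<open>g\<close>, so \<open>q\<close> is kept out here; the equation for \<open>g\<close> is
  brought in where solutions are verified.\<close>

locale liouville =
  fixes A B :: real and p r p' r' :: "real \<Rightarrow> real" and g g' :: "real \<Rightarrow> complex"
  assumes AB: "A < B"
    and p_deriv: "\<And>y. y \<in> {A..B} \<Longrightarrow> (p has_real_derivative p' y) (at y within {A..B})"
    and r_deriv: "\<And>y. y \<in> {A..B} \<Longrightarrow> (r has_real_derivative r' y) (at y within {A..B})"
    and p'_cont: "continuous_on {A..B} p'" and r'_cont: "continuous_on {A..B} r'"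
    and p_pos: "\<And>y. y \<in> {A..B} \<Longrightarrow> p y > 0" and r_pos: "\<And>y. y \<in> {A..B}
        \<Longrightarrow> r y > 0"
    and g_deriv: "\<And>y. y \<in> {A..B} \<Longrightarrow> (g has_vector_derivative g' y) (at y within {A..B})"
    and g'_cont: "continuous_on {A..B} g'"
    and gA: "g A = 1 / complex_of_real (sl_rho p r A)"
    and g_nz: "\<And>y. y \<in> {A..B} \<Longrightarrow> g y \<noteq> 0"
begin

section \<open>The Liouville change of variables\<close>

abbreviation "l \<equiv> sl_l A p r"
abbreviation "\<rho> \<equiv> sl_rho p r"

lemma p_cont: "continuous_on {A..B} p" and r_cont: "continuous_on {A..B} r"
  using p_deriv r_deriv by (meson DERIV_continuous continuous_on_eq_continuous_within)+

lemma g_cont: "continuous_on {A..B} g"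
  using g_deriv by (meson continuous_on_eq_continuous_within has_vector_derivative_continuous)

lemma rho_pos: "y \<in> {A..B} \<Longrightarrow> \<rho> y > 0"
  using p_pos[of y] r_pos[of y] by (auto simp: sl_rho_def)

lemma rho_sq: "y \<in> {A..B} \<Longrightarrow> (\<rho> y)\<^sup>2 = sqrt (p y * r y)"
  using p_pos[of y] r_pos[of y]
  by (auto simp: sl_rho_def powr_half_sqrt powr_powr simp flip: powr_realpow)

definition dl :: "real \<Rightarrow> real" where "dl y = sqrt (r y / p y)"

lemma dl_pos: "y \<in> {A..B} \<Longrightarrow> dl y > 0"
  using p_pos[of y] r_pos[of y] by (auto simp: dl_def)

lemma dl_cont: "continuous_on {A..B} dl"
  unfolding dl_def using p_pos by (auto intro!: continuous_intros p_cont r_cont simp: less_le)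

lemma rho_sq_eq:
  assumes "y \<in> {A..B}"
  shows "(\<rho> y)\<^sup>2 = dl y * p y" "r y = dl y * (\<rho> y)\<^sup>2"
proof -
  have *: "p y > 0" "r y > 0" using assms p_pos r_pos by auto
  show 1: "(\<rho> y)\<^sup>2 = dl y * p y"
    using * by (simp add: rho_sq[OF assms] dl_def real_sqrt_mult real_sqrt_divide field_simps)
  show "r y = dl y * (\<rho> y)\<^sup>2"
    using * by (simp add: rho_sq[OF assms] dl_def real_sqrt_mult real_sqrt_divide field_simps)
qed

lemma l_deriv: "y \<in> {A..B} \<Longrightarrow> (l has_real_derivative dl y) (at y within {A..B})"
  using integral_has_vector_derivative[OF dl_cont, of y]
  by (simp add: has_real_derivative_iff_has_vector_derivative sl_l_def[abs_def] dl_def[abs_def])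

lemma l_cont: "continuous_on {A..B} l"
  using l_deriv by (meson DERIV_continuous continuous_on_eq_continuous_within)

lemma l_A [simp]: "l A = 0"
  by (simp add: sl_l_def)

lemma l_strict_mono:
  assumes "A \<le> x" "x < y" "y \<le> B"
  shows "l x < l y"
proof (rule DERIV_pos_imp_increasing_open[OF assms(2)])
  show "continuous_on {x..y} l"
    by (rule continuous_on_subset[OF l_cont]) (use assms in auto)
  show "\<exists>d. (l has_real_derivative d) (at z) \<and> d > 0" if "x < z" "z < y" for z
    using l_deriv[of z] dl_pos[of z] that assms by (auto simp: at_within_Icc_at)
qed

lemma l_mono: "A \<le> x \<Longrightarrow> x \<le> y \<Longrightarrow> y \<le> B \<Longrightarrow> l x \<le> l y"
  using l_strict_mono[of x y] by (cases "x = y") auto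

lemma l_nonneg: "y \<in> {A..B} \<Longrightarrow> l y \<ge> 0"
  using l_mono[of A y] by simp

lemma l_pos: "y \<in> {A<..B} \<Longrightarrow> l y > 0"
  using l_strict_mono[of A y] by simp

text \<open>The Liouville transform of \<open>g\<close>. In the variable l it plays the part that
  \<open>g\<close> plays for p = r = 1, and the normalization of \<open>g\<close> makes it start at
  1.\<close>

definition G :: "real \<Rightarrow> complex" where "G y = g y * complex_of_real (\<rho> y)"

definition d\<rho> :: "real \<Rightarrow> real" where
  "d\<rho> y = \<rho> y / (p y * r y) * ((p' y * r y + p y * r' y) / 4)"

definition dG :: "real \<Rightarrow> complex" where
  "dG y = g y * complex_of_real (d\<rho> y) + g' y * complex_of_real (\<rho> y)"

lemma rho_deriv:
  assumes "y \<in> {A..B}"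
  shows "(\<rho> has_real_derivative d\<rho> y) (at y within {A..B})"
proof -
  have *: "p y * r y > 0" using p_pos[OF assms] r_pos[OF assms] by simp
  have "((\<lambda>y. p y * r y) has_real_derivative (p' y * r y + p y * r' y)) (at y within {A..B})"
    using DERIV_mult[OF p_deriv[OF assms] r_deriv[OF assms]] by (simp add: algebra_simps)
  from DERIV_chain2[OF DERIV_powr[OF DERIV_ident * DERIV_const[of "1 / 4"]] this]
  have "((\<lambda>y. (p y * r y) powr (1 / 4)) has_real_derivative
      (p y * r y) powr (1 / 4) * (0 * ln (p y * r y) + 1 * (1 / 4) / (p y * r y)) * (p' y * r y + p y * r' y))
      (at y within {A..B})"
    by simp
  then show ?thesis
    by (simp add: sl_rho_def[abs_def] d\<rho>_def mult_ac)
qed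

lemma rho_cont: "continuous_on {A..B} \<rho>"
  using rho_deriv by (meson DERIV_continuous continuous_on_eq_continuous_within)

lemma G_deriv: "y \<in> {A..B} \<Longrightarrow> (G has_vector_derivative dG y) (at y within {A..B})"
  using has_vector_derivative_mult[OF g_deriv has_vector_derivative_of_real, of y \<rho> "d\<rho> y"] rho_deriv[of y]
  by (simp add: G_def[abs_def] dG_def has_real_derivative_iff_has_vector_derivative)

lemma G_nz: "y \<in> {A..B} \<Longrightarrow> G y \<noteq> 0"
  using g_nz[of y] rho_pos[of y] by (simp add: G_def)

lemma G_A: "G A = 1"
  using rho_pos[of A] AB by (simp add: G_def gA)

lemma dG_cont: "continuous_on {A..B} dG"
  unfolding dG_def d\<rho>_def
  using p_pos r_pos
  by (auto intro!: continuous_intros g_cont g'_cont p_cont r_cont p'_cont r'_cont rho_cont simp: less_le)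

lemma G_cont: "continuous_on {A..B} G"
  unfolding G_def by (intro continuous_intros g_cont rho_cont)

definition \<tau> :: "real \<Rightarrow> complex" where "\<tau> y = dG y / G y"

text \<open>Dividing by \<open>dl\<close> turns the logarithmic derivative of \<open>G\<close> into
  a derivative with respect to l, bounded by compactness. In this form it can be integrated exactly
  against a weight exp(2 S l).\<close>

lemma tau_bound: "\<exists>S>0. \<forall>y\<in>{A..B}. cmod (\<tau> y) \<le> S * dl y"
proof -
  have "continuous_on {A..B} (\<lambda>y. cmod (\<tau> y) / dl y)"
    unfolding \<tau>_def using G_nz dl_pos
    by (auto intro!: continuous_intros G_cont dG_cont dl_cont simp: less_le)
  then have "compact ((\<lambda>y. cmod (\<tau> y) / dl y) ` {A..B})"
    by (rule compact_continuous_image) simp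
  then obtain S where S: "\<And>y. y \<in> {A..B} \<Longrightarrow> cmod (\<tau> y) / dl y \<le> S"
    by (fastforce dest!: compact_imp_bounded bounded_imp_bdd_above simp: bdd_above_def)
  show ?thesis
  proof (intro exI[of _ "\<bar>S\<bar> + 1"] conjI ballI)
    fix y assume "y \<in> {A..B}"
    then have "cmod (\<tau> y) \<le> S * dl y" using S[of y] dl_pos[of y] by (simp add: pos_divide_le_eq)
    also have "\<dots> \<le> (\<bar>S\<bar> + 1) * dl y"
      using dl_pos[OF \<open>y \<in> {A..B}\<close>] by (intro mult_right_mono) auto
    finally show "cmod (\<tau> y) \<le> (\<bar>S\<bar> + 1) * dl y" .
  qed auto
qed

section \<open>Formal powers and their exponential generating functions\<close>

definition X :: "nat \<Rightarrow> real \<Rightarrow> complex" where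
  "X k = (if odd k then formal_Y A p r g k else formal_Yt A p r g k)"

definition Z :: "nat \<Rightarrow> real \<Rightarrow> complex" where
  "Z k = (if odd k then formal_Yt A p r g k else formal_Y A p r g k)"

lemma Phi_eq: "formal_Phi A p r g k y = g y * X k y"
  by (simp add: formal_Phi_def X_def)

definition u :: "real \<Rightarrow> complex" where "u s = 1 / ((g s)\<^sup>2 * complex_of_real (p s))"
definition w :: "real \<Rightarrow> complex" where "w s = (g s)\<^sup>2 * complex_of_real (r s)"

lemma X_0 [simp]: "X 0 y = 1" and Z_0 [simp]: "Z 0 y = 1"
  by (simp_all add: X_def Z_def)

text \<open>Regrouping the two families by parity removes the case distinction: the weight is always
  \<open>u\<close> for \<open>X\<close> and always \<open>w\<close> for \<open>Z\<close>.\<close>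

lemma X_Suc: "X (Suc n) y = of_nat (Suc n) * integral {A..y} (\<lambda>s. Z n s * u s)"
  and Z_Suc: "Z (Suc n) y = of_nat (Suc n) * integral {A..y} (\<lambda>s. X n s * w s)"
  by (simp_all add: X_def Z_def u_def w_def)

lemma X_Suc_A [simp]: "X (Suc n) A = 0" and Z_Suc_A [simp]: "Z (Suc n) A = 0"
  by (simp_all add: X_Suc Z_Suc)

lemma u_cont: "continuous_on {A..B} u"
  unfolding u_def using g_nz p_pos by (auto intro!: continuous_intros g_cont p_cont simp: less_le)

lemma w_cont: "continuous_on {A..B} w"
  unfolding w_def by (intro continuous_intros g_cont r_cont)

lemma integral_deriv:
  fixes f :: "real \<Rightarrow> complex"
  assumes "continuous_on {A..B} f" "y \<in> {A..B}"
  shows "((\<lambda>y. c * integral {A..y} f) has_vector_derivative c * f y) (at y within {A..B})"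
  by (intro has_vector_derivative_mult_right integral_has_vector_derivative assms)

lemma XZ_cont: "continuous_on {A..B} (X n) \<and> continuous_on {A..B} (Z n)"
proof (induction n)
  case 0
  have "X 0 = (\<lambda>_. 1)" "Z 0 = (\<lambda>_. 1)" by auto
  then show ?case by simp
next
  case (Suc n)
  have "continuous_on {A..B} (\<lambda>s. Z n s * u s)" "continuous_on {A..B} (\<lambda>s. X n s * w s)"
    using Suc by (auto intro!: continuous_intros u_cont w_cont)
  from this[THEN integral_deriv] show ?case
    unfolding X_Suc[abs_def] Z_Suc[abs_def]
    by (meson continuous_on_eq_continuous_within has_vector_derivative_continuous)
qed

lemma X_deriv:
  "y \<in> {A..B} \<Longrightarrow> (X (Suc n) has_vector_derivative of_nat (Suc n)
      * (Z n y * u y)) (at y within {A..B})"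
  unfolding X_Suc[abs_def] using XZ_cont
  by (intro integral_deriv) (auto intro!: continuous_intros u_cont)

lemma Z_deriv:
  "y \<in> {A..B} \<Longrightarrow> (Z (Suc n) has_vector_derivative of_nat (Suc n)
      * (X n y * w y)) (at y within {A..B})"
  unfolding Z_Suc[abs_def] using XZ_cont
  by (intro integral_deriv) (auto intro!: continuous_intros w_cont)

lemma uw_bound: "\<exists>c>0. \<forall>y\<in>{A..B}. cmod (u y) \<le> c \<and> cmod (w y) \<le> c"
proof -
  have "bounded (u ` {A..B})" "bounded (w ` {A..B})"
    by (intro compact_imp_bounded compact_continuous_image u_cont w_cont compact_Icc)+
  then obtain c d where "\<forall>y\<in>{A..B}. cmod (u y) \<le> c" "\<forall>y\<in>{A..B}. cmod (w y) \<le> d"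
    by (auto simp: bounded_iff)
  then show ?thesis by (intro exI[of _ "max 1 (max c d)"]) fastforce
qed

text \<open>The factor n in the formal powers cancels the 1/n from integrating (s - A)^(n - 1), so
  the growth is geometric and the exponential generating functions converge for every
  parameter.\<close>

lemma XZ_bound: "\<exists>c>0. \<forall>n. \<forall>y\<in>{A..B}. cmod (X n y) \<le> c ^ n \<and> cmod (Z n y)
    \<le> c ^ n"
proof -
  obtain c where c: "c > 0" "\<And>y. y \<in> {A..B} \<Longrightarrow> cmod (u y) \<le> c" "\<And>y. y \<in>
      {A..B} \<Longrightarrow> cmod (w y) \<le> c"
    using uw_bound by blast
  \<comment> \<open>Stated for abstract \<open>F\<close>, \<open>H\<close> and \<open>v\<close>,
    since it is applied to X over Z and to Z over X.\<close>
  have step: "cmod (F y) \<le> (c * (y - A)) ^ Suc n"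
    if F: "\<And>y. y \<in> {A..B} \<Longrightarrow> (F has_vector_derivative of_nat (Suc n)
        * (H y * v y)) (at y within {A..B})"
      and "F A = 0" and H: "\<And>y. y \<in> {A..B} \<Longrightarrow> cmod (H y) \<le> (c * (y - A)) ^ n"
      and v: "\<And>y. y \<in> {A..B} \<Longrightarrow> cmod (v y) \<le> c" and y: "y \<in> {A..B}"
    for F H v y n
  proof -
    have "norm (F y - F A) \<le> (c * (y - A)) ^ Suc n - (c * (A - A)) ^ Suc n"
    proof (rule norm_increment_le)
      show "(F has_vector_derivative of_nat (Suc n) * (H x * v x)) (at x within {A..y})" if "x \<in> {A..y}" for x
        by (rule has_vector_derivative_within_subset[OF F]) (use that y in auto)
      show "((\<lambda>x. (c * (x - A)) ^ Suc n) has_real_derivative real (Suc n) * ((c * (x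
          - A)) ^ n * c)) (at x within {A..y})" for x
      proof -
        have "((\<lambda>x. c * (x - A)) has_real_derivative c) (at x within {A..y})"
          by (auto intro!: derivative_eq_intros)
        from DERIV_power_Suc[OF this, of n] show ?thesis
          by (simp only: mult_ac of_nat_Suc add.commute)
      qed
      show "norm (of_nat (Suc n) * (H x * v x)) \<le> real (Suc n) * ((c * (x - A)) ^ n * c)"
          if "x \<in> {A..y}" for x
        using that y c(1) H[of x] v[of x]
        by (auto simp: norm_mult simp del: of_nat_Suc intro!: mult_left_mono mult_mono)
    qed (use y in auto)
    then show ?thesis using \<open>F A = 0\<close> by simp
  qed
  have "\<forall>y\<in>{A..B}. cmod (X n y) \<le> (c * (y - A)) ^ n \<and> cmod (Z n y) \<le> (c * (y - A)) ^ n" for n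
  proof (induction n)
    case (Suc n)
    then show ?case
      using step[OF X_deriv X_Suc_A, of n] step[OF Z_deriv Z_Suc_A, of n] c by blast
  qed simp
  moreover have "(c * (y - A)) ^ n \<le> (c * (B - A)) ^ n" if "y \<in> {A..B}" for n y
    using that c(1) by (intro power_mono mult_left_mono) auto
  ultimately have "\<forall>n. \<forall>y\<in>{A..B}. cmod (X n y) \<le> (c * (B
      - A)) ^ n \<and> cmod (Z n y) \<le> (c * (B - A)) ^ n"
    by (meson order.trans)
  moreover have "c * (B - A) > 0" using c(1) AB by simp
  ultimately show ?thesis by blast
qed

text \<open>Analogues of the exponential: the pair solves the linear system aX' = \<theta> u aZ, aZ'
  = \<theta> w aX with both initial values 1.\<close>

definition aX :: "complex \<Rightarrow> real \<Rightarrow> complex" where "aX \<theta> y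
    = (\<Sum>k. \<theta> ^ k / fact k * X k y)"
definition aZ :: "complex \<Rightarrow> real \<Rightarrow> complex" where "aZ \<theta> y
    = (\<Sum>k. \<theta> ^ k / fact k * Z k y)"

lemma exp_series_deriv:
  assumes F: "\<And>n y. y \<in> {A..B} \<Longrightarrow>
      (F (Suc n) has_vector_derivative of_nat (Suc n) * (H n y * v y)) (at y within {A..B})"
    and F0: "\<And>y. F 0 y = 1"
    and c: "c > 0" "\<And>n y. y \<in> {A..B} \<Longrightarrow> cmod (F n y) \<le> c ^ n" "\<And>n y. y \<in>
        {A..B} \<Longrightarrow> cmod (H n y) \<le> c ^ n"
    and d: "\<And>y. y \<in> {A..B} \<Longrightarrow> cmod (v y) \<le> d" "d > 0"
    and y: "y \<in> {A..B}"
  shows "summable (\<lambda>k. \<theta> ^ k / fact k * F k y)"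
    and "((\<lambda>y. \<Sum>k. \<theta> ^ k / fact k * F k y) has_vector_derivative
      \<theta> * (\<Sum>k. \<theta> ^ k / fact k * H k y) * v y) (at y within {A..B})"
proof -
  have *: "summable (\<lambda>k. \<theta> ^ k / fact k * E k y)"
    if "y \<in> {A..B}" "\<And>n y. y \<in> {A..B} \<Longrightarrow> cmod (E n y) \<le> c ^ n"
        for E :: "nat \<Rightarrow> real \<Rightarrow> complex" and y
  proof (rule summable_comparison_test)
    show "summable (\<lambda>k. (cmod \<theta> * c) ^ k / fact k)" by (rule sums_summable[OF exp_sums])
    show "\<exists>N. \<forall>n\<ge>N. cmod (\<theta> ^ n / fact n * E n y) \<le> (cmod \<theta> * c) ^ n / fact n"
      using that by (auto simp: norm_mult norm_divide norm_power power_mult_distrib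
        intro!: divide_right_mono mult_left_mono)
  qed
  show "summable (\<lambda>k. \<theta> ^ k / fact k * F k y)" using * y c by blast
  \<comment> \<open>The term k = 0 is constant; every other derivative is the preceding term of the
    dual series times \<open>\<theta> * v\<close>.\<close>
  define f' where "f' k y = (case k of 0 \<Rightarrow> 0 | Suc n \<Rightarrow> \<theta>
      * (\<theta> ^ n / fact n * H n y) * v y)" for k y
  have fact: "\<theta> ^ Suc n / fact (Suc n) * (of_nat (Suc n) * x) = \<theta> * (\<theta> ^ n / fact n * x)"
      for n and x :: complex
    by (simp add: field_simps del: of_nat_Suc)
  have "((\<lambda>y. \<Sum>k. \<theta> ^ k / fact k * F k y)
      has_vector_derivative (\<Sum>k. f' k y)) (at y within {A..B})"
  proof (rule has_vector_derivative_series)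
    show "((\<lambda>y. \<theta> ^ k / fact k * F k y) has_vector_derivative f' k y) (at y within {A..B})"
      if "y \<in> {A..B}" for k y
    proof (cases k)
      case 0
      then show ?thesis by (simp add: f'_def F0)
    next
      case (Suc n)
      from has_vector_derivative_mult_right[OF F[OF that, of n], of "\<theta> ^ Suc n / fact (Suc n)"]
      show ?thesis unfolding fact by (simp add: f'_def Suc mult.assoc del: power_Suc fact_Suc)
    qed
    define M where "M k = (case k of 0 \<Rightarrow> 0 | Suc n \<Rightarrow> cmod \<theta>
        * ((cmod \<theta> * c) ^ n / fact n) * d)" for k
    have "summable (\<lambda>n. M (Suc n))"
      unfolding M_def nat.case by (intro summable_mult summable_mult2 sums_summable[OF exp_sums])
    then show "summable M" by (simp only: summable_Suc_iff)
    show "norm (f' k y) \<le> M k" if "y \<in> {A..B}" for k y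
      using that c d by (auto simp: f'_def M_def norm_mult norm_divide norm_power power_mult_distrib
        split: nat.split intro!: divide_right_mono mult_left_mono mult_mono)
  qed (use y * c in auto)
  moreover have "(\<lambda>k. f' k y) sums (\<theta> * (\<Sum>k. \<theta> ^ k / fact k * H k y) * v y)"
  proof -
    have "(\<lambda>n. f' (Suc n) y) sums (\<theta> * (\<Sum>k. \<theta> ^ k / fact k * H k y) * v y)"
      unfolding f'_def nat.case by (intro sums_mult sums_mult2 summable_sums *[OF y c(3)])
    then show ?thesis by (subst (asm) sums_Suc_iff) (simp add: f'_def)
  qed
  ultimately show "((\<lambda>y. \<Sum>k. \<theta> ^ k / fact k * F k y) has_vector_derivative
      \<theta> * (\<Sum>k. \<theta> ^ k / fact k * H k y) * v y) (at y within {A..B})"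
    by (simp only: sums_unique[symmetric])
qed

lemma aX_sums: "y \<in> {A..B} \<Longrightarrow> (\<lambda>k. \<theta> ^ k / fact k * X k y) sums aX \<theta> y"
  and aX_deriv: "y \<in> {A..B} \<Longrightarrow> (aX \<theta>
      has_vector_derivative \<theta> * aZ \<theta> y * u y) (at y within {A..B})"
  and aZ_deriv: "y \<in> {A..B} \<Longrightarrow> (aZ \<theta>
      has_vector_derivative \<theta> * aX \<theta> y * w y) (at y within {A..B})"
proof -
  obtain c where c: "c > 0" "\<And>n y. y \<in> {A..B} \<Longrightarrow> cmod (X n y) \<le> c ^ n"
    "\<And>n y. y \<in> {A..B} \<Longrightarrow> cmod (Z n y) \<le> c ^ n"
    using XZ_bound by blast
  obtain d where d: "d > 0" "\<And>y. y \<in> {A..B} \<Longrightarrow> cmod (u y) \<le> d" "\<And>y. y \<in>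
      {A..B} \<Longrightarrow> cmod (w y) \<le> d"
    using uw_bound by blast
  assume y: "y \<in> {A..B}"
  show "(\<lambda>k. \<theta> ^ k / fact k * X k y) sums aX \<theta> y"
    unfolding aX_def using exp_series_deriv(1)[OF X_deriv X_0 c d(2,1) y]
    by (rule summable_sums)
  show "(aX \<theta> has_vector_derivative \<theta> * aZ \<theta> y * u y) (at y within {A..B})"
    unfolding aX_def[abs_def] aZ_def by (rule exp_series_deriv(2)[OF X_deriv X_0 c d(2,1) y])
  show "(aZ \<theta> has_vector_derivative \<theta> * aX \<theta> y * w y) (at y within {A..B})"
    unfolding aZ_def[abs_def] aX_def by (rule exp_series_deriv(2)[OF Z_deriv Z_0 c(1,3,2) d(3,1) y])
qed

lemma aX_A: "aX \<theta> A = 1" and aZ_A: "aZ \<theta> A = 1"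
proof -
  have "(\<lambda>k. \<theta> ^ k / fact k * X k A) = (\<lambda>k. if k = 0 then 1 else 0)"
    "(\<lambda>k. \<theta> ^ k / fact k * Z k A) = (\<lambda>k. if k = 0 then 1 else 0)"
    by (auto simp: fun_eq_iff gr0_conv_Suc)
  with sums_single[of 0 "\<lambda>_. 1 :: complex", THEN sums_unique] show "aX \<theta> A = 1" "aZ \<theta> A = 1"
    by (simp_all only: aX_def aZ_def)
qed

text \<open>In other words u = l' / G^2 and w = l' G^2: with respect to l both characteristic speeds
  become constant, and only \<open>G\<close> is left as a coefficient.\<close>

lemma G_u: "s \<in> {A..B} \<Longrightarrow> G s * u s = of_real (dl s) / G s"
  and w_G: "s \<in> {A..B} \<Longrightarrow> w s / G s = of_real (dl s) * G s"
proof -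
  assume s: "s \<in> {A..B}"
  have nz: "g s \<noteq> 0" "complex_of_real (\<rho> s) \<noteq> 0" "complex_of_real (p s) \<noteq> 0"
    using g_nz[OF s] rho_pos[OF s] p_pos[OF s] by auto
  have "complex_of_real ((\<rho> s)\<^sup>2) = of_real (dl s * p s)" "complex_of_real (r s) = of_real (dl s
      * (\<rho> s)\<^sup>2)"
    using rho_sq_eq[OF s] by auto
  then show "G s * u s = of_real (dl s) / G s" "w s / G s = of_real (dl s) * G s"
    using nz by (simp_all add: G_def u_def w_def field_simps power2_eq_square)
qed

section \<open>The wave equation: Riemann invariants and the domain of dependence\<close>

context
  fixes h :: "real poly" and y0 \<kappa> :: real
  assumes y0: "y0 \<in> {A<..B}" and \<kappa>: "\<kappa> = 1 / l y0"
begin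

text \<open>\<open>wave X 0\<close> and \<open>wave Z 0\<close> are the images of the translates of \<open>h\<close>, with time scaled by
  \<open>1 / l y0\<close>; the index \<open>j\<close> counts time derivatives. \<open>P\<close> and \<open>M\<close> are the Riemann invariants.\<close>

definition wave :: "(nat \<Rightarrow> real \<Rightarrow> complex) \<Rightarrow> nat \<Rightarrow> real
    \<Rightarrow> real \<Rightarrow> complex" where
  "wave F j s t = (\<Sum>k\<le>degree h. of_real (\<kappa> ^ k / fact k) * F k s * of_real (poly ((pderiv ^^ (k
      + j)) h) t))"

definition P :: "real \<Rightarrow> real \<Rightarrow> complex" where "P s t = G s * wave X 0 s t
    + 1 / G s * wave Z 0 s t"
definition M :: "real \<Rightarrow> real \<Rightarrow> complex" where "M s t = G s * wave X 0 s t
    - 1 / G s * wave Z 0 s t"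

lemma higher_pderiv_degree [simp]: "(pderiv ^^ Suc (degree h)) h = 0"
  by (rule poly_eqI) (simp add: coeff_higher_pderiv coeff_eq_0 del: funpow.simps)

text \<open>The wave is Taylor's formula for a translate of \<open>h\<close> with the powers
  replaced by \<open>F\<close>. Differentiating \<open>F\<close> lowers the index k by one, which
  amounts to a time derivative of the dual wave; the top term drops out because the derivative of
  \<open>h\<close> beyond its degree vanishes. The other summand is the chain rule along t = c +
  \<sigma> l(s).\<close>

lemma wave_deriv:
  assumes F: "\<And>n y. y \<in> {A..B} \<Longrightarrow>
      (F (Suc n) has_vector_derivative of_nat (Suc n) * (H n y * v y)) (at y within {A..B})"
    and F0: "\<And>y. F 0 y = 1"
    and s: "s \<in> {A..B}"
  shows "((\<lambda>s. wave F 0 s (c + \<sigma> * l s)) has_vector_derivative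
      of_real \<kappa> * v s * wave H 1 s (c + \<sigma> * l s) + of_real (\<sigma> * dl s) * wave F 1 s (c
          + \<sigma> * l s))
      (at s within {A..B})"
proof -
  let ?D = "\<lambda>k. (pderiv ^^ k) h"
  define F' where "F' k s = (case k of 0 \<Rightarrow> 0 | Suc n \<Rightarrow> of_nat (Suc n) * (H n s * v s))"
      for k s
  have dF: "(F k has_vector_derivative F' k s) (at s within {A..B})" for k
  proof (cases k)
    case 0
    have "F 0 = (\<lambda>_. 1)" using F0 by auto
    with 0 show ?thesis by (simp add: F'_def)
  qed (use F[OF s] in \<open>simp add: F'_def\<close>)
  have dp: "((\<lambda>s. complex_of_real (poly f (c + \<sigma> * l s))) has_vector_derivative
      of_real (\<sigma> * dl s * poly (pderiv f) (c + \<sigma> * l s))) (at s within {A..B})" for f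
  proof (rule has_vector_derivative_of_real)
    have "((\<lambda>s. c + \<sigma> * l s) has_real_derivative \<sigma> * dl s) (at s within {A..B})"
      using l_deriv[OF s] by (auto intro!: derivative_eq_intros)
    from DERIV_chain2[OF poly_DERIV this, of f]
    show "((\<lambda>s. poly f (c + \<sigma> * l s)) has_real_derivative \<sigma> * dl s * poly (pderiv f) (c
        + \<sigma> * l s))
        (at s within {A..B})"
      by (simp add: mult.commute)
  qed
  have wave_eq: "wave F 0 s t = (\<Sum>k\<le>degree h. of_real (\<kappa> ^ k / fact k)
      * (F k s * of_real (poly (?D k) t)))" for s t
    by (simp add: wave_def mult.assoc)
  have "((\<lambda>s. wave F 0 s (c + \<sigma> * l s)) has_vector_derivative
      (\<Sum>k\<le>degree h. of_real (\<kappa> ^ k / fact k)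
          * (F k s * of_real (\<sigma> * dl s * poly (pderiv (?D k)) (c + \<sigma> * l s))
        + F' k s * of_real (poly (?D k) (c + \<sigma> * l s))))) (at s within {A..B})"
    unfolding wave_eq
    by (intro has_vector_derivative_sum has_vector_derivative_mult_right has_vector_derivative_mult dF dp)
  also have "(\<Sum>k\<le>degree h. of_real (\<kappa> ^ k / fact k)
      * (F k s * of_real (\<sigma> * dl s * poly (pderiv (?D k)) (c + \<sigma> * l s))
        + F' k s * of_real (poly (?D k) (c + \<sigma> * l s))))
     = of_real (\<sigma> * dl s) * wave F 1 s (c + \<sigma> * l s)
       + (\<Sum>k\<le>degree h. of_real (\<kappa> ^ k / fact k) * F' k s * of_real (poly (?D k) (c
           + \<sigma> * l s)))"
    by (simp add: wave_def sum_distrib_left sum.distrib algebra_simps)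
  also have "(\<Sum>k\<le>degree h. of_real (\<kappa> ^ k / fact k) * F' k s * of_real (poly (?D k) (c
      + \<sigma> * l s)))
     = (\<Sum>k<degree h. of_real (\<kappa> ^ Suc k / fact (Suc k)) * F' (Suc k) s * of_real (poly (?D (Suc k))
         (c + \<sigma> * l s)))"
    by (subst sum.atMost_shift) (simp add: F'_def)
  also have "\<dots> = (\<Sum>k<degree h. of_real \<kappa> * v s
      * (of_real (\<kappa> ^ k / fact k) * H k s * of_real (poly (?D (Suc k)) (c + \<sigma> * l s))))"
    by (intro sum.cong refl) (simp add: F'_def field_simps del: of_nat_Suc funpow.simps)
  also have "\<dots> = of_real \<kappa> * v s * wave H 1 s (c + \<sigma> * l s)"
  proof -
    have "wave H 1 s (c + \<sigma> * l s)
      = (\<Sum>k<degree h. of_real (\<kappa> ^ k / fact k) * H k s * of_real (poly (?D (Suc k)) (c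
          + \<sigma> * l s)))"
      unfolding wave_def lessThan_Suc_atMost[symmetric] sum.lessThan_Suc
      by (simp add: higher_pderiv_degree[simplified])
    then show ?thesis by (simp only: sum_distrib_left)
  qed
  finally show ?thesis by (simp only: add.commute)
qed

lemma wave_A:
  assumes "\<And>y. F 0 y = 1" "\<And>n. F (Suc n) A = 0"
  shows "wave F 0 A t = of_real (poly h t)"
  unfolding wave_def sum.atMost_shift by (simp add: assms del: funpow.simps)

lemma kappa_pos: "\<kappa> > 0"
  using l_pos[OF y0] by (simp add: \<kappa>)

text \<open>Along its own characteristic each invariant loses all time derivatives, by the
  identities for \<open>u\<close> and \<open>w\<close>. What remains comes from differentiating
  \<open>G\<close> and 1/G, and it couples the invariants through \<open>\<tau>\<close>
  alone.\<close>

lemma characteristic_deriv: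
  assumes s: "s \<in> {A..B}"
  shows "((\<lambda>s. P s (c + (- \<kappa>) * l s)) has_vector_derivative \<tau> s * M s (c
      + (- \<kappa>) * l s)) (at s within {A..B})"
    and "((\<lambda>s. M s (c + \<kappa> * l s)) has_vector_derivative \<tau> s * P s (c
        + \<kappa> * l s)) (at s within {A..B})"
proof -
  note X' = wave_deriv[OF X_deriv X_0 s] and Z' = wave_deriv[OF Z_deriv Z_0 s]
  note G' = G_deriv[OF s] and I' = has_vector_derivative_inverse[OF G_deriv[OF s] G_nz[OF s]]
  \<comment> \<open>\<open>K\<close> stands for \<open>\<kappa>\<close> and \<open>L\<close> for
    \<open>dl s\<close>; \<open>a\<close>, \<open>b\<close> are the two waves and \<open>a1\<close>,
    \<open>b1\<close> their time derivatives.\<close>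
  have alg1: "G s * (K * u s * b1 + - K * L * a1) + dG s * a + (1 / G s * (K * w s * a1 + - K * L * b1) +
      - dG s / (G s)\<^sup>2 * b)
      = \<tau> s * (G s * a - 1 / G s * b)" (is ?A)
    and alg2: "G s * (K * u s * b1 + K * L * a1) + dG s * a - (1 / G s * (K * w s * a1 + K * L * b1) +
        - dG s / (G s)\<^sup>2 * b)
      = \<tau> s * (G s * a + 1 / G s * b)" (is ?B)
    if L: "L = of_real (dl s)" for K L a a1 b b1 :: complex
  proof -
    have u: "G s * (K * u s * x) = K * L / G s * x" for x
    proof -
      have "G s * (K * u s * x) = K * (G s * u s) * x" by (simp only: mult_ac)
      then show ?thesis unfolding G_u[OF s] L by simp
    qed
    have w: "1 / G s * (K * w s * x) = K * L * G s * x" for x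
    proof -
      have "1 / G s * (K * w s * x) = K * (w s / G s) * x" by simp
      then show ?thesis unfolding w_G[OF s] L by simp
    qed
    have t: "dG s = \<tau> s * G s" using G_nz[OF s] by (simp add: \<tau>_def)
    have "G s * (K * u s * b1) + G s * (- K * L * a1) + dG s * a
        + (1 / G s * (K * w s * a1) + 1 / G s * (- K * L * b1) + - dG s / (G s)\<^sup>2 * b)
      = \<tau> s * (G s * a - 1 / G s * b)"
      unfolding u w t using G_nz[OF s] by (simp add: field_simps power2_eq_square)
    then show ?A by (simp only: distrib_left)
    have "G s * (K * u s * b1) + G s * (K * L * a1) + dG s * a
        - (1 / G s * (K * w s * a1) + 1 / G s * (K * L * b1) + - dG s / (G s)\<^sup>2 * b)
      = \<tau> s * (G s * a + 1 / G s * b)"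
      unfolding u w t using G_nz[OF s] by (simp add: field_simps power2_eq_square)
    then show ?B by (simp only: distrib_left)
  qed
  have 1: "of_real (- \<kappa> * dl s) = - of_real \<kappa> * complex_of_real (dl s)"
    "of_real (\<kappa> * dl s) = of_real \<kappa> * complex_of_real (dl s)" by simp_all
  show "((\<lambda>s. P s (c + (- \<kappa>) * l s)) has_vector_derivative \<tau> s * M s (c
      + (- \<kappa>) * l s)) (at s within {A..B})"
    using has_vector_derivative_add[OF has_vector_derivative_mult[OF G' X'[of c "- \<kappa>"]]
        has_vector_derivative_mult[OF I' Z'[of c "- \<kappa>"]]]
    unfolding P_def M_def 1 alg1[OF refl] .
  show "((\<lambda>s. M s (c + \<kappa> * l s)) has_vector_derivative \<tau> s * P s (c
      + \<kappa> * l s)) (at s within {A..B})"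
    using has_vector_derivative_diff[OF has_vector_derivative_mult[OF G' X'[of c "\<kappa>"]]
        has_vector_derivative_mult[OF I' Z'[of c "\<kappa>"]]]
    unfolding P_def M_def 1 alg2[OF refl] .
qed

lemma P_A: "P A t = 2 * of_real (poly h t)" and M_A: "M A t = 0"
  by (simp_all add: P_def M_def G_A wave_A)

lemma PM_bounded: "\<exists>C. \<forall>s\<in>{A..B}. \<forall>t\<in>{-1..1}. cmod (P s t) \<le> C \<and> cmod
    (M s t) \<le> C"
proof -
  have F: "continuous_on ({A..B} \<times> {-1..1}) (\<lambda>z. f (fst z))" if "continuous_on {A..B} f"
      for f :: "real \<Rightarrow> complex"
    by (rule continuous_on_compose2[OF that continuous_on_fst[OF continuous_on_id]]) auto
  have q: "continuous_on ({A..B} \<times> {-1..1}) (\<lambda>z. complex_of_real (poly f (snd z)))"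
      for f :: "real poly"
    by (intro continuous_intros)
  have W: "continuous_on ({A..B} \<times> {-1..1}) (\<lambda>z. wave F 0 (fst z) (snd z))"
    if "\<And>n. continuous_on {A..B} (F n)" for F
    unfolding wave_def by (intro continuous_on_sum continuous_on_mult continuous_on_const F q that)
  have Gi: "continuous_on {A..B} (\<lambda>s. 1 / G s)"
    using G_nz by (auto intro!: continuous_intros G_cont)
  have "bounded ((\<lambda>z. P (fst z) (snd z)) ` ({A..B} \<times> {-1..1}))" "bounded ((\<lambda>z. M (fst z)
      (snd z)) ` ({A..B} \<times> {-1..1}))"
    unfolding P_def M_def using XZ_cont
    by (intro compact_imp_bounded compact_continuous_image compact_Times compact_Icc
        continuous_on_add continuous_on_diff continuous_on_mult F[OF G_cont] F[OF Gi] W; simp)+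
  then obtain C D where "\<forall>z\<in>{A..B} \<times> {-1..1}. cmod (P (fst z) (snd z)) \<le> C"
      "\<forall>z\<in>{A..B} \<times> {-1..1}. cmod (M (fst z) (snd z)) \<le> D"
    unfolding bounded_iff by auto
  then show ?thesis by (intro exI[of _ "max C D"]) (fastforce simp: le_max_iff_disj)
qed

text \<open>If \<open>\<tau>\<close> vanished, \<open>P\<close> would be the pure translate 2 h(t +
  \<kappa> l(s)) and \<open>M\<close> would be 0. In general \<open>M\<close> is driven by this
  translate integrated along a characteristic, which is why only the L^1 norm of \<open>h\<close>
  appears. At (y0, 0) the sum of the invariants is twice \<open>G\<close> times the wave, and the
  translate is 2 h(1).\<close>

lemma wave_bound:
  assumes S: "S > 0" "\<And>y. y \<in> {A..B} \<Longrightarrow> cmod (\<tau> y) \<le> S * dl y"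
  shows "cmod (2 * G y0 * wave X 0 y0 0 - 2 * of_real (poly h 1))
      \<le> 4 * S * exp (2 * S * l B) * l y0 * integral {-1..1} (\<lambda>t. \<bar>poly h t\<bar>)"
proof -
  define F where "F = integral {-1..1} (\<lambda>t. \<bar>poly h t\<bar>)"
  define H where "H v = integral {-1..v} (\<lambda>t. \<bar>poly h t\<bar>)" for v
  have h_int: "(\<lambda>t. \<bar>poly h t\<bar>) integrable_on {a..b}" for a b
    by (intro integrable_continuous_real continuous_intros)
  have "F \<ge> 0" unfolding F_def by (intro integral_nonneg h_int) auto
  have H_diff: "H v - H v' \<le> F" if "-1 \<le> v'" "v' \<le> v" "v \<le> 1" for v v'
  proof -
    have "H v - H v' = integral {v'..v} (\<lambda>t. \<bar>poly h t\<bar>)"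
      using Henstock_Kurzweil_Integration.integral_combine[OF that(1,2) h_int] by (simp add: H_def)
    also have "\<dots> \<le> F" unfolding F_def
      by (intro integral_subset_le h_int) (use that in auto)
    finally show ?thesis .
  qed
  \<comment> \<open>The deviation of \<open>P\<close> from free transport.\<close>
  define D where "D s t = P s t - 2 * of_real (poly h (t + \<kappa> * l s))" for s t
  \<comment> \<open>A triangle with base [-1,1] at s = A and apex (y0, 0), as \<kappa> l(y0) = 1.
    Followed back to A, both characteristics through any of its points stay inside.\<close>
  define T where "T = {(s, t). s \<in> {A..y0} \<and> \<bar>t\<bar> \<le> 1 - \<kappa> * l s}"
  \<comment> \<open>The exponent 2 S makes S l' E the derivative of E/2; the resulting factor 1/2 is
    what allows absorption.\<close>
  define E where "E s = exp (2 * S * l s)" for s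
  have E_pos: "E s > 0" for s by (simp add: E_def)
  have in_AB: "s \<in> {A..B}" if "s \<in> {A..y0}" for s using that y0 by auto
  have kl: "0 \<le> \<kappa> * l s" "\<kappa> * l s \<le> 1" if "s \<in> {A..y0}" for s
    using that y0 kappa_pos l_nonneg[of s] l_mono[of s y0] l_pos[OF y0]
    by (auto simp: \<kappa> field_simps)
  have kl_mono: "\<kappa> * l s' \<le> \<kappa> * l s" if "A \<le> s'" "s' \<le> s" "s \<le> y0" for s s'
    using that y0 kappa_pos by (intro mult_left_mono l_mono) auto
  \<comment> \<open>Gronwall's argument: \<open>m\<close> is the weighted supremum of both invariants over the domain of
    dependence \<open>T\<close>, and integrating along characteristics gives \<open>m \<le> S / \<kappa> * F + m / 2\<close>.\<close>
  define V where "V = (\<lambda>(s, t). max (cmod (D s t)) (cmod (M s t)) / E s) ` T"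
  define m where "m = Sup V"
  have "(y0, 0) \<in> T" using y0 l_pos[OF y0] by (auto simp: T_def \<kappa>)
  have "bdd_above V"
  proof -
    obtain C where C: "\<And>s t. s \<in> {A..B} \<Longrightarrow> t \<in> {-1..1} \<Longrightarrow> cmod (P s
        t) \<le> C"
        "\<And>s t. s \<in> {A..B} \<Longrightarrow> t \<in> {-1..1} \<Longrightarrow> cmod (M s t) \<le> C"
      using PM_bounded by blast
    have "bounded (poly h ` {-1..1})"
      by (intro compact_imp_bounded compact_continuous_image continuous_intros compact_Icc)
    then obtain C' where C': "\<And>t. t \<in> {-1..1} \<Longrightarrow> \<bar>poly h t\<bar> \<le> C'"
      unfolding bounded_iff by force
    have "max (cmod (D s t)) (cmod (M s t)) / E s \<le> C + 2 * C'" if "(s, t) \<in> T" for s t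
    proof -
      have s: "s \<in> {A..y0}" and t: "\<bar>t\<bar> \<le> 1 - \<kappa> * l s" using that by (auto simp: T_def)
      have "cmod (D s t) \<le> cmod (P s t) + 2 * \<bar>poly h (t + \<kappa> * l s)\<bar>"
        unfolding D_def by (rule order.trans[OF norm_triangle_ineq4]) (simp add: norm_mult)
      moreover have "cmod (P s t) \<le> C" "cmod (M s t) \<le> C" "\<bar>poly h (t + \<kappa> * l s)\<bar> \<le> C'"
        using kl[OF s] t by (auto intro!: C C' in_AB s simp del: atLeastAtMost_iff simp: atLeastAtMost_iff[of
            t] atLeastAtMost_iff[of "t + \<kappa> * l s"])
      ultimately have "max (cmod (D s t)) (cmod (M s t)) \<le> C + 2 * C'" by auto
      moreover have "max (cmod (D s t)) (cmod (M s t)) / E s \<le> max (cmod (D s t)) (cmod (M s t)) / 1"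
        using S(1) l_nonneg[OF in_AB[OF s]] by (intro divide_left_mono) (auto simp: E_def le_max_iff_disj)
      ultimately show ?thesis by linarith
    qed
    then show ?thesis unfolding V_def by (intro bdd_aboveI2[where M = "C + 2 * C'"]) auto
  qed
  then have m: "cmod (D s t) \<le> m * E s" "cmod (M s t) \<le> m * E s" if "(s, t) \<in> T" for s t
  proof -
    have "max (cmod (D s t)) (cmod (M s t)) / E s \<le> m"
      unfolding m_def using that \<open>bdd_above V\<close> by (intro cSup_upper) (auto simp: V_def)
    then have "max (cmod (D s t)) (cmod (M s t)) \<le> m * E s"
      using E_pos[of s] by (simp add: pos_divide_le_eq)
    then show "cmod (D s t) \<le> m * E s" "cmod (M s t) \<le> m * E s" by auto
  qed
  have "m \<ge> 0"
    using m(1)[OF \<open>(y0, 0) \<in> T\<close>] E_pos[of y0] norm_ge_zero order.trans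
    by (meson mult_less_0_iff not_less)
  have E_deriv: "((\<lambda>s. m / 2 * E s) has_real_derivative S * dl s * (m * E s)) (at s within {A..x})"
    if "s \<in> {A..x}" "x \<le> y0" for s x
  proof -
    have "(l has_real_derivative dl s) (at s within {A..x})"
      by (rule DERIV_subset[OF l_deriv]) (use that y0 in auto)
    then show ?thesis unfolding E_def by (auto intro!: derivative_eq_intros)
  qed
  have D_le: "cmod (D s t) \<le> m / 2 * E s" if "(s, t) \<in> T" for s t
  proof -
    have s: "s \<in> {A..y0}" and t: "\<bar>t\<bar> \<le> 1 - \<kappa> * l s" using that by (auto simp: T_def)
    define c where "c = t + \<kappa> * l s"
    have "norm (P s (c + (- \<kappa>) * l s) - P A (c + (- \<kappa>) * l A)) \<le> m / 2 * E s - m / 2 * E A"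
    proof (rule norm_increment_le)
      fix x assume x: "x \<in> {A..s}"
      then have xAB: "x \<in> {A..B}" using s y0 by auto
      show "((\<lambda>s. P s (c + (- \<kappa>) * l s)) has_vector_derivative \<tau> x * M x (c
          + (- \<kappa>) * l x)) (at x within {A..s})"
        by (rule has_vector_derivative_within_subset[OF characteristic_deriv(1)[OF xAB]]) (use s y0 in auto)
      show "((\<lambda>s. m / 2 * E s) has_real_derivative S * dl x * (m * E x)) (at x within {A..s})"
        by (rule E_deriv) (use x s in auto)
      have "(x, c + (- \<kappa>) * l x) \<in> T"
        using x s t kl_mono[of x s] by (auto simp: T_def c_def)
      then show "norm (\<tau> x * M x (c + (- \<kappa>) * l x)) \<le> S * dl x * (m * E x)"
        unfolding norm_mult using S(2)[OF xAB] S(1) dl_pos[OF xAB] by (intro mult_mono m) auto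
    qed (use s in auto)
    also have "m / 2 * E s - m / 2 * E A \<le> m / 2 * E s"
      using \<open>m \<ge> 0\<close> E_pos[of A] by simp
    finally show ?thesis by (simp add: D_def P_A c_def)
  qed
  have M_le: "cmod (M s t) \<le> S / \<kappa> * F + m / 2 * E s" if "(s, t) \<in> T" for s t
  proof -
    have s: "s \<in> {A..y0}" and t: "\<bar>t\<bar> \<le> 1 - \<kappa> * l s" using that by (auto simp: T_def)
    define c where "c = t - \<kappa> * l s"
    have range: "c + 2 * \<kappa> * l x \<in> {-1..1}" if "x \<in> {A..s}" for x
      using that s t kl[of x] kl_mono[of x s] by (auto simp: c_def)
    \<comment> \<open>Along this characteristic the main part of \<open>P\<close> is 2 h(c + 2
      \<kappa> l(x)). Substituting v = c + 2 \<kappa> l(x) turns 2 S l' |h| into S/\<kappa> times a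
      piece of the integral of |h|.\<close>
    have "norm (M s (c + \<kappa> * l s) - M A (c + \<kappa> * l A))
        \<le> (S / \<kappa> * H (c + 2 * \<kappa> * l s) + m / 2 * E s) - (S / \<kappa> * H (c
            + 2 * \<kappa> * l A) + m / 2 * E A)"
    proof (rule norm_increment_le)
      fix x assume x: "x \<in> {A..s}"
      then have xAB: "x \<in> {A..B}" using s y0 by auto
      show "((\<lambda>s. M s (c + \<kappa> * l s)) has_vector_derivative \<tau> x * P x (c
          + \<kappa> * l x)) (at x within {A..s})"
        by (rule has_vector_derivative_within_subset[OF characteristic_deriv(2)[OF xAB]]) (use s y0 in auto)
      have "((\<lambda>s. c + 2 * \<kappa> * l s) has_real_derivative 2 * \<kappa> * dl x) (at x within {A..s})"
        using DERIV_subset[OF l_deriv[OF xAB], of "{A..s}"] s y0 by (auto intro!: derivative_eq_intros)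
      moreover have "(H has_real_derivative \<bar>poly h (c + 2 * \<kappa> * l x)\<bar>)
          (at (c + 2 * \<kappa> * l x) within (\<lambda>s. c + 2 * \<kappa> * l s) ` {A..s})"
      proof (rule DERIV_subset)
        show "(H has_real_derivative \<bar>poly h (c + 2 * \<kappa> * l x)\<bar>) (at (c
            + 2 * \<kappa> * l x) within {-1..1})"
          unfolding H_def[abs_def] has_real_derivative_iff_has_vector_derivative
          by (intro integral_has_vector_derivative range x continuous_intros)
      qed (use range in auto)
      ultimately have "((\<lambda>s. H (c + 2 * \<kappa> * l s)) has_real_derivative
          \<bar>poly h (c + 2 * \<kappa> * l x)\<bar> * (2 * \<kappa> * dl x)) (at x within {A..s})"
        using DERIV_image_chain[of H _ "\<lambda>s. c + 2 * \<kappa> * l s"] by (simp add: o_def)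
      from DERIV_add[OF DERIV_cmult[OF this, of "S / \<kappa>"] E_deriv[OF x]] s
      show "((\<lambda>s. S / \<kappa> * H (c + 2 * \<kappa> * l s) + m / 2 * E s) has_real_derivative
          S * dl x * (2 * \<bar>poly h (c + 2 * \<kappa> * l x)\<bar> + m * E x)) (at x within {A..s})"
        using kappa_pos by (simp add: algebra_simps)
      have "(x, c + \<kappa> * l x) \<in> T"
        using x s t kl_mono[of x s] kl[of x] by (auto simp: T_def c_def)
      from m(1)[OF this] have m': "cmod (D x (c + \<kappa> * l x)) \<le> m * E x" .
      have "c + \<kappa> * l x + \<kappa> * l x = c + 2 * \<kappa> * l x" by (simp add: algebra_simps)
      with D_def[of x "c + \<kappa> * l x"] have "P x (c + \<kappa> * l x) = 2 * of_real (poly h (c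
          + 2 * \<kappa> * l x)) + D x (c + \<kappa> * l x)"
        by (simp only:) simp
      moreover have "cmod (2 * of_real (poly h (c + 2 * \<kappa> * l x))) = 2 * \<bar>poly h (c
          + 2 * \<kappa> * l x)\<bar>"
        unfolding norm_mult norm_of_real by simp
      ultimately have "cmod (P x (c + \<kappa> * l x)) \<le> 2 * \<bar>poly h (c + 2 * \<kappa> * l x)\<bar>
          + m * E x"
        using m' by (metis norm_triangle_le add_left_mono)
      then show "norm (\<tau> x * P x (c + \<kappa> * l x)) \<le> S * dl x * (2 * \<bar>poly h (c
          + 2 * \<kappa> * l x)\<bar> + m * E x)"
        unfolding norm_mult using S(2)[OF xAB] S(1) dl_pos[OF xAB] by (intro mult_mono) auto
    qed (use s in auto)
    moreover have "S / \<kappa> * (H (c + 2 * \<kappa> * l s) - H (c + 2 * \<kappa> * l A)) \<le> S / \<kappa> * F"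
      using S(1) kappa_pos range[of s] range[of A] kl[OF s] s
      by (intro mult_left_mono H_diff) auto
    moreover have "m / 2 * E A \<ge> 0"
      using \<open>m \<ge> 0\<close> E_pos[of A] by simp
    ultimately show ?thesis by (simp add: M_A c_def right_diff_distrib)
  qed
  have "m \<le> S / \<kappa> * F + m / 2" unfolding m_def
  proof (rule cSup_least)
    show "V \<noteq> {}" using \<open>(y0, 0) \<in> T\<close> by (auto simp: V_def)
    fix v assume "v \<in> V"
    then obtain s t where st: "(s, t) \<in> T" and v: "v = max (cmod (D s t)) (cmod (M s t)) / E s"
      by (auto simp: V_def)
    have "E s \<ge> 1" using S(1) l_nonneg[OF in_AB, of s] st by (auto simp: E_def T_def)
    have SF: "S / \<kappa> * F \<ge> 0" using S(1) kappa_pos \<open>F \<ge> 0\<close> by simp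
    then have "S / \<kappa> * F \<le> S / \<kappa> * F * E s"
        using mult_left_mono[OF \<open>E s \<ge> 1\<close> SF] by simp
    then have "max (cmod (D s t)) (cmod (M s t)) \<le> (S / \<kappa> * F + m / 2) * E s"
      using D_le[OF st] M_le[OF st] SF unfolding distrib_right by linarith
    then show "v \<le> S / \<kappa> * F + Sup V / 2"
      using E_pos[of s] by (simp add: v pos_divide_le_eq m_def)
  qed
  \<comment> \<open>Half of \<open>m\<close> is absorbed on the left, and 1/\<kappa> = l(y0)
    supplies the factor that vanishes at A.\<close>
  then have m_le: "m \<le> 2 * S * l y0 * F" by (simp add: \<kappa>)
  have "\<kappa> * l y0 = 1" using l_pos[OF y0] by (simp add: \<kappa>)
  then have "2 * G y0 * wave X 0 y0 0 - 2 * of_real (poly h 1) = D y0 0 + M y0 0"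
    by (simp add: D_def P_def M_def)
  also have "cmod \<dots> \<le> m * E y0 + m * E y0"
    using m[OF \<open>(y0, 0) \<in> T\<close>] by (intro norm_triangle_le add_mono)
  \<comment> \<open>Enlarging \<open>E y0\<close> to \<open>E B\<close> makes the constant
    independent of y0; the factor l(y0) is kept.\<close>
  also have "\<dots> \<le> (2 * S * l y0 * F) * E B + (2 * S * l y0 * F) * E B"
    using m_le \<open>m \<ge> 0\<close> E_pos l_mono[of y0 B] y0 S(1) \<open>F \<ge> 0\<close> l_pos[OF y0]
    by (intro add_mono mult_mono) (auto simp: E_def)
  finally show ?thesis by (simp add: E_def F_def algebra_simps)
qed

end

text \<open>In terms of the transmutation kernel \<open>K\<close>, the number \<open>moment y k\<close> is
  \<open>l(y) \<integral> K(y, l(y) t) t\<^sup>k dt\<close> over \<open>[-1,1]\<close>; the bound \<open>C * l y\<close> below says that \<open>K\<close> is bounded.\<close>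

definition moment :: "real \<Rightarrow> nat \<Rightarrow> complex" where
  "moment y k = formal_Phi A p r g k y / of_real (l y) ^ k - 1 / of_real (\<rho> y)"

lemma moment_bounded:
  "\<exists>C\<ge>0. \<forall>y\<in>{A<..B}. bounded_moment_functional (moment y) (C * l y)"
proof -
  obtain S where S: "S > 0" "\<And>y. y \<in> {A..B} \<Longrightarrow> cmod (\<tau> y) \<le> S * dl y"
    using tau_bound by blast
  have "continuous_on {A..B} (\<lambda>y. 1 / \<rho> y)"
    using rho_pos by (auto intro!: continuous_intros rho_cont simp: less_le)
  then have "bounded ((\<lambda>y. 1 / \<rho> y) ` {A..B})"
    by (intro compact_imp_bounded compact_continuous_image compact_Icc)
  then obtain b where b': "\<And>y. y \<in> {A..B} \<Longrightarrow> \<bar>1 / \<rho> y\<bar> \<le> b"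
      unfolding bounded_iff by force
  have b: "1 / \<rho> y \<le> b" if "y \<in> {A..B}" for y using b'[OF that] by linarith
  have "b \<ge> 0" using b[of A] rho_pos[of A] AB by (smt (verit) atLeastAtMost_iff divide_pos_pos)
  define C where "C = b * (2 * S * exp (2 * S * l B))"
  have "cmod (moment_functional (moment y) h) \<le> C * l y * integral {-1..1} (\<lambda>t. \<bar>poly h t\<bar>)"
    if y: "y \<in> {A<..B}" for y h
  proof -
    define W where "W = wave h (1 / l y) X 0 y 0"
    have yAB: "y \<in> {A..B}" using y by auto
    have \<rho>: "\<rho> y > 0" by (rule rho_pos[OF yAB])
    \<comment> \<open>At time 0 the k-th derivative of \<open>h\<close> over k! is its k-th
      coefficient, so the wave is the polynomial with powers replaced by scaled formal
      powers.\<close>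
    have W: "W = (\<Sum>k\<le>degree h. of_real (coeff h k) * (X k y / of_real (l y) ^ k))"
      unfolding W_def wave_def[OF y refl]
    proof (rule sum.cong[OF refl])
      fix k
      have "poly ((pderiv ^^ (k + 0)) h) 0 = fact k * coeff h k"
        by (simp add: poly_0_coeff_0 coeff_higher_pderiv pochhammer_fact)
      then show "of_real ((1 / l y) ^ k / fact k) * X k y * of_real (poly ((pderiv ^^ (k + 0)) h) 0)
          = of_real (coeff h k) * (X k y / of_real (l y) ^ k)"
        by (simp add: power_divide)
    qed
    have "moment_functional (moment y) h = g y * W - of_real (poly h 1) / of_real (\<rho> y)"
      by (simp add: moment_functional_def moment_def Phi_eq W right_diff_distrib sum_subtractf
          sum_distrib_left sum_divide_distrib poly_altdef mult_ac)
    also have "\<dots> = of_real (1 / (2 * \<rho> y)) * (2 * G y * W - 2 * of_real (poly h 1))"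
      using \<rho> by (simp add: G_def field_simps)
    also have "cmod \<dots> = 1 / (2 * \<rho> y) * cmod (2 * G y * W - 2 * of_real (poly h 1))"
      using \<rho> unfolding norm_mult norm_of_real by simp
    also have "\<dots> \<le> 1 / (2 * \<rho> y) * (4 * S * exp (2 * S * l B) * l y * integral {-1..1}
        (\<lambda>t. \<bar>poly h t\<bar>))"
      unfolding W_def using \<rho> by (intro mult_left_mono wave_bound[OF y refl S]) auto
    also have "\<dots> = 1 / \<rho> y * (2 * S * exp (2 * S * l B) * l y * integral {-1..1} (\<lambda>t.
        \<bar>poly h t\<bar>))"
      by simp
    also have "\<dots> \<le> b * (2 * S * exp (2 * S * l B) * l y * integral {-1..1} (\<lambda>t. \<bar>poly h
        t\<bar>))"
      using b[OF yAB] S(1) l_nonneg[OF yAB]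
      by (intro mult_right_mono mult_nonneg_nonneg integral_nonneg integrable_continuous_real continuous_intros) auto
    finally show ?thesis by (simp add: C_def mult_ac)
  qed
  moreover have "C \<ge> 0" using \<open>b \<ge> 0\<close> S(1) by (simp add: C_def)
  ultimately show ?thesis by (auto simp: bounded_moment_functional_def)
qed

end

subsection \<open>The Neumann series of Bessel functions\<close>

text \<open>Divisions into a single interval suffice, degenerate intervals included.\<close>

lemma abs_continuous_imp_continuous:
  assumes "abs_continuous_on_interval A B f"
  shows "continuous_on {A..B} f"
  unfolding continuous_on_iff
proof (intro ballI allI impI)
  fix x e :: real assume x: "x \<in> {A..B}" and "e > 0"
  then obtain d where "d > 0" and d: "\<And>D t. D division_of t \<Longrightarrow> t \<subseteq> {A..B}
      \<Longrightarrow> (\<Sum>K\<in>D. Sup K - Inf K) < d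
      \<Longrightarrow> (\<Sum>K\<in>D. \<bar>f (Sup K) - f (Inf K)\<bar>) < e"
    using assms unfolding abs_continuous_on_interval_def by metis
  have *: "\<bar>f b - f a\<bar> < e" if "a \<in> {A..B}" "b \<in> {A..B}" "a \<le> b" "b - a < d" for a b
    using d[of "{{a..b}}" "{a..b}"] division_of_self[of a b] that by auto
  then have "dist (f y) (f x) < e" if "y \<in> {A..B}" "dist y x < d" for y
    using that x *[of x y] *[of y x] by (cases "x \<le> y") (auto simp: dist_real_def abs_minus_commute)
  then show "\<exists>d>0. \<forall>y\<in>{A..B}. dist y x < d \<longrightarrow> dist (f y) (f x) < e"
    using \<open>d > 0\<close> by blast
qed

lemma sl_solves_lincomb:
  assumes "sl_solves A B p q f1 w1" "sl_solves A B p q f2 w2"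
    and v: "\<And>y. y \<in> {A..B} \<Longrightarrow> v y = c1 * w1 y + c2 * w2 y"
    and f: "\<And>y. y \<in> {A..B} \<Longrightarrow> f y = c1 * f1 y + c2 * f2 y"
  shows "sl_solves A B p q f v"
proof -
  obtain v1' W1 where
    "\<forall>y\<in>{A..B}. (w1 has_vector_derivative v1' y) (at y within {A..B}) \<and>
        ((\<lambda>s. complex_of_real (p s) * v1' s) has_vector_derivative W1 y) (at y within {A..B}) \<and>
        W1 y - q y * w1 y = f1 y"
    using assms(1) unfolding sl_solves_def by (elim exE)
  then have 1: "\<And>y. y \<in> {A..B} \<Longrightarrow> (w1 has_vector_derivative v1' y) (at y within {A..B})"
      "\<And>y. y \<in> {A..B} \<Longrightarrow> ((\<lambda>s. complex_of_real (p s) * v1' s)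
          has_vector_derivative W1 y) (at y within {A..B})"
      "\<And>y. y \<in> {A..B} \<Longrightarrow> W1 y - q y * w1 y = f1 y"
    by simp_all
  obtain v2' W2 where
    "\<forall>y\<in>{A..B}. (w2 has_vector_derivative v2' y) (at y within {A..B}) \<and>
        ((\<lambda>s. complex_of_real (p s) * v2' s) has_vector_derivative W2 y) (at y within {A..B}) \<and>
        W2 y - q y * w2 y = f2 y"
    using assms(2) unfolding sl_solves_def by (elim exE)
  then have 2: "\<And>y. y \<in> {A..B} \<Longrightarrow> (w2 has_vector_derivative v2' y) (at y within {A..B})"
      "\<And>y. y \<in> {A..B} \<Longrightarrow> ((\<lambda>s. complex_of_real (p s) * v2' s)
          has_vector_derivative W2 y) (at y within {A..B})"
      "\<And>y. y \<in> {A..B} \<Longrightarrow> W2 y - q y * w2 y = f2 y"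
    by simp_all
  show ?thesis unfolding sl_solves_def
  proof (intro exI ballI conjI)
    fix y assume y: "y \<in> {A..B}"
    have "((\<lambda>y. c1 * w1 y + c2 * w2 y) has_vector_derivative c1 * v1' y + c2 * v2' y) (at y within {A..B})"
      by (intro has_vector_derivative_add has_vector_derivative_mult_right 1 2 y)
    then show "(v has_vector_derivative c1 * v1' y + c2 * v2' y) (at y within {A..B})"
      by (rule has_vector_derivative_transform[OF y, rotated], intro v)
    have "((\<lambda>s. c1 * (complex_of_real (p s) * v1' s) + c2 * (complex_of_real (p s) * v2' s))
        has_vector_derivative c1 * W1 y + c2 * W2 y) (at y within {A..B})"
      by (intro has_vector_derivative_add has_vector_derivative_mult_right 1 2 y)
    then show "((\<lambda>s. complex_of_real (p s) * (c1 * v1' s + c2 * v2' s))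
        has_vector_derivative c1 * W1 y + c2 * W2 y) (at y within {A..B})"
      by (simp add: algebra_simps)
    show "c1 * W1 y + c2 * W2 y - q y * v y = f y"
      using 1(3)[OF y] 2(3)[OF y] by (simp add: v[OF y] f[OF y] algebra_simps flip: 1(3) 2(3))
  qed
qed

section \<open>Spectral parameter power series\<close>

context liouville
begin

lemma spps_deriv:
  "y \<in> {A..B} \<Longrightarrow> ((\<lambda>y. g y * aX \<theta> y) has_vector_derivative g y
      * (\<theta> * aZ \<theta> y * u y) + g' y * aX \<theta> y)
     (at y within {A..B})"
  by (rule has_vector_derivative_mult[OF g_deriv aX_deriv])

text \<open>Because u = 1/(g^2 p), the quantity p v' equals (p g') aX + \<theta> aZ / g. On
  differentiating, the two terms containing g' cancel, leaving q v and \<theta>^2 r v.\<close>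

lemma spps_solves:
  assumes pg': "\<And>y. y \<in> {A..B} \<Longrightarrow>
      ((\<lambda>s. complex_of_real (p s) * g' s) has_vector_derivative q y * g y) (at y within {A..B})"
  shows "sl_solves A B p q (\<lambda>y. \<theta>\<^sup>2 * complex_of_real (r y)
      * (g y * aX \<theta> y)) (\<lambda>y. g y * aX \<theta> y)"
  unfolding sl_solves_def
proof (intro exI ballI conjI)
  fix y assume y: "y \<in> {A..B}"
  show "((\<lambda>y. g y * aX \<theta> y) has_vector_derivative g y * (\<theta> * aZ \<theta> y * u y)
      + g' y * aX \<theta> y) (at y within {A..B})"
    by (rule spps_deriv[OF y])
  have nz: "g s \<noteq> 0" "complex_of_real (p s) \<noteq> 0" if "s \<in> {A..B}" for s
    using g_nz[OF that] p_pos[OF that] by auto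
  have "((\<lambda>s. (complex_of_real (p s) * g' s) * aX \<theta> s + \<theta> * (aZ \<theta> s * (1 / g s)))
      has_vector_derivative
      ((complex_of_real (p y) * g' y) * (\<theta> * aZ \<theta> y * u y) + q y * g y * aX \<theta> y
        + \<theta> * (aZ \<theta> y * (- g' y / (g y)\<^sup>2) + \<theta> * aX \<theta> y * w y
            * (1 / g y)))) (at y within {A..B})"
    by (intro has_vector_derivative_add has_vector_derivative_mult_right has_vector_derivative_mult
        pg' aX_deriv aZ_deriv has_vector_derivative_inverse g_deriv g_nz y)
  then show "((\<lambda>s. complex_of_real (p s) * (g s * (\<theta> * aZ \<theta> s * u s)
      + g' s * aX \<theta> s)) has_vector_derivative
      ((complex_of_real (p y) * g' y) * (\<theta> * aZ \<theta> y * u y) + q y * g y * aX \<theta> y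
        + \<theta> * (aZ \<theta> y * (- g' y / (g y)\<^sup>2) + \<theta> * aX \<theta> y * w y
            * (1 / g y)))) (at y within {A..B})"
    by (rule has_vector_derivative_transform[OF y, rotated])
      (use nz in \<open>simp add: u_def field_simps power2_eq_square\<close>)
  show "(complex_of_real (p y) * g' y) * (\<theta> * aZ \<theta> y * u y) + q y * g y * aX \<theta> y
        + \<theta> * (aZ \<theta> y * (- g' y / (g y)\<^sup>2) + \<theta> * aX \<theta> y * w y * (1 / g y))
            - q y * (g y * aX \<theta> y)
      = \<theta>\<^sup>2 * complex_of_real (r y) * (g y * aX \<theta> y)"
    using nz[OF y] by (simp add: u_def w_def field_simps power2_eq_square)
qed

section \<open>The coefficients alpha_n\<close>

abbreviation "\<Lambda> y n \<equiv> moment_functional (moment y) (legendre_poly n)"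
abbreviation "\<alpha> \<equiv> alpha A p r g"

text \<open>The coefficients of P_n add up to P_n(1) = 1, so the single term 1/rho can be
  distributed over the moments.\<close>

lemma alpha_formula_eq: "alpha_formula A p r g n y = complex_of_real ((2 * real n + 1) / 2) * \<Lambda> y n"
proof -
  have "(\<Sum>k\<le>n. complex_of_real (coeff (legendre_poly n) k)) = 1"
    using legendre_at_1[of n] by (simp add: poly_altdef degree_legendre flip: of_real_sum)
  then show ?thesis
    by (simp add: alpha_formula_def moment_functional_def degree_legendre moment_def
        right_diff_distrib sum_subtractf flip: sum_divide_distrib)
qed

lemma alpha_bound:
  "\<exists>C\<ge>0. \<forall>y\<in>{A<..B}. \<forall>n. cmod (alpha_formula A p r g n y) \<le> 3 ^ n
      * (3 / 2 * C * l y)"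
proof -
  obtain C where C: "C \<ge> 0" "\<And>y. y \<in> {A<..B} \<Longrightarrow> bounded_moment_functional (moment
      y) (C * l y)"
    using moment_bounded by blast
  have "cmod (alpha_formula A p r g n y) \<le> 3 ^ n * (3 / 2 * C * l y)" if y: "y \<in> {A<..B}" for y n
  proof -
    have "cmod (alpha_formula A p r g n y) = (2 * real n + 1) / 2 * cmod (\<Lambda> y n)"
      unfolding alpha_formula_eq norm_mult norm_of_real by simp
    also have "\<dots> \<le> 3 ^ n / 2 * (3 * (C * l y))"
      using odd_le_power_3[of n] bounded_moment_functional.norm_legendre_le[OF C(2)[OF y], of n]
      by (intro mult_mono) auto
    finally show ?thesis by (simp add: mult_ac)
  qed
  with C(1) show ?thesis by blast
qed

text \<open>The functional at y has norm at most a constant times l(y), which tends to 0 at A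
  although the formula divides by powers of l(y).\<close>

lemma alpha_limit: "(alpha_formula A p r g n \<longlongrightarrow> 0) (at_right A)"
proof -
  obtain C where C: "\<And>y n. y \<in> {A<..B} \<Longrightarrow> cmod (alpha_formula A p r g n y) \<le> 3 ^ n
      * (3 / 2 * C * l y)"
    using alpha_bound by blast
  have "(l \<longlongrightarrow> 0) (at_right A)"
    using l_cont AB by (auto simp: continuous_on_def at_within_Icc_at_right[symmetric] dest: bspec[of _ _ A])
  then have "((\<lambda>y. 3 ^ n * (3 / 2 * C * l y)) \<longlongrightarrow> 3 ^ n * (3 / 2 * C * 0)) (at_right A)"
    by (intro tendsto_intros)
  then have lim: "((\<lambda>y. 3 ^ n * (3 / 2 * C * l y)) \<longlongrightarrow> 0) (at_right A)"
    by (simp only: mult_zero_right)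
  have "eventually (\<lambda>y. cmod (alpha_formula A p r g n y) \<le> 3 ^ n * (3 / 2 * C * l y)) (at_right A)"
    using eventually_at_right_less[of A] eventually_at_right_real[OF AB]
    by eventually_elim (use C in auto)
  then show ?thesis
    using lim by (rule Lim_null_comparison)
qed

lemma alpha_A [simp]: "\<alpha> n A = 0"
  using tendsto_Lim[OF _ alpha_limit] by (simp add: alpha_def)

lemma alpha_eq: "y \<in> {A<..B} \<Longrightarrow> \<alpha> n y = complex_of_real ((2 * real n
    + 1) / 2) * \<Lambda> y n"
  by (simp add: alpha_def alpha_formula_eq)

section \<open>The Neumann series and its even and odd parts in omega\<close>

abbreviation "spps \<omega> y \<equiv> g y * aX (\<i> * \<omega>) y"

text \<open>For z = \<omega> l(y) the powers of l(y) cancel in the moment series, which becomes the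
  power series solution minus exp(i z)/rho. At y = A both sides are 0.\<close>

lemma neumann_sums:
  assumes y: "y \<in> {A..B}"
  shows "(\<lambda>n. 2 * \<i> ^ n * \<alpha> n y * spherical_bessel_j n (\<omega> * of_real (l y)))
    sums (spps \<omega> y - exp (\<i> * \<omega> * of_real (l y)) / of_real (\<rho> y))"
proof (cases "y = A")
  case True
  then show ?thesis by (simp add: aX_A gA)
next
  case False
  then have y': "y \<in> {A<..B}" using y by auto
  obtain C where "bounded_moment_functional (moment y) (C * l y)"
    using moment_bounded y' by blast
  from bounded_moment_functional.neumann_series[OF this, of "\<omega> * of_real (l y)"]
  obtain s where s: "(\<lambda>n. (2 * real n + 1) * \<i> ^ n * spherical_bessel_j n (\<omega> * of_real (l y))
      * \<Lambda> y n) sums s"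
    "(\<lambda>k. (\<i> * (\<omega> * of_real (l y))) ^ k / fact k * moment y k) sums s" by blast
  have "(\<lambda>k. g y * ((\<i> * \<omega>) ^ k / fact k * X k y)
      - (\<i> * \<omega> * of_real (l y)) ^ k / fact k / of_real (\<rho> y))
    sums (spps \<omega> y - exp (\<i> * \<omega> * of_real (l y)) / of_real (\<rho> y))"
    by (intro sums_diff sums_mult sums_divide aX_sums[OF y] exp_sums)
  also have "(\<lambda>k. g y * ((\<i> * \<omega>) ^ k / fact k * X k y)
      - (\<i> * \<omega> * of_real (l y)) ^ k / fact k / of_real (\<rho> y))
      = (\<lambda>k. (\<i> * (\<omega> * of_real (l y))) ^ k / fact k * moment y k)"
    using l_pos[OF y'] by (simp add: fun_eq_iff moment_def Phi_eq power_mult_distrib field_simps)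
  finally have "s = spps \<omega> y - exp (\<i> * \<omega> * of_real (l y)) / of_real (\<rho> y)"
    using s(2) sums_unique2 by blast
  moreover have "(\<lambda>n. 2 * \<i> ^ n * \<alpha> n y * spherical_bessel_j n (\<omega> * of_real (l y)))
      = (\<lambda>n. (2 * real n + 1) * \<i> ^ n * spherical_bessel_j n (\<omega> * of_real (l y)) * \<Lambda> y n)"
    by (simp add: fun_eq_iff alpha_eq[OF y'] mult_ac)
  ultimately show ?thesis using s(1) by simp
qed

text \<open>Adding the series for \<omega> and -\<omega> kills the odd indices because j_n has the
  parity of n. The doubled even terms and the factor 2 of the series account for the 4.\<close>

lemma term1_sums:
  assumes y: "y \<in> {A..B}"
  shows "term1 A p r g \<omega> y sums ((spps \<omega> y + spps (- \<omega>) y) / 4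
      - cos (\<omega> * of_real (l y)) / of_real (2 * \<rho> y))"
proof -
  define f where "f n = 2 * \<i> ^ n * \<alpha> n y * spherical_bessel_j n (\<omega> * of_real (l y))
    + 2 * \<i> ^ n * \<alpha> n y * spherical_bessel_j n (- \<omega> * of_real (l y))" for n
  have "f sums (spps \<omega> y - exp (\<i> * \<omega> * of_real (l y)) / of_real (\<rho> y)
      + (spps (- \<omega>) y - exp (\<i> * - \<omega> * of_real (l y)) / of_real (\<rho> y)))"
    unfolding f_def by (intro sums_add neumann_sums y)
  moreover have zero: "f n = 0" if "n \<notin> range (\<lambda>n. 2 * n)" for n
  proof -
    have "odd n" using that by auto
    then show ?thesis by (simp add: f_def spherical_bessel_minus)
  qed
  ultimately have "(\<lambda>n. f (2 * n)) sums (spps \<omega> y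
      - exp (\<i> * \<omega> * of_real (l y)) / of_real (\<rho> y)
      + (spps (- \<omega>) y - exp (\<i> * - \<omega> * of_real (l y)) / of_real (\<rho> y)))"
    by (subst sums_mono_reindex[where g = "\<lambda>n. 2 * n" and f = f]) (auto intro: strict_monoI)
  moreover have "f (2 * n) = 4 * term1 A p r g \<omega> y n" for n
    by (simp add: f_def term1_def spherical_bessel_minus power_mult)
  ultimately have S: "(\<lambda>n. 4 * term1 A p r g \<omega> y n / 4) sums ((spps \<omega> y
      - exp (\<i> * \<omega> * of_real (l y)) / of_real (\<rho> y)
      + (spps (- \<omega>) y - exp (\<i> * - \<omega> * of_real (l y)) / of_real (\<rho> y))) / 4)"
    by (intro sums_divide) simp
  have E: "(spps \<omega> y - exp (\<i> * \<omega> * of_real (l y)) / of_real (\<rho> y)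
      + (spps (- \<omega>) y - exp (\<i> * - \<omega> * of_real (l y)) / of_real (\<rho> y))) / 4
    = (spps \<omega> y + spps (- \<omega>) y) / 4 - cos (\<omega> * of_real (l y)) / of_real (2 * \<rho> y)"
    by (simp add: cos_exp_eq mult_ac add_divide_distrib diff_divide_distrib)
  show ?thesis using S unfolding E by simp
qed

text \<open>Subtracting instead leaves the odd indices, whose powers of i contribute an extra factor
  i.\<close>

lemma term2_sums:
  assumes y: "y \<in> {A..B}"
  shows "term2 A p r g \<omega> y sums ((spps \<omega> y - spps (- \<omega>) y) / (4 * \<i>)
      - sin (\<omega> * of_real (l y)) / of_real (2 * \<rho> y))"
proof -
  define f where "f n = 2 * \<i> ^ n * \<alpha> n y * spherical_bessel_j n (\<omega> * of_real (l y))
    - 2 * \<i> ^ n * \<alpha> n y * spherical_bessel_j n (- \<omega> * of_real (l y))" for n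
  have "f sums (spps \<omega> y - exp (\<i> * \<omega> * of_real (l y)) / of_real (\<rho> y)
      - (spps (- \<omega>) y - exp (\<i> * - \<omega> * of_real (l y)) / of_real (\<rho> y)))"
    unfolding f_def by (intro sums_diff neumann_sums y)
  moreover have zero: "f n = 0" if "n \<notin> range (\<lambda>n. 2 * n + 1)" for n
  proof -
    have "even n" using that by (metis oddE rangeI)
    then show ?thesis by (simp add: f_def spherical_bessel_minus)
  qed
  ultimately have "(\<lambda>n. f (2 * n + 1)) sums (spps \<omega> y
      - exp (\<i> * \<omega> * of_real (l y)) / of_real (\<rho> y)
      - (spps (- \<omega>) y - exp (\<i> * - \<omega> * of_real (l y)) / of_real (\<rho> y)))"
    by (subst sums_mono_reindex[where g = "\<lambda>n. 2 * n + 1" and f = f]) (auto intro: strict_monoI)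
  moreover have "f (2 * n + 1) = 4 * \<i> * term2 A p r g \<omega> y n" for n
    by (simp add: f_def term2_def spherical_bessel_minus power_mult)
  ultimately have S: "(\<lambda>n. 4 * \<i> * term2 A p r g \<omega> y n / (4 * \<i>)) sums ((spps \<omega> y
      - exp (\<i> * \<omega> * of_real (l y)) / of_real (\<rho> y)
      - (spps (- \<omega>) y - exp (\<i> * - \<omega> * of_real (l y)) / of_real (\<rho> y))) / (4 * \<i>))"
    by (intro sums_divide) simp
  have E: "(spps \<omega> y - exp (\<i> * \<omega> * of_real (l y)) / of_real (\<rho> y)
      - (spps (- \<omega>) y - exp (\<i> * - \<omega> * of_real (l y)) / of_real (\<rho> y))) / (4 * \<i>)
    = (spps \<omega> y - spps (- \<omega>) y) / (4 * \<i>) - sin (\<omega> * of_real (l y)) / of_real (2 * \<rho> y)"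
    by (simp add: sin_exp_eq mult_ac add_divide_distrib diff_divide_distrib)
  show ?thesis using S unfolding E by simp
qed

text \<open>The cosine in front of the series cancels the one in its sum, so \<open>v1\<close> is a
  plain average of two solutions; initial values and the equation can be read off there.\<close>

lemma v1_eq: "y \<in> {A..B} \<Longrightarrow> v1 A p r g \<omega> y = 1 / 2 * spps \<omega> y
    + 1 / 2 * spps (- \<omega>) y"
  using sums_unique[OF term1_sums, of y \<omega>] by (simp add: v1_def field_simps)

lemma v2_eq: "y \<in> {A..B} \<Longrightarrow> v2 A p r g \<omega> y = 1 / (2 * \<i>) * spps \<omega> y
    + (- 1 / (2 * \<i>)) * spps (- \<omega>) y"
  using sums_unique[OF term2_sums, of y \<omega>] by (simp add: v2_def field_simps)

section \<open>Initial values and linear independence\<close>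

lemma v_at_A:
  shows "v1 A p r g \<omega> A = 1 / of_real (\<rho> A)" and "v2 A p r g \<omega> A = 0"
  using AB by (auto simp: v1_eq v2_eq aX_A gA field_simps)

lemma v1_deriv_A: "(v1 A p r g \<omega> has_vector_derivative g' A) (at A within {A..B})"
proof -
  have A: "A \<in> {A..B}" using AB by simp
  have "((\<lambda>y. 1 / 2 * spps \<omega> y + 1 / 2 * spps (- \<omega>) y) has_vector_derivative
      1 / 2 * (g A * (\<i> * \<omega> * aZ (\<i> * \<omega>) A * u A) + g' A * aX (\<i> * \<omega>) A)
      + 1 / 2 * (g A * (\<i> * - \<omega> * aZ (\<i> * - \<omega>) A * u A) + g' A * aX (\<i> *
          - \<omega>) A)) (at A within {A..B})"
    by (intro has_vector_derivative_add has_vector_derivative_mult_right spps_deriv A)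
  then have "((\<lambda>y. 1 / 2 * spps \<omega> y + 1 / 2 * spps (- \<omega>) y)
      has_vector_derivative g' A) (at A within {A..B})"
    by (simp only: aX_A aZ_A) (simp add: field_simps)
  then show ?thesis by (rule has_vector_derivative_transform[OF A, rotated], intro v1_eq)
qed

lemma v2_deriv_A:
  "(v2 A p r g \<omega> has_vector_derivative \<omega> / of_real (\<rho> A) * of_real (sqrt (r A / p A))) (at A
      within {A..B})"
proof -
  have A: "A \<in> {A..B}" using AB by simp
  have "((\<lambda>y. 1 / (2 * \<i>) * spps \<omega> y + (- 1 / (2 * \<i>)) * spps (- \<omega>) y)
      has_vector_derivative
      1 / (2 * \<i>) * (g A * (\<i> * \<omega> * aZ (\<i> * \<omega>) A * u A) + g' A * aX (\<i> * \<omega>) A)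
      + (- 1 / (2 * \<i>)) * (g A * (\<i> * - \<omega> * aZ (\<i> * - \<omega>) A * u A) + g' A * aX (\<i> *
          - \<omega>) A)) (at A within {A..B})"
    by (intro has_vector_derivative_add has_vector_derivative_mult_right spps_deriv A)
  then have "((\<lambda>y. 1 / (2 * \<i>) * spps \<omega> y + (- 1 / (2 * \<i>)) * spps (- \<omega>) y)
      has_vector_derivative \<omega> * (g A * u A)) (at A within {A..B})"
    by (simp only: aX_A aZ_A) (simp add: field_simps)
  \<comment> \<open>The identity for \<open>u\<close> at A, where \<open>G\<close> equals 1.\<close>
  moreover have "g A * u A = 1 / of_real (\<rho> A) * of_real (sqrt (r A / p A))"
    using G_u[OF A] by (simp add: G_A gA dl_def)
  ultimately have "((\<lambda>y. 1 / (2 * \<i>) * spps \<omega> y + (- 1 / (2 * \<i>)) * spps (- \<omega>) y)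
      has_vector_derivative
      \<omega> / of_real (\<rho> A) * of_real (sqrt (r A / p A))) (at A within {A..B})"
    by simp
  then show ?thesis by (rule has_vector_derivative_transform[OF A, rotated], intro v2_eq)
qed

text \<open>The value at A isolates \<open>c1\<close>; the derivative at A then isolates
  \<open>c2\<close>, being a nonzero multiple of \<omega>.\<close>

lemma v_independent:
  assumes "\<omega> \<noteq> 0" and zero: "\<And>y. y \<in> {A..B} \<Longrightarrow> c1 * v1 A p r g \<omega> y
      + c2 * v2 A p r g \<omega> y = 0"
  shows "c1 = 0 \<and> c2 = 0"
proof -
  have A: "A \<in> {A..B}" using AB by simp
  let ?d = "\<omega> / of_real (\<rho> A) * of_real (sqrt (r A / p A))"
  have c1: "c1 = 0" using zero[OF A] rho_pos[OF A] by (simp add: v_at_A)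
  have "((\<lambda>y. 0) has_vector_derivative c2 * ?d) (at A within {A..B})"
    by (rule has_vector_derivative_transform[OF A _ has_vector_derivative_mult_right[OF v2_deriv_A]])
      (use zero c1 in auto)
  then have "c2 * ?d = 0"
    using vector_derivative_unique_within_closed_interval[OF AB, of A "\<lambda>y. 0 :: complex" "c2 * ?d" 0] A
    by simp
  moreover have "?d \<noteq> 0" using assms(1) rho_pos[OF A] p_pos[OF A] r_pos[OF A] by simp
  ultimately show ?thesis using c1 by simp
qed

section \<open>Uniform convergence\<close>

lemma term_bound:
  "\<exists>M. summable M \<and> (\<forall>n. M n \<ge> 0) \<and> (\<forall>n. \<forall>y\<in>{A..B}.
      \<forall>\<omega>. cmod \<omega> \<le> b \<longrightarrow>
     cmod (\<alpha> n y * spherical_bessel_j n (\<omega> * of_real (l y))) \<le> M n)"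
proof (cases "b \<ge> 0")
  case False
  have "cmod \<omega> > b" for \<omega> :: complex using False norm_ge_zero[of \<omega>] by linarith
  then show ?thesis by (intro exI[of _ "\<lambda>_. 0"]) (auto simp: not_le[symmetric])
next
  case True
  obtain C where C: "C \<ge> 0" "\<And>y n. y \<in> {A<..B} \<Longrightarrow> cmod (alpha_formula A p r g n y)
      \<le> 3 ^ n * (3 / 2 * C * l y)"
    using alpha_bound by blast
  define R where "R = b * l B"
  have lB: "l B \<ge> 0" using l_nonneg AB by simp
  then have "R \<ge> 0" using True by (simp add: R_def)
  \<comment> \<open>\<open>R\<close> bounds the argument of the Bessel functions. The growth 3^n of
    alpha_n is outweighed by the factor 1/n! of j_n.\<close>
  define M where "M n = 3 / 2 * C * l B * exp (R\<^sup>2 / 4) * ((3 * R / 2) ^ n / fact n)" for n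
  show ?thesis
  proof (intro exI[of _ M] conjI allI ballI impI)
    show "summable M" unfolding M_def by (intro summable_mult sums_summable[OF exp_sums])
    show nn: "M n \<ge> 0" for n unfolding M_def using C(1) lB \<open>R \<ge> 0\<close> by simp
    fix n y \<omega> assume y: "y \<in> {A..B}" and \<omega>: "cmod \<omega> \<le> b"
    show "cmod (\<alpha> n y * spherical_bessel_j n (\<omega> * of_real (l y))) \<le> M n"
    proof (cases "y = A")
      case True
      then show ?thesis using nn by simp
    next
      case False
      have ly: "0 \<le> l y" "l y \<le> l B" using l_nonneg[OF y] l_mono[of y B] y by auto
      let ?z = "\<omega> * of_real (l y)"
      have z: "cmod ?z \<le> R" unfolding R_def norm_mult using \<omega> ly True by (intro mult_mono) auto
      have "cmod (\<alpha> n y) \<le> 3 ^ n * (3 / 2 * C * l y)"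
        using C(2)[of y n] y False by (simp add: alpha_def)
      also have "\<dots> \<le> 3 ^ n * (3 / 2 * C * l B)"
        using ly C(1) by (intro mult_left_mono) auto
      finally have 1: "cmod (\<alpha> n y) \<le> 3 ^ n * (3 / 2 * C * l B)" .
      have "cmod (spherical_bessel_j n ?z) \<le> (cmod ?z / 2) ^ n / fact n * exp ((cmod ?z)\<^sup>2 / 4)"
        by (rule norm_spherical_bessel_le)
      also have "\<dots> \<le> (R / 2) ^ n / fact n * exp (R\<^sup>2 / 4)"
        using z \<open>R \<ge> 0\<close> by (intro mult_mono divide_right_mono power_mono) (auto intro!:
            divide_right_mono power_mono)
      finally have 2: "cmod (spherical_bessel_j n ?z) \<le> (R / 2) ^ n / fact n * exp (R\<^sup>2 / 4)" .
      have "cmod (\<alpha> n y * spherical_bessel_j n ?z) \<le> 3 ^ n * (3 / 2 * C * l B)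
          * ((R / 2) ^ n / fact n * exp (R\<^sup>2 / 4))"
        unfolding norm_mult using 1 2 C(1) lB by (intro mult_mono) auto
      also have "\<dots> = M n" by (simp add: M_def power_mult_distrib power_divide)
      finally show ?thesis .
    qed
  qed
qed

lemma norm_term1: "cmod (term1 A p r g \<omega> y n) = cmod (\<alpha> (2 * n) y * spherical_bessel_j (2 * n)
    (\<omega> * of_real (l y)))"
  and norm_term2: "cmod (term2 A p r g \<omega> y n) = cmod (\<alpha> (2 * n + 1) y * spherical_bessel_j (2 * n
      + 1) (\<omega> * of_real (l y)))"
  by (simp_all add: term1_def term2_def norm_mult norm_power)

lemma uniform_convergence:
  assumes "compact K"
  shows "uniform_limit ({A..B} \<times> K)
      (\<lambda>N (y, \<omega>). \<Sum>n<N. term1 A p r g \<omega> y n) (\<lambda>(y, \<omega>). \<Sum>n. term1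
          A p r g \<omega> y n) sequentially"
    and "uniform_limit ({A..B} \<times> K)
      (\<lambda>N (y, \<omega>). \<Sum>n<N. term2 A p r g \<omega> y n) (\<lambda>(y, \<omega>). \<Sum>n. term2
          A p r g \<omega> y n) sequentially"
proof -
  obtain b where b: "\<And>\<omega>. \<omega> \<in> K \<Longrightarrow> cmod \<omega> \<le> b"
    using compact_imp_bounded[OF assms] unfolding bounded_iff by blast
  obtain M where M: "summable M" "\<And>n. M n \<ge> 0"
    "\<And>n y \<omega>. y \<in> {A..B} \<Longrightarrow> cmod \<omega> \<le> b \<Longrightarrow> cmod
        (\<alpha> n y * spherical_bessel_j n (\<omega> * of_real (l y))) \<le> M n"
    using term_bound[of b] by blast
  have sM: "summable (\<lambda>n. M (2 * n))" "summable (\<lambda>n. M (2 * n + 1))"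
    using summable_reindex[OF M(1) _ M(2), of "\<lambda>n. 2 * n"] summable_reindex[OF M(1) _ M(2), of
        "\<lambda>n. 2 * n + 1"]
    by (auto simp: o_def inj_on_def)
  show "uniform_limit ({A..B} \<times> K)
      (\<lambda>N (y, \<omega>). \<Sum>n<N. term1 A p r g \<omega> y n) (\<lambda>(y, \<omega>). \<Sum>n. term1
          A p r g \<omega> y n) sequentially"
    unfolding case_prod_beta
    by (rule Weierstrass_m_test[OF _ sM(1)]) (auto simp: norm_term1 intro!: M(3) b)
  show "uniform_limit ({A..B} \<times> K)
      (\<lambda>N (y, \<omega>). \<Sum>n<N. term2 A p r g \<omega> y n) (\<lambda>(y, \<omega>). \<Sum>n. term2
          A p r g \<omega> y n) sequentially"
    unfolding case_prod_beta
    by (rule Weierstrass_m_test[OF _ sM(2)])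
      (auto simp: norm_term2 simp del: of_nat_Suc intro!: M(3) b)
qed

section \<open>The error estimate\<close>

definition bessel_tail :: "nat \<Rightarrow> real \<Rightarrow> real" where
  "bessel_tail N y = (\<Sum>n. (2 * real (n + Suc N) + 1) * (cmod (\<Lambda> y (n + Suc N)))\<^sup>2)"

lemma summable_bessel:
  assumes "y \<in> {A<..B}"
  shows "summable (\<lambda>n. (2 * real n + 1) * (cmod (\<Lambda> y n))\<^sup>2)"
proof -
  obtain C where "bounded_moment_functional (moment y) (C * l y)"
    using moment_bounded assms by blast
  from bounded_moment_functional.legendre_bessel_inequality[OF this] show ?thesis
    by (intro bounded_imp_summable) auto
qed

lemma bessel_tail_nonneg: "y \<in> {A<..B} \<Longrightarrow> bessel_tail N y \<ge> 0"
  unfolding bessel_tail_def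
  by (intro suminf_nonneg summable_ignore_initial_segment[OF summable_bessel]) auto

lemma bessel_tail_tendsto:
  assumes "y \<in> {A<..B}"
  shows "(\<lambda>N. bessel_tail N y) \<longlonglongrightarrow> 0"
proof -
  define b where "b n = (2 * real n + 1) * (cmod (\<Lambda> y n))\<^sup>2" for n
  have b: "summable b" unfolding b_def[abs_def] by (rule summable_bessel[OF assms])
  have "(\<lambda>N. suminf b - (\<Sum>n<Suc N. b n)) \<longlonglongrightarrow> suminf b - suminf b"
    by (intro tendsto_intros LIMSEQ_Suc[OF summable_LIMSEQ[OF b]])
  moreover have "bessel_tail N y = suminf b - (\<Sum>n<Suc N. b n)" for N
    unfolding bessel_tail_def b_def[symmetric] by (rule suminf_minus_initial_segment[OF b])
  ultimately show ?thesis by simp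
qed

text \<open>Serves both series: \<open>\<phi>\<close> lists the even or the odd indices, and
  \<open>k\<close> is the number of terms kept. Cauchy-Schwarz splits the weight 2n + 1 evenly
  between the functional and the Bessel functions, and the 1/2 in alpha_n cancels the 2 in front.
  The tail counts every n > N of either parity, so one error function covers both solutions.\<close>

lemma tail_bound:
  assumes y: "y \<in> {A<..B}" and \<phi>: "inj \<phi>" "\<And>n. n \<ge> k \<Longrightarrow> \<phi> n > N" and
      C: "\<bar>Im \<omega>\<bar> \<le> C"
    and t: "summable t" "\<And>n. cmod (t n) = cmod (\<alpha> (\<phi> n) y * spherical_bessel_j (\<phi> n)
        (\<omega> * of_real (l y)))"
  shows "cmod (2 * suminf t - 2 * (\<Sum>n<k. t n)) \<le> sqrt (bessel_tail N y) * sqrt (sinhc (C * l y))"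
proof -
  let ?z = "\<omega> * of_real (l y)"
  have Imz: "\<bar>Im ?z\<bar> \<le> C * l y"
    using C l_pos[OF y] by (simp add: abs_mult mult_right_mono)
  have partial: "cmod (\<Sum>n<m. t (n + k)) \<le> 1 / 2 * (sqrt (bessel_tail N y) * sqrt (sinhc (C * l y)))" for m
  proof -
    define a where "a n = sqrt (2 * real (\<phi> (n + k)) + 1) * cmod (\<Lambda> y (\<phi> (n + k)))" for n
    define c where "c n = sqrt (2 * real (\<phi> (n + k)) + 1) * cmod (spherical_bessel_j (\<phi> (n + k)) ?z)" for n
    have "cmod (t (n + k)) = 1 / 2 * (\<bar>a n\<bar> * \<bar>c n\<bar>)" for n
    proof -
      have "cmod (t (n + k)) = (2 * real (\<phi> (n + k)) + 1) / 2 * cmod (\<Lambda> y (\<phi> (n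
          + k))) * cmod (spherical_bessel_j (\<phi> (n + k)) ?z)"
        unfolding t(2) alpha_eq[OF y] norm_mult norm_of_real by simp
      also have "2 * real (\<phi> (n + k)) + 1 = sqrt (2 * real (\<phi> (n + k))
          + 1) * sqrt (2 * real (\<phi> (n + k)) + 1)"
        by simp
      finally show ?thesis by (simp only: a_def c_def) (simp add: abs_mult mult_ac)
    qed
    then have "cmod (\<Sum>n<m. t (n + k)) \<le> (\<Sum>n<m. 1 / 2 * (\<bar>a n\<bar> * \<bar>c n\<bar>))"
      by (intro sum_norm_le) auto
    also have "\<dots> = 1 / 2 * (\<Sum>n<m. \<bar>a n\<bar> * \<bar>c n\<bar>)" by (simp only: sum_distrib_left)
    also have "\<dots> \<le> 1 / 2 * (L2_set a {..<m} * L2_set c {..<m})"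
      by (intro mult_left_mono L2_set_mult_ineq) auto
    also have "\<dots> \<le> 1 / 2 * (sqrt (bessel_tail N y) * sqrt (sinhc (C * l y)))"
    proof (intro mult_left_mono mult_mono)
      \<comment> \<open>The omitted indices exceed N, so shifting them down by \<open>Suc N\<close>
        loses nothing and embeds the sum in the tail.\<close>
      have "(\<Sum>n<m. (a n)\<^sup>2) = (\<Sum>n<m. (\<lambda>n. (2 * real (n + Suc N) + 1)
          * (cmod (\<Lambda> y (n + Suc N)))\<^sup>2) (\<phi> (n + k) - Suc N))"
      proof (rule sum.cong[OF refl])
        fix n
        have "\<phi> (n + k) - Suc N + Suc N = \<phi> (n + k)" using \<phi>(2)[of "n + k"] by simp
        then show "(a n)\<^sup>2 = (\<lambda>n. (2 * real (n + Suc N) + 1) * (cmod (\<Lambda> y (n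
            + Suc N)))\<^sup>2) (\<phi> (n + k) - Suc N)"
          by (simp only: a_def) (simp add: power_mult_distrib)
      qed
      also have "\<dots> = (\<Sum>n\<in>(\<lambda>n. \<phi> (n + k) - Suc N) ` {..<m}. (2 * real (n + Suc N)
          + 1) * (cmod (\<Lambda> y (n + Suc N)))\<^sup>2)"
      proof (subst sum.reindex)
        show "inj_on (\<lambda>n. \<phi> (n + k) - Suc N) {..<m}"
        proof (rule inj_onI)
          fix i j assume "\<phi> (i + k) - Suc N = \<phi> (j + k) - Suc N"
          then have "\<phi> (i + k) = \<phi> (j + k)"
            using \<phi>(2)[of "i + k"] \<phi>(2)[of "j + k"] by simp
          then show "i = j" using \<phi>(1) by (simp add: inj_eq)
        qed
      qed (simp only: o_def)
      also have "\<dots> \<le> bessel_tail N y"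
        unfolding bessel_tail_def
        by (intro sum_le_suminf summable_ignore_initial_segment[OF summable_bessel[OF y]]) auto
      finally show "L2_set a {..<m} \<le> sqrt (bessel_tail N y)"
        unfolding L2_set_def by (rule real_sqrt_le_mono)
      have "(\<Sum>n<m. (c n)\<^sup>2) = (\<Sum>n<m. (\<lambda>n. (2 * real n + 1)
          * (cmod (spherical_bessel_j n ?z))\<^sup>2) (\<phi> (n + k)))"
        by (simp add: c_def power_mult_distrib)
      also have "\<dots> = (\<Sum>n\<in>(\<lambda>n. \<phi> (n + k)) ` {..<m}. (2 * real n + 1)
          * (cmod (spherical_bessel_j n ?z))\<^sup>2)"
      proof (subst sum.reindex)
        show "inj_on (\<lambda>n. \<phi> (n + k)) {..<m}"
          using \<phi>(1) by (intro inj_onI) (simp add: inj_eq)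
      qed (simp only: o_def)
      \<comment> \<open>For m = 0 the bound is the unspecified \<open>Max {}\<close>, which is
        harmless because the sum on the left is then empty.\<close>
      also have "\<dots> \<le> (\<Sum>n\<le>Max ((\<lambda>n. \<phi> (n + k)) ` {..<m}). (2 * real n + 1)
          * (cmod (spherical_bessel_j n ?z))\<^sup>2)"
        by (intro sum_mono2) auto
      also have "\<dots> \<le> sinhc (C * l y)"
        using spherical_bessel_sum_le[of ?z] sinhc_mono[OF Imz] by (rule order.trans)
      finally show "L2_set c {..<m} \<le> sqrt (sinhc (C * l y))"
        unfolding L2_set_def by (rule real_sqrt_le_mono)
    qed (auto simp: bessel_tail_nonneg[OF y] L2_set_nonneg)
    finally show ?thesis .
  qed
  have "(\<lambda>m. \<Sum>n<m. t (n + k)) \<longlonglongrightarrow> (\<Sum>n. t (n + k))"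
    by (intro summable_LIMSEQ summable_ignore_initial_segment t(1))
  then have "cmod (\<Sum>n. t (n + k)) \<le> 1 / 2 * (sqrt (bessel_tail N y) * sqrt (sinhc (C * l y)))"
    using partial by (intro LIMSEQ_le_const2[OF tendsto_norm]) auto
  moreover have "2 * suminf t - 2 * (\<Sum>n<k. t n) = 2 * (\<Sum>n. t (n + k))"
    by (simp add: suminf_minus_initial_segment[OF t(1)] right_diff_distrib)
  ultimately show ?thesis by (simp add: norm_mult)
qed

text \<open>Found by solving the desired inequality: \<open>sinh_quot C x\<close> is
  \<open>2 * x * sinhc (C * x)\<close>, so dividing the tail by 2x and by the maximum of 1/rho
  leaves what the tail estimate provides. Since l is injective, y can be recovered from x. At x = 0
  the default value 0 is right, as no error occurs at y = A.\<close>

definition err :: "nat \<Rightarrow> real \<Rightarrow> real" where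
  "err N x = (if x \<in> l ` {A<..B}
     then sqrt (bessel_tail N (inv_into {A<..B} l x) / (2 * x)) / max_inv_rho A B p r else 0)"

lemma max_inv_rho_pos: "max_inv_rho A B p r > 0"
proof -
  have "continuous_on {A..B} (\<lambda>y. 1 / \<bar>\<rho> y\<bar>)"
    using rho_pos by (auto intro!: continuous_intros rho_cont simp: less_le)
  then have "bdd_above ((\<lambda>y. 1 / \<bar>\<rho> y\<bar>) ` {A..B})"
    by (intro bounded_imp_bdd_above compact_imp_bounded compact_continuous_image compact_Icc)
  then have "1 / \<bar>\<rho> A\<bar> \<le> max_inv_rho A B p r"
    unfolding max_inv_rho_def using AB by (intro cSUP_upper) auto
  moreover have "1 / \<bar>\<rho> A\<bar> > 0" using rho_pos[of A] AB by simp
  ultimately show ?thesis by linarith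
qed

lemma l_inj: "inj_on l {A<..B}"
proof (rule linorder_inj_onI)
  show "l x \<noteq> l y" if "x < y" "x \<in> {A<..B}" "y \<in> {A<..B}" for x y
    using l_strict_mono[of x y] that by auto
qed auto

lemma err_eq:
  "y \<in> {A<..B} \<Longrightarrow> err N (l y) = sqrt (bessel_tail N y / (2 * l y)) / max_inv_rho A B p r"
  using l_inj by (simp add: err_def)

lemma err_nonneg: "err N x \<ge> 0"
proof (cases "x \<in> l ` {A<..B}")
  case True
  then obtain y where y: "y \<in> {A<..B}" "x = l y" by blast
  then show ?thesis
    using err_eq[OF y(1), of N] bessel_tail_nonneg[OF y(1), of N] l_pos[OF y(1)] max_inv_rho_pos by simp
qed (auto simp: err_def)

lemma err_tendsto: "(\<lambda>N. err N x) \<longlonglongrightarrow> 0"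
proof (cases "x \<in> l ` {A<..B}")
  case True
  then obtain y where y: "y \<in> {A<..B}" "x = l y" by blast
  have "(\<lambda>N. sqrt (bessel_tail N y / (2 * l y)) / max_inv_rho A B p r) \<longlonglongrightarrow> sqrt
      (0 / (2 * l y)) / max_inv_rho A B p r"
    using l_pos[OF y(1)] max_inv_rho_pos by (intro tendsto_intros bessel_tail_tendsto y) auto
  then show ?thesis by (simp add: y(2) err_eq[OF y(1)])
qed (auto simp: err_def)

text \<open>The estimate in the strip; real \<omega> is the case C = 0, where
  \<open>sinh_quot\<close> is 2x.\<close>

lemma err_bound:
  assumes y: "y \<in> {A..B}" and C: "\<bar>Im \<omega>\<bar> \<le> C"
  shows "cmod (v1 A p r g \<omega> y - v1_approx A p r g N \<omega> y)
      \<le> err N (l y) * sqrt (sinh_quot C (l y)) * max_inv_rho A B p r"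
    and "cmod (v2 A p r g \<omega> y - v2_approx A p r g N \<omega> y)
      \<le> err N (l y) * sqrt (sinh_quot C (l y)) * max_inv_rho A B p r"
proof -
  have d1: "v1 A p r g \<omega> y - v1_approx A p r g N \<omega> y
      = 2 * suminf (term1 A p r g \<omega> y) - 2 * (\<Sum>n<Suc (N div 2). term1 A p r g \<omega> y n)"
    by (simp add: v1_def v1_approx_def lessThan_Suc_atMost)
  have d2: "v2 A p r g \<omega> y - v2_approx A p r g N \<omega> y
      = 2 * suminf (term2 A p r g \<omega> y) - 2 * (\<Sum>n<(N + 1) div 2. term2 A p r g \<omega> y n)"
    by (simp add: v2_def v2_approx_def)
  have "cmod (v1 A p r g \<omega> y - v1_approx A p r g N \<omega> y) \<le> err N (l y) * sqrt (sinh_quot C (l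
      y)) * max_inv_rho A B p r
      \<and> cmod (v2 A p r g \<omega> y - v2_approx A p r g N \<omega> y) \<le> err N (l y) * sqrt (sinh_quot
          C (l y)) * max_inv_rho A B p r"
  proof (cases "y = A")
    case True
    \<comment> \<open>All alpha_n vanish at A, so the error is 0, and so is the bound, because
      \<open>sinh_quot C 0\<close> is 0.\<close>
    have "term1 A p r g \<omega> A = (\<lambda>_. 0)" "term2 A p r g \<omega> A = (\<lambda>_. 0)"
      by (auto simp: term1_def term2_def)
    then show ?thesis unfolding d1 d2 by (simp add: True sinh_quot_def)
  next
    case False
    then have y': "y \<in> {A<..B}" using y by auto
    have "err N (l y) * sqrt (sinh_quot C (l y)) * max_inv_rho A B p r
        = sqrt (bessel_tail N y / (2 * l y)) * sqrt (2 * l y * sinhc (C * l y))"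
      using max_inv_rho_pos by (simp add: err_eq[OF y'] sinh_quot_sinhc l_pos[OF y'])
    also have "\<dots> = sqrt (bessel_tail N y) * sqrt (sinhc (C * l y))"
      using l_pos[OF y'] by (simp add: real_sqrt_mult real_sqrt_divide)
    finally have e: "err N (l y) * sqrt (sinh_quot C (l y)) * max_inv_rho A B p r
        = sqrt (bessel_tail N y) * sqrt (sinhc (C * l y))" .
    show ?thesis unfolding d1 d2 e
    proof
      show "cmod (2 * suminf (term1 A p r g \<omega> y) - 2 * (\<Sum>n<Suc (N div 2). term1 A p r g \<omega> y n))
          \<le> sqrt (bessel_tail N y) * sqrt (sinhc (C * l y))"
        by (rule tail_bound[OF y' _ _ C sums_summable[OF term1_sums[OF y]] norm_term1]) (auto simp: inj_def)
      show "cmod (2 * suminf (term2 A p r g \<omega> y) - 2 * (\<Sum>n<(N + 1) div 2. term2 A p r g \<omega> y n))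
          \<le> sqrt (bessel_tail N y) * sqrt (sinhc (C * l y))"
        by (rule tail_bound[OF y' _ _ C sums_summable[OF term2_sums[OF y]] norm_term2]) (auto simp: inj_def)
    qed
  qed
  then show "cmod (v1 A p r g \<omega> y - v1_approx A p r g N \<omega> y)
      \<le> err N (l y) * sqrt (sinh_quot C (l y)) * max_inv_rho A B p r"
    "cmod (v2 A p r g \<omega> y - v2_approx A p r g N \<omega> y)
      \<le> err N (l y) * sqrt (sinh_quot C (l y)) * max_inv_rho A B p r" by auto
qed

lemma v_solves:
  assumes pg': "\<And>y. y \<in> {A..B} \<Longrightarrow>
      ((\<lambda>s. complex_of_real (p s) * g' s) has_vector_derivative q y * g y) (at y within {A..B})"
  shows "sl_solves A B p q (\<lambda>y. - \<omega>\<^sup>2 * complex_of_real (r y) * v1 A p r g \<omega> y) (v1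
      A p r g \<omega>)"
    and "sl_solves A B p q (\<lambda>y. - \<omega>\<^sup>2 * complex_of_real (r y) * v2 A p r g \<omega> y) (v2
        A p r g \<omega>)"
proof -
  have sq: "(\<i> * \<omega>)\<^sup>2 = - \<omega>\<^sup>2" "(\<i> * - \<omega>)\<^sup>2 = - \<omega>\<^sup>2"
      by (simp_all add: power_mult_distrib)
  note solves = spps_solves[OF pg', of "\<i> * \<omega>", unfolded sq] spps_solves[OF pg', of "\<i> *
      - \<omega>", unfolded sq]
  show "sl_solves A B p q (\<lambda>y. - \<omega>\<^sup>2 * complex_of_real (r y) * v1 A p r g \<omega> y) (v1
      A p r g \<omega>)"
    by (rule sl_solves_lincomb[OF solves v1_eq]) (auto simp only: v1_eq algebra_simps)
  show "sl_solves A B p q (\<lambda>y. - \<omega>\<^sup>2 * complex_of_real (r y) * v2 A p r g \<omega> y) (v2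
      A p r g \<omega>)"
    by (rule sl_solves_lincomb[OF solves v2_eq]) (auto simp only: v2_eq algebra_simps)
qed

end

theorem theorem4p1:
  fixes A B :: real
    and p p' r r' :: "real \<Rightarrow> real"
    and q g :: "real \<Rightarrow> complex"
  assumes "A < B"
    and "continuous_on {A..B} q"
    and "\<forall>y\<in>{A..B}. (p has_real_derivative p' y) (at y within {A..B})"
    and "\<forall>y\<in>{A..B}. (r has_real_derivative r' y) (at y within {A..B})"
    and "abs_continuous_on_interval A B p" "abs_continuous_on_interval A B p'"
    and "abs_continuous_on_interval A B r" "abs_continuous_on_interval A B r'"
    and "\<forall>y\<in>{A..B}. p y > 0" "\<forall>y\<in>{A..B}. r y > 0"
    and "sl_solves A B p q (\<lambda>y. 0) g"
    and "g A = 1 / complex_of_real (sl_rho p r A)"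
    and "\<forall>y\<in>{A..B}. g y \<noteq> 0"
  shows
    \<comment> \<open>the limits defining \<open>\<alpha>\<^sub>n(A)\<close> exist\<close>
    "(\<forall>n. \<exists>L. (alpha_formula A p r g n \<longlongrightarrow> L) (at_right A))
     \<and> (\<forall>\<omega>. \<omega> \<noteq> 0 \<longrightarrow>
          sl_solves A B p q (\<lambda>y. - \<omega>\<^sup>2 * complex_of_real (r y) * v1 A p r g \<omega> y) (v1 A p r g \<omega>)
        \<and> sl_solves A B p q (\<lambda>y. - \<omega>\<^sup>2 * complex_of_real (r y) * v2 A p r g \<omega> y) (v2 A p r g \<omega>)
        \<and> (\<forall>c1 c2. (\<forall>y\<in>{A..B}. c1 * v1 A p r g \<omega> y + c2 * v2 A p r g \<omega> y = 0)
              \<longrightarrow> c1 = 0 \<and> c2 = 0)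
        \<and> v1 A p r g \<omega> A = 1 / complex_of_real (sl_rho p r A)
        \<and> v2 A p r g \<omega> A = 0
        \<and> (v1 A p r g \<omega> has_vector_derivative vector_derivative g (at A within {A..B}))
              (at A within {A..B})
        \<and> (v2 A p r g \<omega> has_vector_derivative
              \<omega> / complex_of_real (sl_rho p r A) * complex_of_real (sqrt (r A / p A)))
              (at A within {A..B}))
     \<and> (\<forall>K. compact K \<longrightarrow>
          uniform_limit ({A..B} \<times> K)
            (\<lambda>M (y, \<omega>). \<Sum>n<M. term1 A p r g \<omega> y n) (\<lambda>(y, \<omega>). \<Sum>n. term1 A p r g \<omega> y n) sequentially
        \<and> uniform_limit ({A..B} \<times> K)
            (\<lambda>M (y, \<omega>). \<Sum>n<M. term2 A p r g \<omega> y n) (\<lambda>(y, \<omega>). \<Sum>n. term2 A p r g \<omega> y n) sequentially)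
     \<and> (\<exists>\<epsilon> :: nat \<Rightarrow> real \<Rightarrow> real.
          (\<forall>N. \<forall>x\<in>{0..sl_l A p r B}. \<epsilon> N x \<ge> 0)
        \<and> (\<forall>x\<in>{0..sl_l A p r B}. (\<lambda>N. \<epsilon> N x) \<longlonglongrightarrow> 0)
        \<and> (\<forall>N. \<forall>y\<in>{A..B}. \<forall>\<omega>. \<omega> \<noteq> 0 \<and> \<omega> \<in> \<real> \<longrightarrow>
              cmod (v1 A p r g \<omega> y - v1_approx A p r g N \<omega> y)
                \<le> sqrt (2 * sl_l A p r y) * \<epsilon> N (sl_l A p r y) * max_inv_rho A B p r
            \<and> cmod (v2 A p r g \<omega> y - v2_approx A p r g N \<omega> y)
                \<le> sqrt (2 * sl_l A p r y) * \<epsilon> N (sl_l A p r y) * max_inv_rho A B p r)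
        \<and> (\<forall>N. \<forall>y\<in>{A..B}. \<forall>C\<ge>0. \<forall>\<omega>. \<omega> \<noteq> 0 \<and> \<bar>Im \<omega>\<bar> \<le> C \<longrightarrow>
              cmod (v1 A p r g \<omega> y - v1_approx A p r g N \<omega> y)
                \<le> \<epsilon> N (sl_l A p r y) * sqrt (sinh_quot C (sl_l A p r y)) * max_inv_rho A B p r
            \<and> cmod (v2 A p r g \<omega> y - v2_approx A p r g N \<omega> y)
                \<le> \<epsilon> N (sl_l A p r y) * sqrt (sinh_quot C (sl_l A p r y)) * max_inv_rho A B p r))"
proof -
  obtain g' w where gw: "\<forall>y\<in>{A..B}. (g has_vector_derivative g' y) (at y within {A..B}) \<and>
      ((\<lambda>s. complex_of_real (p s) * g' s) has_vector_derivative w y) (at y within {A..B}) \<and>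
      w y - q y * g y = 0"
    using assms(11) unfolding sl_solves_def by (elim exE)
  have g: "\<And>y. y \<in> {A..B} \<Longrightarrow> (g has_vector_derivative g' y) (at y within {A..B})"
    and w: "\<And>y. y \<in> {A..B} \<Longrightarrow> ((\<lambda>s. complex_of_real (p s) * g' s)
        has_vector_derivative w y) (at y within {A..B})"
      "\<And>y. y \<in> {A..B} \<Longrightarrow> w y - q y * g y = 0"
    using gw by blast+
  have pg': "((\<lambda>s. complex_of_real (p s) * g' s) has_vector_derivative q y * g y) (at y within {A..B})"
    if "y \<in> {A..B}" for y
    using w(1)[OF that] w(2)[OF that] by simp
  have pg'_cont: "continuous_on {A..B} (\<lambda>s. complex_of_real (p s) * g' s)"
    using w(1) by (meson continuous_on_eq_continuous_within has_vector_derivative_continuous)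
  \<comment> \<open>Continuity of g' comes from dividing the differentiable function p g' by p; it
    makes \<open>\<tau>\<close> continuous and hence bounded.\<close>
  have "continuous_on {A..B} (\<lambda>s. complex_of_real (p s) * g' s / complex_of_real (p s))"
    by (rule continuous_on_divide[OF pg'_cont continuous_on_of_real[OF abs_continuous_imp_continuous[OF assms(5)]]])
      (use assms(9) in force)
  then have g'_cont: "continuous_on {A..B} g'"
    by (rule continuous_on_eq) (use assms(9) in \<open>auto simp: less_le\<close>)
  interpret liouville A B p r p' r' g g'
    using assms g g'_cont by unfold_locales (auto intro: abs_continuous_imp_continuous)
  have A: "A \<in> {A..B}" using assms(1) by simp
  have vd: "vector_derivative g (at A within {A..B}) = g' A"
    using vector_derivative_within_cbox[of A B A g "g' A"] g[OF A] assms(1) by simp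
  have real: "cmod (v1 A p r g \<omega> y - v1_approx A p r g N \<omega> y)
        \<le> sqrt (2 * sl_l A p r y) * err N (sl_l A p r y) * max_inv_rho A B p r
      \<and> cmod (v2 A p r g \<omega> y - v2_approx A p r g N \<omega> y)
        \<le> sqrt (2 * sl_l A p r y) * err N (sl_l A p r y) * max_inv_rho A B p r"
    if "y \<in> {A..B}" "\<omega> \<in> \<real>" for y \<omega> N
    using err_bound[OF that(1), of \<omega> 0 N] that(2)
    by (simp add: sinh_quot_def complex_is_Real_iff mult_ac)
  show ?thesis
    unfolding vd
  proof (intro conjI, goal_cases)
    case 1
    then show ?case using alpha_limit by blast
  next
    case 2
    then show ?case
    proof (intro allI impI conjI)
      fix \<omega> c1 c2 :: complex
      assume "\<omega> \<noteq> 0" and zero: "\<forall>y\<in>{A..B}. c1 * v1 A p r g \<omega> y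
          + c2 * v2 A p r g \<omega> y = 0"
      show "c1 = 0" "c2 = 0"
        using v_independent[OF \<open>\<omega> \<noteq> 0\<close> bspec[OF zero]] by auto
    qed (rule v_solves[OF pg'] v_at_A v1_deriv_A v2_deriv_A, assumption?)+
  next
    case 3
    then show ?case using uniform_convergence by blast
  next
    case 4
    \<comment> \<open>The same \<open>err\<close> serves both estimates; goals 3 and 4 are the ones
      for real \<omega>.\<close>
    then show ?case
    proof (intro exI[of _ err] conjI allI ballI impI, goal_cases)
      case (3 N y \<omega>)
      then show ?case using real by blast
    next
      case (4 N y \<omega>)
      then show ?case using real by blast
    qed (auto intro: err_nonneg err_tendsto err_bound)
  qed
qed

end
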